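(* Let $G$ be a finite simple connected graph satisfying condition $(\sharp)$. (1) Let $M$ be an indispensable monomial of $I_{\mathcal{A}_G}$ that is not quadratic. Then $\{\mathrm{supp}(M)\}$ is a connected component of $\Gamma_G$ if and only if every even closed walk $w$ of $G$ such that $M$ is a monomial of $B_w$ has an $\mathcal{F}_4$. (2) Every connected component of $\Gamma_G$ is either a vertex, an edge, or a $2$-simplex.
   Context: $G$ has vertices $v_1,\ldots,v_n$, edges $e_1,\ldots,e_m$; for $e_i=\{v_j,v_k\}$, $\mathbf a_i\in\mathbb{Z}^n$ has $1$ in positions $j,k$ and $0$ elsewhere; $\mathcal{A}_G=\{\mathbf a_i\}$; $I_{\mathcal{A}_G}\subset K[x_1,\ldots,x_m]$ is the kernel of $x_i\mapsto\mathbf t^{\mathbf a_i}$. Condition $(\sharp)$: no induced subgraph of $G$ consists of two vertex-disjoint odd cycles joined by a path of length $\ge1$. For an even closed walk $w=(e_{i_1},\ldots,e_{i_{2s}})$, $B_w=\prod_k x_{i_{2k-1}}-\prod_k x_{i_{2k}}$; edges in odd positions are odd edges of $w$, those in even positions even edges. A binomial $\mathbf x^{\mathbf u_+}-\mathbf x^{\mathbf u_-}$ is primitive if it is irreducible and there is no other binomial $\mathbf x^{\mathbf v_+}-\mathbf x^{\mathbf v_-}\in I_{\mathcal{A}_G}$ with $\mathbf x^{\mathbf v_+}\mid\mathbf x^{\mathbf u_+}$, $\mathbf x^{\mathbf v_-}\mid\mathbf x^{\mathbf u_-}$; $w$ is primitive if $B_w$ is. For a primitive walk $w=(\{v_1,v_2\},\{v_2,v_3\},\ldots,\{v_{2s},v_1\})$,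 a chord $e=\{v_k,v_l\}$ ($k<l$) is an edge of $G$ not in $w$ joining two vertices of $w$; it splits $w$ into $\gamma_1=(e_1,\ldots,e_{k-1},e,e_l,\ldots,e_{2s})$ and $\gamma_2=(e_k,\ldots,e_{l-1},e)$. It is a bridge if $v_k,v_l$ lie in different blocks (maximal subgraphs without cut vertex) of $w$ viewed as a subgraph, and it is an odd chord if it is not a bridge and both $\gamma_1,\gamma_2$ have odd length. Two odd chords $\{v_t,v_j\}$, $\{v_{t'},v_{j'}\}$ ($t<j$, $t'<j'$) cross effectively if $t'-t$ is odd and $t<t'<j<j'$ or $t'<t<j'<j$. An $\mathcal{F}_4$ of $w$ is a cycle $(e_i,e_j,e_k,e_l)$ of length $4$ where $e_i,e_k$ are edges of $w$ that are both odd or both even in $w$, and $e_j,e_l$ are odd chords of $w$ crossing effectively. A monomial $M$ is indispensable if every system of binomial generators of $I_{\mathcal{A}_G}$ contains a binomial having $M$ as a monomial. $\mathcal{T}_{\min}$: inclusion-minimal supports of indispensable monomials. $\Gamma_G$: simplicial complex on $\mathcal{T}_{\min}$ in which $\{E_1,\ldots,E_k\}$ is a face iff there exist monomials $M_l$ with $\mathrm{supp}(M_l)=E_l$ all of the same $\mathcal{A}_G$-degree. *)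

theory Defs
  imports "HOL-Library.Poly_Mapping"
begin

definition simple_graph :: "'v set \<Rightarrow> 'v set set \<Rightarrow> bool" where
  "simple_graph V E \<longleftrightarrow> finite V \<and> (\<forall>e\<in>E. \<exists>a b. a \<noteq> b \<and> e = {a, b} \<and> a \<in> V \<and> b \<in> V)"

definition sg_connected :: "'v set \<Rightarrow> 'v set set \<Rightarrow> bool" where
  "sg_connected V E \<longleftrightarrow> V \<noteq> {} \<and>
     (\<forall>x\<in>V. \<forall>y\<in>V. (\<lambda>a b. a \<in> V \<and> b \<in> V \<and> {a, b} \<in> E)\<^sup>*\<^sup>* x y)"

definition cyc_edge :: "'v list \<Rightarrow> nat \<Rightarrow> 'v set" where
  "cyc_edge cs i = {cs ! i, cs ! ((i + 1) mod length cs)}"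

definition is_cycle_list :: "'v set set \<Rightarrow> 'v list \<Rightarrow> bool" where
  "is_cycle_list E cs \<longleftrightarrow> distinct cs \<and> length cs \<ge> 3 \<and> (\<forall>i<length cs. cyc_edge cs i \<in> E)"

definition cycle_edges :: "'v list \<Rightarrow> 'v set set" where
  "cycle_edges cs = cyc_edge cs ` {..<length cs}"

definition is_path_list :: "'v set set \<Rightarrow> 'v list \<Rightarrow> bool" where
  "is_path_list E ps \<longleftrightarrow> distinct ps \<and> length ps \<ge> 2 \<and>
     (\<forall>i. Suc i < length ps \<longrightarrow> {ps ! i, ps ! Suc i} \<in> E)"

definition path_edges :: "'v list \<Rightarrow> 'v set set" where
  "path_edges ps = {{ps ! i, ps ! Suc i} | i. Suc i < length ps}"

definition sharp_condition :: "'v set \<Rightarrow> 'v set set \<Rightarrow> bool" where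
  "sharp_condition V E \<longleftrightarrow> \<not> (\<exists>c1 c2 p.
      is_cycle_list E c1 \<and> odd (length c1) \<and> is_cycle_list E c2 \<and> odd (length c2) \<and>
      set c1 \<inter> set c2 = {} \<and> is_path_list E p \<and>
      hd p \<in> set c1 \<and> last p \<in> set c2 \<and>
      (\<forall>x\<in>set p - {hd p, last p}. x \<notin> set c1 \<union> set c2) \<and>
      {e\<in>E. e \<subseteq> set c1 \<union> set c2 \<union> set p} = cycle_edges c1 \<union> cycle_edges c2 \<union> path_edges p)"

text \<open>Polynomials in the variables x_e (e an edge) over the field 'k: monomials are
  exponent vectors (finitely supported functions from edges to nat) with support in E.\<close>

definition Adeg :: "('v set \<Rightarrow>\<^sub>0 nat) \<Rightarrow> 'v \<Rightarrow> nat" where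
  "Adeg u v = (\<Sum>e\<in>{e\<in>Poly_Mapping.keys u. v \<in> e}. Poly_Mapping.lookup u e)"

definition in_polyring :: "'v set set \<Rightarrow> (('v set \<Rightarrow>\<^sub>0 nat) \<Rightarrow>\<^sub>0 'k::zero) \<Rightarrow> bool" where
  "in_polyring E p \<longleftrightarrow> (\<forall>u\<in>Poly_Mapping.keys p. Poly_Mapping.keys u \<subseteq> E)"

text \<open>Kernel of x_e \<mapsto> t^{a_e}: the coefficient of every monomial t^b of the image vanishes.\<close>
definition toric_ideal :: "'k::field itself \<Rightarrow> 'v set set \<Rightarrow> (('v set \<Rightarrow>\<^sub>0 nat) \<Rightarrow>\<^sub>0 'k) set" where
  "toric_ideal K E = {p. in_polyring E p \<and>
      (\<forall>b. (\<Sum>u\<in>{u\<in>Poly_Mapping.keys p. Adeg u = b}. Poly_Mapping.lookup p u) = 0)}"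

definition gen_ideal :: "'v set set \<Rightarrow> (('v set \<Rightarrow>\<^sub>0 nat) \<Rightarrow>\<^sub>0 'k::field) set
     \<Rightarrow> (('v set \<Rightarrow>\<^sub>0 nat) \<Rightarrow>\<^sub>0 'k) set" where
  "gen_ideal E S = {p. \<exists>F c. finite F \<and> F \<subseteq> S \<and> (\<forall>s\<in>F. in_polyring E (c s)) \<and>
      p = (\<Sum>s\<in>F. c s * s)}"

definition is_binomial :: "'v set set \<Rightarrow> (('v set \<Rightarrow>\<^sub>0 nat) \<Rightarrow>\<^sub>0 'k::field) \<Rightarrow> bool" where
  "is_binomial E b \<longleftrightarrow> (\<exists>u v. Poly_Mapping.keys u \<subseteq> E \<and> Poly_Mapping.keys v \<subseteq> E \<and>
      b = Poly_Mapping.single u 1 - Poly_Mapping.single v 1)"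

definition indispensable_monomial :: "'k::field itself \<Rightarrow> 'v set set \<Rightarrow> ('v set \<Rightarrow>\<^sub>0 nat) \<Rightarrow> bool" where
  "indispensable_monomial K E u \<longleftrightarrow> Poly_Mapping.keys u \<subseteq> E \<and>
     (\<forall>S :: (('v set \<Rightarrow>\<^sub>0 nat) \<Rightarrow>\<^sub>0 'k) set.
        (\<forall>b\<in>S. is_binomial E b) \<and> gen_ideal E S = toric_ideal K E \<longrightarrow> (\<exists>b\<in>S. u \<in> Poly_Mapping.keys b))"

definition quadratic_monomial :: "('v set \<Rightarrow>\<^sub>0 nat) \<Rightarrow> bool" where
  "quadratic_monomial u \<longleftrightarrow> (\<Sum>e\<in>Poly_Mapping.keys u. Poly_Mapping.lookup u e) = 2"

definition T_min :: "'k::field itself \<Rightarrow> 'v set set \<Rightarrow> 'v set set set" where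
  "T_min K E = {T. (\<exists>u. indispensable_monomial K E u \<and> Poly_Mapping.keys u = T) \<and>
       \<not> (\<exists>u'. indispensable_monomial K E u' \<and> Poly_Mapping.keys u' \<subset> T)}"

definition Gamma_face :: "'k::field itself \<Rightarrow> 'v set set \<Rightarrow> 'v set set set \<Rightarrow> bool" where
  "Gamma_face K E F \<longleftrightarrow> finite F \<and> F \<noteq> {} \<and> F \<subseteq> T_min K E \<and>
     (\<exists>b. \<forall>T\<in>F. \<exists>u. Poly_Mapping.keys u = T \<and> Adeg u = b)"

definition Gamma_adj :: "'k::field itself \<Rightarrow> 'v set set \<Rightarrow> 'v set set \<Rightarrow> 'v set set \<Rightarrow> bool" where
  "Gamma_adj K E T1 T2 \<longleftrightarrow> T1 \<noteq> T2 \<and> Gamma_face K E {T1, T2}"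

definition Gamma_components :: "'k::field itself \<Rightarrow> 'v set set \<Rightarrow> 'v set set set set" where
  "Gamma_components K E = {C. \<exists>T\<in>T_min K E. C = {T'. (Gamma_adj K E)\<^sup>*\<^sup>* T T'}}"

text \<open>An even closed walk given by its vertex list [v_1,...,v_2s] (0-indexed here); its
  i-th edge is {v_i, v_(i+1)} cyclically.\<close>
definition is_even_closed_walk :: "'v set set \<Rightarrow> 'v list \<Rightarrow> bool" where
  "is_even_closed_walk E vs \<longleftrightarrow> vs \<noteq> [] \<and> even (length vs) \<and>
     (\<forall>i<length vs. cyc_edge vs i \<in> E)"

definition walk_binomial :: "'k::field itself \<Rightarrow> 'v list \<Rightarrow> (('v set \<Rightarrow>\<^sub>0 nat) \<Rightarrow>\<^sub>0 'k)" where
  "walk_binomial K vs =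
     Poly_Mapping.single (\<Sum>i\<in>{i. i < length vs \<and> even i}. Poly_Mapping.single (cyc_edge vs i) 1) 1
   - Poly_Mapping.single (\<Sum>i\<in>{i. i < length vs \<and> odd i}. Poly_Mapping.single (cyc_edge vs i) 1) 1"

definition is_subgraph :: "'v set \<Rightarrow> 'v set set \<Rightarrow> 'v set \<Rightarrow> 'v set set \<Rightarrow> bool" where
  "is_subgraph VB EB VH EH \<longleftrightarrow> VB \<subseteq> VH \<and> EB \<subseteq> EH \<and> (\<forall>e\<in>EB. e \<subseteq> VB)"

definition no_cut_vertex :: "'v set \<Rightarrow> 'v set set \<Rightarrow> bool" where
  "no_cut_vertex VB EB \<longleftrightarrow>
     (\<forall>x\<in>VB. VB - {x} \<noteq> {} \<longrightarrow> sg_connected (VB - {x}) {e\<in>EB. x \<notin> e})"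

definition is_block :: "'v set \<Rightarrow> 'v set set \<Rightarrow> 'v set \<Rightarrow> 'v set set \<Rightarrow> bool" where
  "is_block VH EH VB EB \<longleftrightarrow> is_subgraph VB EB VH EH \<and> sg_connected VB EB \<and> no_cut_vertex VB EB \<and>
     (\<forall>VB' EB'. is_subgraph VB' EB' VH EH \<and> sg_connected VB' EB' \<and> no_cut_vertex VB' EB' \<and>
        VB \<subseteq> VB' \<and> EB \<subseteq> EB' \<longrightarrow> VB' = VB \<and> EB' = EB)"

definition is_chord :: "'v set set \<Rightarrow> 'v list \<Rightarrow> nat \<Rightarrow> nat \<Rightarrow> bool" where
  "is_chord E vs k l \<longleftrightarrow> k < l \<and> l < length vs \<and> {vs ! k, vs ! l} \<in> E \<and>
     {vs ! k, vs ! l} \<notin> cycle_edges vs"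

definition is_bridge :: "'v set set \<Rightarrow> 'v list \<Rightarrow> nat \<Rightarrow> nat \<Rightarrow> bool" where
  "is_bridge E vs k l \<longleftrightarrow> is_chord E vs k l \<and>
     \<not> (\<exists>VB EB. is_block (set vs) (cycle_edges vs) VB EB \<and> vs ! k \<in> VB \<and> vs ! l \<in> VB)"

text \<open>gamma_1 has length 2s-(l-k)+1 and gamma_2 has length l-k+1; both odd iff l-k even.\<close>
definition is_odd_chord :: "'v set set \<Rightarrow> 'v list \<Rightarrow> nat \<Rightarrow> nat \<Rightarrow> bool" where
  "is_odd_chord E vs k l \<longleftrightarrow> is_chord E vs k l \<and> \<not> is_bridge E vs k l \<and>
     odd (length vs - (l - k) + 1) \<and> odd (l - k + 1)"

definition cross_effectively :: "nat \<Rightarrow> nat \<Rightarrow> nat \<Rightarrow> nat \<Rightarrow> bool" where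
  "cross_effectively t j t' j' \<longleftrightarrow> odd (int t' - int t) \<and>
     ((t < t' \<and> t' < j \<and> j < j') \<or> (t' < t \<and> t < j' \<and> j' < j))"

text \<open>Edge positions p (0-indexed) of the walk: even p = odd edge (1-indexed position p+1).\<close>
definition has_F4 :: "'v set set \<Rightarrow> 'v list \<Rightarrow> bool" where
  "has_F4 E vs \<longleftrightarrow> (\<exists>p q t j t' j'. p < length vs \<and> q < length vs \<and> (even p \<longleftrightarrow> even q) \<and>
     is_odd_chord E vs t j \<and> is_odd_chord E vs t' j' \<and> cross_effectively t j t' j' \<and>
     (\<exists>a b c d. distinct [a, b, c, d] \<and> cyc_edge vs p = {a, b} \<and> {vs ! t, vs ! j} = {b, c} \<and>
        cyc_edge vs q = {c, d} \<and> {vs ! t', vs ! j'} = {d, a}))"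

end

theory Submission
  imports Defs
begin

text \<open>The indispensable monomials are the divisor-minimal monomials \<open>u\<close> having a second monomial
  \<open>v\<close> of the same degree. For such a \<open>u\<close>, an even closed walk \<open>w\<close> with binomial \<open>u - v\<close> is rigid:
  a shorter alternating closed walk, made of arcs of \<open>w\<close> and chords playing the role of \<open>v\<close>, would
  give a proper divisor of \<open>u\<close> with a nontrivial fiber. Hence a repeated vertex of \<open>w\<close> is a cut
  vertex of the subgraph induced on \<open>w\<close> and separates two odd closed walks, so two repeated vertices
  would yield two odd cycles joined by a path as an induced subgraph. Under the sharp
  condition \<open>w\<close> is thus an even cycle or two odd cycles sharing one vertex. An effective crossing
  of odd chords forces arcs of length one, that is an F4, and it makes \<open>v\<close> non-minimal unless
  \<open>w\<close> has length 4; without crossings \<open>u\<close> and \<open>v\<close> are the only monomials of their degree.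
  Finally, adjacent minimal supports carry squarefree minimal monomials of the same degree, so that
  the components of the complex are the sets of supports of minimal monomials of a given degree.\<close>

text \<open>The witnesses of a face may have arbitrary exponents, so adjacent supports visibly share
  only their vertex set and not a degree. This is why even cycles and bow ties are told apart by the
  parity of the number of vertices, and two bow ties by their centres. The walk theory is
  asymmetric: \<open>u\<close> is minimal but \<open>v\<close> need not be, so an alternating
  subwalk is harmful only if its chords stand in for \<open>v\<close>. If they stand in for
  \<open>u\<close>, the complementary arcs are taken instead, which the same chords close up in the
  role of \<open>v\<close>. Either way a contradiction needs an edge of \<open>u\<close> that is
  left over; an effective crossing can only exist when there is none, and this forces the short arcs
  of the F4. The number 3 in the second claim comes from degree 2 alone, where the minimal monomials
  of a given degree are perfect matchings of four vertices. Beyond degree 2, a second minimal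
  monomial in the fiber of \<open>u\<close> excludes an F4 of the walk through both, and then the
  fiber has just two elements.\<close>

abbreviation keys where "keys \<equiv> Poly_Mapping.keys"
abbreviation lookup where "lookup \<equiv> Poly_Mapping.lookup"
abbreviation single where "single \<equiv> Poly_Mapping.single"

section \<open>Monomials and their degrees\<close>

definition graph :: "'v set set \<Rightarrow> bool" where
  "graph E \<longleftrightarrow> (\<forall>e\<in>E. card e = 2)"

lemma graphE:
  assumes "graph E" "e \<in> E"
  obtains a b where "a \<noteq> b" "e = {a, b}"
  using assms unfolding graph_def card_2_iff by blast

lemma graph_irrefl: "graph E \<Longrightarrow> {a, b} \<in> E \<Longrightarrow> a \<noteq> b"
  unfolding graph_def by fastforce

lemma keys_plus_nat:
  fixes a b :: "'a \<Rightarrow>\<^sub>0 nat"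
  shows "keys (a + b) = keys a \<union> keys b"
  by (auto simp: in_keys_iff lookup_add)

lemma lookup_sum_pm: "lookup (\<Sum>i\<in>A. f i) x = (\<Sum>i\<in>A. lookup (f i) x)"
  by (induction A rule: infinite_finite_induct) (auto simp: lookup_add)

lemma keys_sum_single:
  "finite A \<Longrightarrow> keys (\<Sum>i\<in>A. single (f i) (1::nat)) = f ` A"
  by (induction A rule: finite_induct) (auto simp: keys_plus_nat)

lemma Adeg_eq:
  assumes "finite A" "keys u \<subseteq> A"
  shows "Adeg u x = (\<Sum>e\<in>A. if x \<in> e then lookup u e else 0)"
proof -
  have "Adeg u x = (\<Sum>e\<in>keys u. if x \<in> e then lookup u e else 0)"
    unfolding Adeg_def by (simp add: sum.inter_filter)
  also have "\<dots> = (\<Sum>e\<in>A. if x \<in> e then lookup u e else 0)"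
    by (rule sum.mono_neutral_left) (use assms in \<open>auto simp: in_keys_iff\<close>)
  finally show ?thesis .
qed

lemma Adeg_add [simp]: "Adeg (u + v) x = Adeg u x + Adeg v x"
proof -
  let ?A = "keys u \<union> keys v"
  have "Adeg (u + v) x = (\<Sum>e\<in>?A. if x \<in> e then lookup (u + v) e else 0)"
    by (rule Adeg_eq) (auto simp: keys_plus_nat)
  also have "\<dots> = (\<Sum>e\<in>?A. (if x \<in> e then lookup u e else 0) + (if x \<in> e then lookup v e else 0))"
    by (rule sum.cong) (auto simp: lookup_add)
  also have "\<dots> = Adeg u x + Adeg v x"
    by (subst sum.distrib, subst (1 2) Adeg_eq[where A = ?A]) auto
  finally show ?thesis .
qed

lemma Adeg_zero [simp]: "Adeg 0 x = 0"
  by (simp add: Adeg_def)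

lemma Adeg_single [simp]: "Adeg (single e n) x = (if x \<in> e then n else 0)"
  by (subst Adeg_eq[where A = "{e}"]) (auto)

lemma Adeg_sum: "Adeg (\<Sum>i\<in>A. f i) x = (\<Sum>i\<in>A. Adeg (f i) x)"
  by (induction A rule: infinite_finite_induct) auto


lemma Adeg_eq_0_iff: "Adeg u x = 0 \<longleftrightarrow> x \<notin> \<Union>(keys u)"
  unfolding Adeg_def by (auto simp: in_keys_iff)

lemma Adeg_le: "e \<in> keys u \<Longrightarrow> x \<in> e \<Longrightarrow> lookup u e \<le> Adeg u x"
  unfolding Adeg_def by (rule member_le_sum) auto

lemma Adeg_ge_2:
  assumes "e \<in> keys u" "e' \<in> keys u" "x \<in> e" "x \<in> e'" "e \<noteq> e'"
  shows "Adeg u x \<ge> 2"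
proof -
  have "(\<Sum>e\<in>{e, e'}. lookup u e) \<le> Adeg u x"
    unfolding Adeg_def by (rule sum_mono2) (use assms in auto)
  moreover have "lookup u e > 0" "lookup u e' > 0"
    using assms by (auto simp: in_keys_iff)
  ultimately show ?thesis using assms(5) by simp
qed

lemma Adeg_zero_imp_zero:
  assumes "graph E" "keys u \<subseteq> E" "Adeg u = (\<lambda>_. 0)"
  shows "u = 0"
proof (rule ccontr)
  assume "u \<noteq> 0"
  then obtain e where e: "e \<in> keys u" by fastforce
  then obtain x where "x \<in> e" using assms(1,2) by (metis graphE insertI1 subsetD)
  then have "Adeg u x \<noteq> 0" using e by (auto simp: Adeg_eq_0_iff)
  then show False using assms(3) by simp
qed

definition tot :: "('a \<Rightarrow>\<^sub>0 nat) \<Rightarrow> nat" where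
  "tot u = (\<Sum>e\<in>keys u. lookup u e)"

lemma tot_eq:
  assumes "finite A" "keys u \<subseteq> A"
  shows "tot u = (\<Sum>e\<in>A. lookup u e)"
  unfolding tot_def by (rule sum.mono_neutral_left) (use assms in \<open>auto simp: in_keys_iff\<close>)

lemma tot_add [simp]: "tot (u + v) = tot u + tot v"
proof -
  let ?A = "keys u \<union> keys v"
  have "tot (u + v) = (\<Sum>e\<in>?A. lookup (u + v) e)"
    by (rule tot_eq) (auto simp: keys_plus_nat)
  also have "\<dots> = tot u + tot v"
    by (subst (1 2) tot_eq[where A = ?A]) (auto simp: lookup_add sum.distrib)
  finally show ?thesis .
qed

lemma tot_eq_0_iff [simp]: "tot u = 0 \<longleftrightarrow> u = 0"
  unfolding tot_def by (auto simp: in_keys_iff) (metis in_keys_iff keys_eq_empty all_not_in_conv)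

lemma tot_single [simp]: "tot (single e n) = n"
  by (subst tot_eq[where A = "{e}"]) auto

lemma tot_sum: "tot (\<Sum>i\<in>A. f i) = (\<Sum>i\<in>A. tot (f i))"
  by (induction A rule: infinite_finite_induct) auto

lemma keys_le_split:
  fixes u :: "'a \<Rightarrow>\<^sub>0 nat"
  assumes "e \<in> keys u"
  obtains r where "u = single e 1 + r"
proof
  show "u = single e 1 + (u - single e 1)"
    by (rule poly_mapping_eqI) (use assms in \<open>auto simp: lookup_add lookup_minus lookup_single when_def in_keys_iff\<close>)
qed

lemma le_split:
  fixes u :: "'a \<Rightarrow>\<^sub>0 nat"
  assumes "\<And>e. lookup a e \<le> lookup u e"
  obtains r where "u = a + r"
proof
  show "u = a + (u - a)"
    by (rule poly_mapping_eqI) (use assms in \<open>auto simp: lookup_add lookup_minus\<close>)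
qed

text \<open>The monomials occurring in a nonzero binomial of the toric ideal, phrased through
  degrees only so that the field disappears. They are closed under multiplication by monomials in
  the edge variables.\<close>

definition nontriv :: "'v set set \<Rightarrow> ('v set \<Rightarrow>\<^sub>0 nat) \<Rightarrow> bool" where
  "nontriv E u \<longleftrightarrow> keys u \<subseteq> E \<and> (\<exists>v. keys v \<subseteq> E \<and> v \<noteq> u \<and> Adeg v = Adeg u)"

text \<open>The minimal generators of the monomial ideal formed by the \<open>nontriv\<close>
  monomials; divisibility appears as \<open>+\<close> because exponent vectors are added.\<close>

definition min_mon :: "'v set set \<Rightarrow> ('v set \<Rightarrow>\<^sub>0 nat) \<Rightarrow> bool" where
  "min_mon E u \<longleftrightarrow> nontriv E u \<and> (\<forall>a b. u = a + b \<and> nontriv E a \<longrightarrow> b = 0)"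

lemma min_mon_nontriv: "min_mon E u \<Longrightarrow> nontriv E u"
  by (simp add: min_mon_def)

lemma min_mon_keys: "min_mon E u \<Longrightarrow> keys u \<subseteq> E"
  by (simp add: min_mon_def nontriv_def)

lemma min_monD:
  assumes "min_mon E u" "u = a + b" "keys q \<subseteq> E" "Adeg q = Adeg a" "q \<noteq> a"
  shows "b = 0"
proof -
  have "keys a \<subseteq> E" using min_mon_keys[OF assms(1)] assms(2) by (auto simp: keys_plus_nat)
  then have "nontriv E a" using assms by (auto simp: nontriv_def)
  then show ?thesis using assms(1,2) by (auto simp: min_mon_def)
qed

lemma min_mon_exists:
  assumes "nontriv E u"
  shows "\<exists>a b. u = a + b \<and> min_mon E a"
  using assms
proof (induction "tot u" arbitrary: u rule: less_induct)
  case less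
  show ?case
  proof (cases "min_mon E u")
    case True
    then show ?thesis by (metis add.right_neutral)
  next
    case False
    then obtain a b where ab: "u = a + b" "nontriv E a" "b \<noteq> 0"
      using less.prems by (auto simp: min_mon_def)
    then have "tot a < tot u" by (simp add: neq0_conv[symmetric] del: neq0_conv)
    then obtain c d where "a = c + d" "min_mon E c" using less.hyps ab by blast
    then show ?thesis using ab by (metis add.assoc)
  qed
qed

text \<open>A common variable could be cancelled from both monomials, and the cofactor in
  \<open>u\<close> would be a proper divisor with a nontrivial fiber.\<close>

lemma min_mon_disjoint:
  assumes "min_mon E u" "keys v \<subseteq> E" "v \<noteq> u" "Adeg v = Adeg u"
  shows "keys u \<inter> keys v = {}"
proof (rule ccontr)
  assume "keys u \<inter> keys v \<noteq> {}"
  then obtain e where e: "e \<in> keys u" "e \<in> keys v" by blast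
  obtain a where a: "u = single e 1 + a" using e keys_le_split by metis
  obtain b where b: "v = single e 1 + b" using e keys_le_split by metis
  have "Adeg b = Adeg a"
  proof
    fix x show "Adeg b x = Adeg a x"
      using fun_cong[OF assms(4), of x] by (simp add: a b)
  qed
  moreover have "keys b \<subseteq> E" using assms(2) b by (auto simp: keys_plus_nat)
  moreover have "b \<noteq> a" using a b assms(3) by auto
  ultimately have "single e (1::nat) = 0"
    using min_monD[OF assms(1), of a "single e 1" b] a by (simp add: add.commute)
  then have "lookup (single e (1::nat)) e = 0" by simp
  then show False by simp
qed

section \<open>Indispensable monomials\<close>

lemma in_polyring_0 [simp]: "in_polyring E 0"
  by (simp add: in_polyring_def)

lemma in_polyring_single: "keys u \<subseteq> E \<Longrightarrow> in_polyring E (single u c)"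
  by (auto simp: in_polyring_def split: if_splits)

lemma in_polyring_1 [simp]: "in_polyring E (1 :: ('v set \<Rightarrow>\<^sub>0 nat) \<Rightarrow>\<^sub>0 'k::field)"
  unfolding single_one[symmetric] by (rule in_polyring_single) simp

lemma in_polyring_add:
  assumes "in_polyring E p" "in_polyring E (q :: ('v set \<Rightarrow>\<^sub>0 nat) \<Rightarrow>\<^sub>0 'k::field)"
  shows "in_polyring E (p + q)"
  using assms Poly_Mapping.keys_add[of p q] unfolding in_polyring_def by blast

lemma in_polyring_mult:
  assumes "in_polyring E p" "in_polyring E (q :: ('v set \<Rightarrow>\<^sub>0 nat) \<Rightarrow>\<^sub>0 'k::field)"
  shows "in_polyring E (p * q)"
  unfolding in_polyring_def
proof
  fix u assume "u \<in> keys (p * q)"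
  then obtain a b where "u = a + b" "a \<in> keys p" "b \<in> keys q"
    using keys_mult[of p q] by blast
  then show "keys u \<subseteq> E" using assms by (auto simp: in_polyring_def keys_plus_nat)
qed

text \<open>The coefficient of \<open>t^b\<close> in the image of \<open>p\<close>; the kernel is
  where all of these vanish.\<close>

definition cdeg :: "('v \<Rightarrow> nat) \<Rightarrow> (('v set \<Rightarrow>\<^sub>0 nat) \<Rightarrow>\<^sub>0 'k::field) \<Rightarrow> 'k" where
  "cdeg b p = (\<Sum>u\<in>{u\<in>keys p. Adeg u = b}. lookup p u)"

lemma cdeg_eq:
  assumes "finite A" "keys p \<subseteq> A"
  shows "cdeg b p = (\<Sum>u\<in>A. if Adeg u = b then lookup p u else 0)"
proof -
  have "cdeg b p = (\<Sum>u\<in>keys p. if Adeg u = b then lookup p u else 0)"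
    unfolding cdeg_def by (simp add: sum.inter_filter)
  also have "\<dots> = (\<Sum>u\<in>A. if Adeg u = b then lookup p u else 0)"
    by (rule sum.mono_neutral_left) (use assms in \<open>auto simp: in_keys_iff\<close>)
  finally show ?thesis .
qed

lemma cdeg_add: "cdeg b (p + q) = cdeg b p + cdeg b q"
proof -
  let ?A = "keys p \<union> keys q"
  have "cdeg b (p + q) = (\<Sum>u\<in>?A. if Adeg u = b then lookup (p + q) u else 0)"
    by (rule cdeg_eq) (use Poly_Mapping.keys_add[of p q] in auto)
  also have "\<dots> = (\<Sum>u\<in>?A. (if Adeg u = b then lookup p u else 0) + (if Adeg u = b then lookup q u else 0))"
    by (rule sum.cong) (auto simp: lookup_add)
  also have "\<dots> = cdeg b p + cdeg b q"
    by (subst sum.distrib, subst (1 2) cdeg_eq[where A = ?A]) auto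
  finally show ?thesis .
qed

lemma cdeg_0 [simp]: "cdeg b 0 = 0"
  by (simp add: cdeg_def)

lemma cdeg_single: "cdeg b (single u c) = (if Adeg u = b then c else 0)"
  by (subst cdeg_eq[where A = "{u}"]) auto

lemma cdeg_uminus: "cdeg b (- p) = - cdeg b p"
  using cdeg_add[of b p "- p"] by (simp add: eq_neg_iff_add_eq_0 add.commute)

lemma cdeg_diff: "cdeg b (p - q) = cdeg b p - cdeg b q"
  using cdeg_add[of b p "- q"] by (simp add: cdeg_uminus)

lemma cdeg_sum: "cdeg b (\<Sum>i\<in>A. f i) = (\<Sum>i\<in>A. cdeg b (f i))"
  by (induction A rule: infinite_finite_induct) (auto simp: cdeg_add)

lemma toric_ideal_alt: "toric_ideal K E = {p. in_polyring E p \<and> (\<forall>b. cdeg b p = 0)}"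
  by (simp add: toric_ideal_def cdeg_def)

lemma pm_induct:
  fixes p :: "'a \<Rightarrow>\<^sub>0 'k::field"
  assumes "P 0" "\<And>u c p. P p \<Longrightarrow> c \<noteq> 0 \<Longrightarrow> P (single u c + p)"
  shows "P p"
proof (induction "card (keys p)" arbitrary: p rule: less_induct)
  case less
  show ?case
  proof (cases "p = 0")
    case False
    then obtain u where u: "u \<in> keys p" by fastforce
    define q where "q = p - single u (lookup p u)"
    have kq: "keys q \<subseteq> keys p - {u}"
      by (auto simp: q_def in_keys_iff lookup_minus lookup_single when_def split: if_splits)
    then have "card (keys q) < card (keys p)" using u
      by (metis Diff_subset card_Diff1_less card_mono finite_Diff finite_keys le_less_trans)
    then have "P q" using less by blast
    then have "P (single u (lookup p u) + q)" using assms(2) u by (auto simp: in_keys_iff)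
    then show ?thesis by (simp add: q_def)
  qed (use assms in simp)
qed

lemma cdeg_mult_0:
  fixes p q :: "('v set \<Rightarrow>\<^sub>0 nat) \<Rightarrow>\<^sub>0 'k::field"
  assumes q: "\<forall>b. cdeg b q = 0"
  shows "cdeg b (p * q) = 0"
proof -
  have single: "cdeg b (single a c * q) = 0" for a c
  proof -
    \<comment> \<open>Multiplying by a monomial shifts degrees. The guard is there because
      subtraction on naturals truncates: degrees \<open>b\<close> that are not above that of
      \<open>a\<close> get nothing.\<close>
    have "cdeg b (single a c * q) = (if \<forall>x. Adeg a x \<le> b x then c * cdeg (\<lambda>x. b x - Adeg a x) q else 0)" for q
    proof (induction q rule: pm_induct)
      case (2 u d q)
      have "Adeg (a + u) = b \<longleftrightarrow> (\<forall>x. Adeg a x \<le> b x) \<and> Adeg u = (\<lambda>x. b x - Adeg a x)"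
        unfolding fun_eq_iff Adeg_add by (metis add_diff_cancel_left' le_add1 le_add_diff_inverse)
      then show ?case using 2
        by (auto simp: distrib_left cdeg_add mult_single cdeg_single)
    qed simp
    then show ?thesis using q by simp
  qed
  show ?thesis
    by (induction p rule: pm_induct) (auto simp: distrib_right cdeg_add single)
qed

lemma gen_idealI:
  assumes "finite F" "F \<subseteq> S" "\<forall>s\<in>F. in_polyring E (c s)" "p = (\<Sum>s\<in>F. c s * s)"
  shows "p \<in> gen_ideal E S"
  unfolding gen_ideal_def by (rule CollectI, rule exI[of _ F], rule exI[of _ c]) (use assms in simp)

lemma gen_ideal_add:
  assumes "p \<in> gen_ideal E S" "q \<in> gen_ideal E S"
  shows "p + q \<in> gen_ideal E S"
proof -
  obtain F c where F: "finite F" "F \<subseteq> S" "\<forall>s\<in>F. in_polyring E (c s)" "p = (\<Sum>s\<in>F. c s * s)"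
    using assms(1) unfolding gen_ideal_def by blast
  obtain G d where G: "finite G" "G \<subseteq> S" "\<forall>s\<in>G. in_polyring E (d s)" "q = (\<Sum>s\<in>G. d s * s)"
    using assms(2) unfolding gen_ideal_def by blast
  define e where "e s = (if s \<in> F then c s else 0) + (if s \<in> G then d s else 0)" for s
  have "p = (\<Sum>s\<in>F \<union> G. (if s \<in> F then c s else 0) * s)"
    unfolding F(4) by (rule sum.mono_neutral_cong_left) (use F G in auto)
  moreover have "q = (\<Sum>s\<in>F \<union> G. (if s \<in> G then d s else 0) * s)"
    unfolding G(4) by (rule sum.mono_neutral_cong_left) (use F G in auto)
  ultimately have "p + q = (\<Sum>s\<in>F \<union> G. e s * s)"
    by (simp add: e_def distrib_right sum.distrib)
  moreover have "\<forall>s\<in>F \<union> G. in_polyring E (e s)"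
    using F G by (auto simp: e_def intro!: in_polyring_add)
  ultimately show ?thesis using F(1,2) G(1,2) by (intro gen_idealI[of "F \<union> G"]) auto
qed

lemma gen_ideal_mult:
  assumes "p \<in> gen_ideal E S" "in_polyring E r"
  shows "r * p \<in> gen_ideal E S"
proof -
  obtain F c where F: "finite F" "F \<subseteq> S" "\<forall>s\<in>F. in_polyring E (c s)" "p = (\<Sum>s\<in>F. c s * s)"
    using assms(1) unfolding gen_ideal_def by blast
  then have "r * p = (\<Sum>s\<in>F. (r * c s) * s)" by (simp add: sum_distrib_left mult.assoc)
  moreover have "\<forall>s\<in>F. in_polyring E (r * c s)" using F assms(2) in_polyring_mult by blast
  ultimately show ?thesis using F(1,2) by (intro gen_idealI[of F])
qed

lemma gen_ideal_0 [simp]: "0 \<in> gen_ideal E S"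
  by (rule gen_idealI[of "{}"]) auto

lemma gen_ideal_base: "s \<in> S \<Longrightarrow> s \<in> gen_ideal E S"
  by (rule gen_idealI[of "{s}" _ _ "\<lambda>_. 1"]) auto

text \<open>Binomials span the toric ideal: in a nonzero element each monomial \<open>u\<close> has
  a partner of the same degree, since otherwise its coefficient would survive in the image. A
  multiple of the binomial of this pair removes \<open>u\<close> without adding new
  monomials.\<close>

lemma toric_ideal_induct [consumes 1, case_names zero step]:
  fixes p :: "('v set \<Rightarrow>\<^sub>0 nat) \<Rightarrow>\<^sub>0 'k::field"
  assumes "p \<in> toric_ideal K E" "P 0"
    "\<And>a b c p. P p \<Longrightarrow> keys a \<subseteq> E \<Longrightarrow> keys b \<subseteq> E \<Longrightarrow> Adeg a = Adeg b \<Longrightarrow>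
       P (single 0 c * (single a 1 - single b 1) + p)"
  shows "P p"
  using assms(1)
proof (induction "card (keys p)" arbitrary: p rule: less_induct)
  case less
  show ?case
  proof (cases "p = 0")
    case False
    then obtain u where u: "u \<in> keys p" by fastforce
    have "\<exists>v\<in>keys p. v \<noteq> u \<and> Adeg v = Adeg u"
    proof (rule ccontr)
      assume "\<not> ?thesis"
      then have "{v\<in>keys p. Adeg v = Adeg u} = {u}" using u by auto
      then have "cdeg (Adeg u) p = lookup p u" by (simp add: cdeg_def)
      then show False using less.prems u by (auto simp: toric_ideal_alt in_keys_iff)
    qed
    then obtain v where v: "v \<in> keys p" "v \<noteq> u" "Adeg v = Adeg u" by blast
    define t where "t = single 0 (lookup p u) * (single u 1 - single v (1::'k))"
    have t: "t = single u (lookup p u) - single v (lookup p u)"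
      by (simp add: t_def right_diff_distrib mult_single)
    have uE: "keys u \<subseteq> E" "keys v \<subseteq> E" using less.prems u v by (auto simp: toric_ideal_alt in_polyring_def)
    define q where "q = p - t"
    have kq: "keys q \<subseteq> keys p - {u}" using v
      by (auto simp: q_def t in_keys_iff lookup_minus lookup_single when_def split: if_splits)
    then have "card (keys q) < card (keys p)" using u
      by (metis Diff_subset card_Diff1_less card_mono finite_Diff finite_keys le_less_trans)
    moreover have "in_polyring E q" using kq less.prems by (auto simp: in_polyring_def toric_ideal_alt)
    moreover have "cdeg b q = 0" for b
      using less.prems v by (simp add: q_def cdeg_diff t cdeg_single toric_ideal_alt)
    ultimately have "P q" using less by (auto simp: toric_ideal_alt)
    then have "P (t + q)" unfolding t_def using assms(3) uE v by metis
    then show ?thesis by (simp add: q_def)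
  qed (use assms in simp)
qed

lemma binomial_toric_iff:
  assumes "keys a \<subseteq> E" "keys b \<subseteq> E"
  shows "single a 1 - single b (1::'k::field) \<in> toric_ideal (K :: 'k itself) E \<longleftrightarrow> Adeg a = Adeg b"
proof
  assume "single a 1 - single b (1::'k) \<in> toric_ideal K E"
  then have "cdeg (Adeg a) (single a 1 - single b (1::'k)) = 0" by (simp add: toric_ideal_alt)
  then show "Adeg a = Adeg b" by (simp add: cdeg_diff cdeg_single split: if_splits)
next
  assume "Adeg a = Adeg b"
  moreover have "in_polyring E (single a 1 - single b (1::'k))"
    using assms keys_diff[of "single a (1::'k)" "single b 1"] unfolding in_polyring_def by fastforce
  ultimately show "single a 1 - single b (1::'k) \<in> toric_ideal K E"
    by (simp add: toric_ideal_alt cdeg_diff cdeg_single)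
qed

lemma keys_binomial:
  "u \<in> keys (single a 1 - single b (1::'k::field)) \<longleftrightarrow> a \<noteq> b \<and> (u = a \<or> u = b)"
  by (auto simp: in_keys_iff lookup_minus lookup_single when_def)

text \<open>However a binomial \<open>u - v\<close> is written by generators, \<open>u\<close>
  occurs in some summand, so it is a multiple of a monomial of a generator. That monomial has a
  nontrivial fiber, and minimality makes the cofactor trivial.\<close>

lemma min_mon_imp_indispensable:
  fixes K :: "'k::field itself" and E :: "'v set set"
  assumes "min_mon E u"
  shows "indispensable_monomial K E u"
  unfolding indispensable_monomial_def
proof (intro conjI allI impI)
  show uE: "keys u \<subseteq> E" using assms by (rule min_mon_keys)
  fix S :: "(('v set \<Rightarrow>\<^sub>0 nat) \<Rightarrow>\<^sub>0 'k) set"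
  assume S: "(\<forall>b\<in>S. is_binomial E b) \<and> gen_ideal E S = toric_ideal K E"
  obtain v where v: "keys v \<subseteq> E" "v \<noteq> u" "Adeg v = Adeg u"
    using assms by (auto simp: min_mon_def nontriv_def)
  have "single u 1 - single v (1::'k) \<in> gen_ideal E S"
    using S uE v by (simp add: binomial_toric_iff)
  then obtain F c where F: "finite F" "F \<subseteq> S" "\<forall>s\<in>F. in_polyring E (c s)"
      "single u 1 - single v (1::'k) = (\<Sum>s\<in>F. c s * s)"
    unfolding gen_ideal_def by blast
  have "lookup (\<Sum>s\<in>F. c s * s) u \<noteq> 0"
    unfolding F(4)[symmetric] using v by (simp add: lookup_minus lookup_single)
  then obtain s where s: "s \<in> F" "lookup (c s * s) u \<noteq> 0"
    unfolding lookup_sum_pm by (meson sum.neutral)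
  then have "u \<in> keys (c s * s)" by (simp add: in_keys_iff)
  then obtain m m' where m: "u = m + m'" "m \<in> keys (c s)" "m' \<in> keys s"
    using keys_mult by blast
  have sS: "s \<in> S" using s F by blast
  then obtain a b where ab: "keys a \<subseteq> E" "keys b \<subseteq> E" "s = single a 1 - single b (1::'k)"
    using S unfolding is_binomial_def by blast
  have "s \<in> toric_ideal K E" using gen_ideal_base[OF sS, of E] S by simp
  then have "Adeg a = Adeg b" using ab binomial_toric_iff by metis
  moreover have "a \<noteq> b" "m' = a \<or> m' = b" using m(3) unfolding ab(3) keys_binomial by auto
  ultimately have "nontriv E m'" using ab unfolding nontriv_def by metis
  then have "m = 0" using assms m(1) unfolding min_mon_def by (metis add.commute)
  then show "\<exists>b\<in>S. u \<in> keys b" using m sS by auto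
qed

text \<open>If \<open>u\<close> is not minimal, the binomials avoiding \<open>u\<close> still
  generate: with \<open>u = m + r\<close> and \<open>n\<close> in the fiber of \<open>m\<close>, the
  binomial of \<open>u\<close> and \<open>b\<close> is \<open>r\<close> times that of
  \<open>m\<close> and \<open>n\<close>, plus that of \<open>n + r\<close> and
  \<open>b\<close>.\<close>

lemma indispensable_imp_min_mon:
  fixes K :: "'k::field itself" and E :: "'v set set"
  assumes G: "graph E" and ind: "indispensable_monomial K E u"
  shows "min_mon E u"
proof (rule ccontr)
  assume nmin: "\<not> min_mon E u"
  have uE: "keys u \<subseteq> E" using ind by (simp add: indispensable_monomial_def)
  define S where "S = {single a 1 - single b (1::'k) | a b.
     keys a \<subseteq> E \<and> keys b \<subseteq> E \<and> Adeg a = Adeg b \<and> a \<noteq> u \<and> b \<noteq> u}"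
  have bin: "\<forall>b\<in>S. is_binomial E b" unfolding S_def is_binomial_def by blast
  have StorIc: "S \<subseteq> toric_ideal K E" unfolding S_def using binomial_toric_iff by blast
  have avoid: "single a 1 - single b (1::'k) \<in> gen_ideal E S"
    if "keys a \<subseteq> E" "keys b \<subseteq> E" "Adeg a = Adeg b" "a \<noteq> u" "b \<noteq> u" for a b
    by (rule gen_ideal_base) (use that in \<open>auto simp: S_def\<close>)
  have neg: "- p \<in> gen_ideal E S" if "p \<in> gen_ideal E S" for p :: "('v set \<Rightarrow>\<^sub>0 nat) \<Rightarrow>\<^sub>0 'k"
  proof -
    have "in_polyring E (single 0 (-1) :: ('v set \<Rightarrow>\<^sub>0 nat) \<Rightarrow>\<^sub>0 'k)"
      by (rule in_polyring_single) simp
    moreover have "single 0 (-1) * p = - p" by (simp add: single_uminus single_one)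
    ultimately show ?thesis using gen_ideal_mult[OF that] by metis
  qed
  have left: "single u 1 - single b (1::'k) \<in> gen_ideal E S"
    if b: "keys b \<subseteq> E" "Adeg b = Adeg u" for b
  proof (cases "b = u")
    case False
    then have "nontriv E u" using b uE by (auto simp: nontriv_def)
    then obtain m r where m: "u = m + r" "nontriv E m" "r \<noteq> 0"
      using nmin by (auto simp: min_mon_def)
    then obtain n where n: "keys n \<subseteq> E" "n \<noteq> m" "Adeg n = Adeg m" by (auto simp: nontriv_def)
    have rE: "keys r \<subseteq> E" "keys m \<subseteq> E" using m uE by (auto simp: keys_plus_nat)
    have ne: "n \<noteq> u" "m \<noteq> u"
    proof -
      \<comment> \<open>\<open>r\<close> adds a nonzero degree, so neither \<open>m\<close> nor
        \<open>n\<close> can be \<open>u\<close>, and their binomial lies in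
        \<open>S\<close>.\<close>
      have "Adeg m \<noteq> Adeg u"
      proof
        assume "Adeg m = Adeg u"
        then have "Adeg (m + r) x = Adeg m x" for x by (simp only: m(1))
        then have "Adeg r x = 0" for x by simp
        then have "r = 0" using Adeg_zero_imp_zero[OF G rE(1)] by blast
        then show False using m by simp
      qed
      then show "n \<noteq> u" "m \<noteq> u" using n by auto
    qed
    have "single r 1 * (single m 1 - single n (1::'k)) \<in> gen_ideal E S"
      by (rule gen_ideal_mult[OF avoid]) (use n ne rE in \<open>auto intro: in_polyring_single\<close>)
    moreover have "single (n + r) 1 - single b (1::'k) \<in> gen_ideal E S"
    proof (rule avoid)
      show "Adeg (n + r) = Adeg b" using n b m by (auto simp: fun_eq_iff)
    qed (use n rE b False m in \<open>auto simp: keys_plus_nat\<close>)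
    ultimately have "single r 1 * (single m 1 - single n (1::'k)) + (single (n + r) 1 - single b 1) \<in> gen_ideal E S"
      by (rule gen_ideal_add)
    moreover have "single r 1 * (single m 1 - single n (1::'k)) = single u 1 - single (n + r) 1"
      by (simp add: right_diff_distrib mult_single m(1) add.commute)
    ultimately show ?thesis by simp
  qed simp
  have all: "single a 1 - single b (1::'k) \<in> gen_ideal E S"
    if "keys a \<subseteq> E" "keys b \<subseteq> E" "Adeg a = Adeg b" for a b
  proof (cases "a = u")
    case True then show ?thesis using left that by auto
  next
    case aF: False
    show ?thesis
    proof (cases "b = u")
      case True then show ?thesis using neg[OF left[of a]] that by auto
    qed (use avoid that aF in auto)
  qed
  have "gen_ideal E S = toric_ideal K E"
  proof
    show "gen_ideal E S \<subseteq> toric_ideal K E"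
    proof
      fix p assume "p \<in> gen_ideal E S"
      then obtain F c where F: "finite F" "F \<subseteq> S" "\<forall>s\<in>F. in_polyring E (c s)" "p = (\<Sum>s\<in>F. c s * s)"
        unfolding gen_ideal_def by blast
      have s: "in_polyring E (c s * s)" "cdeg b (c s * s) = 0" if "s \<in> F" for s b
      proof -
        have "s \<in> toric_ideal K E" using that F StorIc by blast
        then show "in_polyring E (c s * s)" "cdeg b (c s * s) = 0"
          using F that by (auto simp: toric_ideal_alt intro!: in_polyring_mult cdeg_mult_0)
      qed
      have "in_polyring E p" unfolding F(4) using F(1) s(1)
        by (induction F rule: finite_induct) (auto intro!: in_polyring_add)
      moreover have "cdeg b p = 0" for b unfolding F(4) cdeg_sum using s by simp
      ultimately show "p \<in> toric_ideal K E" by (simp add: toric_ideal_alt)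
    qed
    show "toric_ideal K E \<subseteq> gen_ideal E S"
    proof
      fix p :: "('v set \<Rightarrow>\<^sub>0 nat) \<Rightarrow>\<^sub>0 'k" assume "p \<in> toric_ideal K E"
      then show "p \<in> gen_ideal E S"
      proof (induction rule: toric_ideal_induct)
        case (step a b c p)
        have "in_polyring E (single 0 c :: ('v set \<Rightarrow>\<^sub>0 nat) \<Rightarrow>\<^sub>0 'k)"
          by (rule in_polyring_single) simp
        then show ?case
          using gen_ideal_add[OF gen_ideal_mult[OF all]] step by blast
      qed simp
    qed
  qed
  with bin have "(\<forall>b\<in>S. is_binomial E b) \<and> gen_ideal E S = toric_ideal K E" by (rule conjI)
  then have "\<exists>b\<in>S. u \<in> keys b" 
    by (rule mp[OF ind[unfolded indispensable_monomial_def, THEN conjunct2, THEN spec, of S]])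
  then obtain b where "b \<in> S" "u \<in> keys b" by (elim bexE)
  then obtain x y where "b = single x 1 - single y (1::'k)" "x \<noteq> u" "y \<noteq> u"
    unfolding S_def by blast
  then show False using \<open>u \<in> keys b\<close> keys_binomial[of u x y] by blast
qed

lemma indispensable_iff_min_mon:
  "graph E \<Longrightarrow> indispensable_monomial K E u \<longleftrightarrow> min_mon E u"
  using indispensable_imp_min_mon min_mon_imp_indispensable by blast

section \<open>Induced lollipops and barbells\<close>

lemma path_edges_Nil [simp]: "path_edges [] = {}"
  by (simp add: path_edges_def)

lemma path_edges_single [simp]: "path_edges [x] = {}"
  by (simp add: path_edges_def)

lemma path_edges_Cons: "path_edges (x # y # xs) = insert {x, y} (path_edges (y # xs))"
proof -
  have "{i. Suc i < length (x # y # xs)} = insert 0 (Suc ` {i. Suc i < length (y # xs)})"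
    by (auto simp: image_def less_Suc_eq_0_disj)
  moreover have "path_edges zs = (\<lambda>i. {zs ! i, zs ! Suc i}) ` {i. Suc i < length zs}" for zs :: "'a list"
    by (auto simp: path_edges_def)
  ultimately show ?thesis by (simp add: image_image)
qed

lemma path_edges_append:
  "xs \<noteq> [] \<Longrightarrow> ys \<noteq> [] \<Longrightarrow>
     path_edges (xs @ ys) = path_edges xs \<union> path_edges ys \<union> {{last xs, hd ys}}"
proof (induction xs)
  case (Cons x xs)
  show ?case
  proof (cases xs)
    case Nil
    then show ?thesis using Cons.prems by (cases ys) (auto simp: path_edges_Cons)
  next
    case (Cons z zs)
    then show ?thesis using Cons.IH Cons.prems by (auto simp: path_edges_Cons)
  qed
qed simp

lemma path_edges_rev [simp]: "path_edges (rev xs) = path_edges xs"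
proof (induction xs)
  case (Cons x xs)
  show ?case
  proof (cases xs)
    case (Cons z zs)
    then show ?thesis using Cons.IH
      by (simp add: path_edges_append path_edges_Cons insert_commute)
         (simp add: path_edges_append[of "rev zs @ [z]" "[x]", simplified] insert_commute)
  qed simp
qed simp

lemma path_edges_join:
  assumes "p \<noteq> []" "q \<noteq> []" "last p = hd q"
  shows "path_edges (p @ tl q) = path_edges p \<union> path_edges q"
proof (cases q)
  case (Cons z q')
  then show ?thesis using assms
    by (cases q') (auto simp: path_edges_append path_edges_Cons)
qed (use assms in simp)

lemma last_join: "q \<noteq> [] \<Longrightarrow> last p = hd q \<Longrightarrow> p \<noteq> [] \<Longrightarrow> last (p @ tl q) = last q"
  by (cases q) (auto simp: last_append)

lemma path_edges_map_upt:
  "path_edges (map a [i..<j]) = {{a k, a (Suc k)} | k. i \<le> k \<and> Suc k < j}"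
proof -
  have "path_edges (map a [i..<j]) = {{a (i + k), a (Suc (i + k))} | k. Suc (i + k) < j}"
  proof -
    have "{map a [i..<j] ! k, map a [i..<j] ! Suc k} = {a (i + k), a (Suc (i + k))}"
        "Suc k < length (map a [i..<j]) \<longleftrightarrow> Suc (i + k) < j" if "Suc k < j - i \<or> Suc (i + k) < j" for k
      using that by auto
    then show ?thesis unfolding path_edges_def by (fastforce simp: less_diff_conv)
  qed
  also have "\<dots> = {{a k, a (Suc k)} | k. i \<le> k \<and> Suc k < j}"
    by (force simp: le_iff_add)
  finally show ?thesis .
qed

lemma cycle_edges_path_edges:
  assumes "cs \<noteq> []"
  shows "cycle_edges cs = insert {last cs, hd cs} (path_edges cs)"
proof -
  obtain n where n: "length cs = Suc n" using assms by (cases cs) auto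
  have "cyc_edge cs n = {last cs, hd cs}"
    using assms by (simp add: cyc_edge_def n hd_conv_nth last_conv_nth)
  moreover have "cyc_edge cs ` {..<n} = path_edges cs"
    unfolding path_edges_def by (auto simp: n cyc_edge_def image_def)
  ultimately show ?thesis
    unfolding cycle_edges_def n lessThan_Suc by simp
qed

text \<open>A set of pairs, so that \<open>^^ n\<close> records the length of a walk within
  \<open>S\<close> and thereby its parity.\<close>

definition adjr :: "'v set set \<Rightarrow> 'v set \<Rightarrow> ('v \<times> 'v) set" where
  "adjr E S = {(a, b). a \<in> S \<and> b \<in> S \<and> {a, b} \<in> E}"

lemma adjr_sym: "(a, b) \<in> adjr E S \<Longrightarrow> (b, a) \<in> adjr E S"
  by (auto simp: adjr_def insert_commute)

lemma adjr_relpow_sym: "(a, b) \<in> adjr E S ^^ n \<Longrightarrow> (b, a) \<in> adjr E S ^^ n"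
proof (induction n arbitrary: b)
  case (Suc n)
  then obtain c where "(a, c) \<in> adjr E S ^^ n" "(c, b) \<in> adjr E S" by auto
  then show ?case using Suc.IH adjr_sym relpow_Suc_I2 by metis
qed simp

lemma relpow_trans: "(a, b) \<in> R ^^ m \<Longrightarrow> (b, c) \<in> R ^^ n \<Longrightarrow> (a, c) \<in> R ^^ (m + n)"
  by (auto simp: relpow_add)

lemma relpow_segment:
  assumes "i \<le> j" "\<And>k. i \<le> k \<Longrightarrow> k < j \<Longrightarrow> (f k, f (Suc k)) \<in> R"
  shows "(f i, f j) \<in> R ^^ (j - i)"
  unfolding relpow_fun_conv
  by (rule exI[of _ "\<lambda>k. f (i + k)"]) (use assms in auto)

text \<open>One half of the forbidden subgraph: an odd cycle with a stick \<open>p\<close> leading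
  to \<open>x\<close>, induced in \<open>E\<close>. The stick may be the single vertex
  \<open>x\<close>, which then lies on the cycle.\<close>

definition lollipop :: "'v set set \<Rightarrow> 'v set \<Rightarrow> 'v \<Rightarrow> 'v list \<Rightarrow> 'v list \<Rightarrow> bool" where
  "lollipop E S x c p \<longleftrightarrow> is_cycle_list E c \<and> odd (length c) \<and> distinct p \<and> p \<noteq> [] \<and>
     hd p \<in> set c \<and> last p = x \<and> set p \<inter> set c = {hd p} \<and> set c \<union> set p \<subseteq> S \<and>
     {e\<in>E. e \<subseteq> set c \<union> set p} = cycle_edges c \<union> path_edges p"

text \<open>A shortest odd closed walk through \<open>x\<close> runs out to distance \<open>r\<close> along \<open>a\<close> and comes back
  along \<open>b\<close>; every vertex \<open>a k\<close> and \<open>b k\<close> has distance exactly \<open>k\<close> from \<open>x\<close>.\<close>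

definition two_arms :: "('v \<times> 'v) set \<Rightarrow> 'v \<Rightarrow> nat \<Rightarrow> (nat \<Rightarrow> 'v) \<Rightarrow> (nat \<Rightarrow> 'v) \<Rightarrow> bool" where
  "two_arms R x r a b \<longleftrightarrow> a 0 = x \<and> b 0 = x \<and> (\<forall>k<r. (a k, a (Suc k)) \<in> R) \<and>
     (\<forall>k<r. (b k, b (Suc k)) \<in> R) \<and> (a r, b r) \<in> R"

lemma two_arms_exist:
  assumes "(x, x) \<in> R ^^ (2 * r + 1)" "sym R"
  shows "\<exists>a b. two_arms R x r a b"
proof -
  obtain f where f: "f 0 = x" "f (2 * r + 1) = x" "\<forall>i<2 * r + 1. (f i, f (Suc i)) \<in> R"
    using assms(1) unfolding relpow_fun_conv by blast
  have 1: "(f (2 * r + 1 - k), f (2 * r + 1 - Suc k)) \<in> R" if "k < r" for k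
  proof -
    have "Suc (2 * r + 1 - Suc k) = 2 * r + 1 - k" using that by simp
    then have "(f (2 * r + 1 - Suc k), f (2 * r + 1 - k)) \<in> R"
      using f(3)[rule_format, of "2 * r + 1 - Suc k"] that by simp
    then show ?thesis using assms(2) by (meson symE)
  qed
  have "Suc (2 * r) - r = Suc r" by simp
  then have "(f r, f (2 * r + 1 - r)) \<in> R" using f(3)[rule_format, of r] by simp
  then show ?thesis using f 1 unfolding two_arms_def
    by (intro exI[of _ f] exI[of _ "\<lambda>k. f (2 * r + 1 - k)"]) auto
qed

lemma two_arms_swap: "two_arms R x r a b \<Longrightarrow> sym R \<Longrightarrow> two_arms R x r b a"
  unfolding two_arms_def by (meson symE)

text \<open>The second arm may follow the first one up to distance \<open>k\<close> and switch
  there, by the connecting edge or because the arms meet. This is how the common initial part of the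
  arms gets longer.\<close>

lemma two_arms_merge:
  assumes "two_arms R x r a b" "k \<le> r" "(a k, b (Suc k)) \<in> R \<or> a k = b k" "k = r \<longrightarrow> a k = b k"
  shows "two_arms R x r a (\<lambda>i. if i \<le> k then a i else b i)"
proof -
  have "((\<lambda>i. if i \<le> k then a i else b i) i, (\<lambda>i. if i \<le> k then a i else b i) (Suc i)) \<in> R" if "i < r" for i
    using assms that unfolding two_arms_def by (cases "i < k"; cases "i = k") auto
  then show ?thesis using assms unfolding two_arms_def by auto
qed

text \<open>A shorter way to \<open>a k\<close> closes up to a shorter odd walk: with the initial
  part of the arm if its length has the other parity than \<open>k\<close>, and with the rest of the
  closed walk if the parities agree.\<close>

lemma two_arms_dist:
  assumes ab: "two_arms R x r a b" and R: "sym R"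
    and min: "\<And>n. odd n \<Longrightarrow> n < 2 * r + 1 \<Longrightarrow> (x, x) \<notin> R ^^ n"
    and k: "k \<le> r" and d: "(x, a k) \<in> R ^^ d"
  shows "k \<le> d"
proof (rule ccontr)
  assume "\<not> k \<le> d"
  then have dk: "d < k" by simp
  have s: "(u, v) \<in> R ^^ n \<Longrightarrow> (v, u) \<in> R ^^ n" for u v n
  proof (induction n arbitrary: v)
    case (Suc n)
    then obtain c where "(u, c) \<in> R ^^ n" "(c, v) \<in> R" by auto
    then show ?case using Suc.IH R relpow_Suc_I2 by (metis symE)
  qed simp
  have a0: "(x, a k) \<in> R ^^ k"
    using relpow_segment[of 0 k a R] ab k by (simp add: two_arms_def)
  have a1: "(a k, a r) \<in> R ^^ (r - k)"
    by (rule relpow_segment) (use ab k in \<open>auto simp: two_arms_def\<close>)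
  have b0: "(x, b r) \<in> R ^^ r"
    using relpow_segment[of 0 r b R] ab by (simp add: two_arms_def)
  have "(a r, b r) \<in> R ^^ 1" using ab by (simp add: two_arms_def)
  from relpow_trans[OF relpow_trans[OF a1 this] s[OF b0]]
  have return: "(a k, x) \<in> R ^^ (r - k + 1 + r)" .
  show False
  proof (cases "even (d + k)")
    case True
    have "(x, x) \<in> R ^^ (d + (r - k + 1 + r))" using d return relpow_trans by fast
    moreover have "odd (d + (r - k + 1 + r))" using True k by (auto simp: even_add even_diff_nat)
    moreover have "d + (r - k + 1 + r) < 2 * r + 1" using dk k by simp
    ultimately show ?thesis using min by blast
  next
    case False
    have "(x, x) \<in> R ^^ (d + k)" using d s[OF a0] relpow_trans by fast
    then show ?thesis using min[of "d + k"] False dk k by simp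
  qed
qed

text \<open>Take a shortest odd closed walk through \<open>x\<close> whose two arms agree as long as
  possible, up to \<open>m\<close>; the shared part is the stick and the rest the odd cycle.
  Vertices are layered by their distance from \<open>x\<close>. An edge between the arms inside a
  layer below the last gives a shorter odd walk, and beyond \<open>m\<close> an edge from one arm to
  the next layer of the other would let the arms agree longer; so there is no chord.\<close>

lemma lollipop_exists:
  assumes E: "graph E" and "odd n" "(x, x) \<in> adjr E S ^^ n"
  shows "\<exists>c p. lollipop E S x c p"
proof -
  let ?R = "adjr E S"
  have symR: "sym ?R" by (auto intro: symI adjr_sym)
  have "\<exists>n. odd n \<and> (x, x) \<in> ?R ^^ n" using assms by blast
  then obtain N where N: "odd N" "(x, x) \<in> ?R ^^ N" "\<And>n. n < N \<Longrightarrow> odd n \<Longrightarrow> (x, x) \<notin> ?R ^^ n"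
    using exists_least_iff[of "\<lambda>n. odd n \<and> (x, x) \<in> ?R ^^ n"] by blast
  obtain r where r: "N = 2 * r + 1" using N(1) by (metis oddE)
  have least: "\<And>n. odd n \<Longrightarrow> n < 2 * r + 1 \<Longrightarrow> (x, x) \<notin> ?R ^^ n" using N r by blast
  define M where "M = {m. m \<le> r \<and> (\<exists>a b. two_arms ?R x r a b \<and> (\<forall>k\<le>m. a k = b k))}"
  have "\<exists>a b. two_arms ?R x r a b" using two_arms_exist[of x r "?R"] N(2) symR r by blast
  then have "\<exists>a b. two_arms ?R x r a b \<and> (\<forall>k\<le>0. a k = b k)"
    by (elim ex_forward) (simp add: two_arms_def)
  then have "0 \<in> M" unfolding M_def by blast
  moreover have finM: "finite M" by (rule finite_subset[of _ "{..r}"]) (auto simp: M_def)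
  ultimately have "Max M \<in> M" by (metis Max_in empty_iff)
  define m where "m = Max M"
  obtain a b where mr: "m \<le> r" and ab: "two_arms ?R x r a b" and agree: "\<forall>k\<le>m. a k = b k"
    using \<open>Max M \<in> M\<close> unfolding m_def M_def by blast
  have ba: "two_arms ?R x r b a" using ab symR by (rule two_arms_swap)
  have maxm: "k \<le> m" if "k \<le> r" "two_arms ?R x r c d" "\<forall>i\<le>k. c i = d i" for k c d
    unfolding m_def by (rule Max_ge[OF finM]) (use that in \<open>auto simp: M_def\<close>)
  have irr: "(z, z) \<notin> ?R" for z using graph_irrefl[OF E, of z z] unfolding adjr_def by blast
  have RE: "(y, z) \<in> ?R \<Longrightarrow> {y, z} \<in> E" for y z by (simp add: adjr_def)
  have arba: "(a r, b r) \<in> ?R" using ab by (simp add: two_arms_def)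
  have "m \<noteq> r" using arba agree irr by auto
  then have mlr: "m < r" using mr by simp
  have merge: "k \<le> m" if "two_arms ?R x r c d" "k \<le> r" "(c k, d (Suc k)) \<in> ?R \<or> c k = d k" "k = r \<longrightarrow> c k = d k" for k c d
    by (rule maxm[OF that(2) two_arms_merge[OF that]]) simp
  have reach: "(x, a k) \<in> ?R ^^ k" "(x, b k) \<in> ?R ^^ k" if "k \<le> r" for k
    using relpow_segment[of 0 k a "?R"] relpow_segment[of 0 k b "?R"] ab that by (auto simp: two_arms_def)
  have da: "k \<le> d" if "(x, a k) \<in> ?R ^^ d" "k \<le> r" for k d
    using two_arms_dist[OF ab symR least that(2,1)] .
  have db: "k \<le> d" if "(x, b k) \<in> ?R ^^ d" "k \<le> r" for k d
    using two_arms_dist[OF ba symR least that(2,1)] .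
  have aa_eq: "k = l" if "a k = a l" "k \<le> r" "l \<le> r" for k l
    using da[of k l] da[of l k] reach that by (metis le_antisym)
  have bb_eq: "k = l" if "b k = b l" "k \<le> r" "l \<le> r" for k l
    using db[of k l] db[of l k] reach that by (metis le_antisym)
  have ab_eq: "k = l \<and> k \<le> m" if "a k = b l" "k \<le> r" "l \<le> r" for k l
  proof -
    have "k = l" using da[of k l] db[of l k] reach that by (metis le_antisym)
    then show ?thesis using merge[OF ab, of k] that by auto
  qed
  have aa_edge: "l = Suc k \<or> k = Suc l" if "(a k, a l) \<in> ?R" "k \<le> r" "l \<le> r" for k l
  proof -
    have "l \<le> Suc k" using da[of l "Suc k"] reach[of k] that by auto
    moreover have "k \<le> Suc l" using da[of k "Suc l"] reach[of l] that adjr_sym by fastforce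
    moreover have "k \<noteq> l" using that irr by auto
    ultimately show ?thesis by linarith
  qed
  have bb_edge: "l = Suc k \<or> k = Suc l" if "(b k, b l) \<in> ?R" "k \<le> r" "l \<le> r" for k l
  proof -
    have "l \<le> Suc k" using db[of l "Suc k"] reach[of k] that by auto
    moreover have "k \<le> Suc l" using db[of k "Suc l"] reach[of l] that adjr_sym by fastforce
    moreover have "k \<noteq> l" using that irr by auto
    ultimately show ?thesis by linarith
  qed
  have ab_edge: "k = r \<and> l = r \<or> k = m \<and> l = Suc m" if "(a k, b l) \<in> ?R" "k \<le> r" "l \<le> r" "m < l" for k l
  proof -
    have "l \<le> Suc k" using db[of l "Suc k"] reach[of k] that by auto
    moreover have "k \<le> Suc l" using da[of k "Suc l"] reach[of l] that adjr_sym by fastforce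
    ultimately consider "k = l" | "l = Suc k" | "k = Suc l" by linarith
    then show ?thesis
    proof cases
      case 1
      have "(x, x) \<in> ?R ^^ (k + 1 + k)"
        using relpow_trans[OF relpow_trans[OF reach(1)[of k], of "b l" 1] adjr_relpow_sym[OF reach(2)[of l]]]
          that 1 by simp
      then have "\<not> k + 1 + k < 2 * r + 1" using least[of "k + 1 + k"] by auto
      then show ?thesis using that 1 by linarith
    next
      case 2
      then have "k \<le> m" using merge[OF ab, of k] that by auto
      then show ?thesis using 2 that by linarith
    next
      case 3
      then have "l \<le> m" using merge[OF ba, of l] that adjr_sym by fastforce
      then show ?thesis using that by simp
    qed
  qed
  \<comment> \<open>Out along \<open>a\<close> from the branch vertex \<open>a m\<close> and back
    along \<open>b\<close>; \<open>b m\<close> is omitted because it equals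
    \<open>a m\<close>.\<close>
  define c where "c = map a [m..<Suc r] @ map b (rev [Suc m..<Suc r])"
  define p where "p = map a (rev [0..<Suc m])"
  have setc: "set c = a ` {m..r} \<union> b ` {Suc m..r}" using mlr
    by (simp only: c_def set_append set_map set_rev set_upt atLeastLessThanSuc_atLeastAtMost)
  have setp: "set p = a ` {..m}" unfolding p_def
    by (simp only: set_map set_rev set_upt) (simp only: atLeastLessThanSuc_atLeastAtMost atMost_atLeast0)
  have hdp: "hd p = a m" and lastp: "last p = x" and pne: "p \<noteq> []"
    using ab by (simp_all add: p_def hd_map hd_rev last_map last_rev two_arms_def del: upt_Suc)
  have hdc: "hd c = a m" using mlr by (simp add: c_def hd_append hd_map del: upt_Suc)
  have lastc: "last c = b (Suc m)" using mlr
    by (simp add: c_def last_append last_map last_rev hd_rev hd_map del: upt_Suc)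
  have cne: "c \<noteq> []" using mlr by (simp add: c_def)
  have pec: "path_edges c = {{a k, a (Suc k)} | k. m \<le> k \<and> Suc k < Suc r} \<union>
      {{b k, b (Suc k)} | k. Suc m \<le> k \<and> Suc k < Suc r} \<union> {{a r, b r}}"
  proof -
    have "path_edges (map b (rev [Suc m..<Suc r])) = path_edges (map b [Suc m..<Suc r])"
      by (metis path_edges_rev rev_map)
    moreover have "hd (map b (rev [Suc m..<Suc r])) = b r" using mlr
      by (simp add: hd_map hd_rev)
    moreover have "last (map a [m..<Suc r]) = a r" using mlr by simp
    ultimately show ?thesis unfolding c_def
      using mlr by (subst path_edges_append) (simp_all add: path_edges_map_upt del: upt_Suc)
  qed
  have cyce: "cycle_edges c = {{a k, a (Suc k)} | k. m \<le> k \<and> Suc k < Suc r} \<union>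
      {{b k, b (Suc k)} | k. Suc m \<le> k \<and> Suc k < Suc r} \<union> {{a r, b r}} \<union> {{b (Suc m), a m}}"
    unfolding cycle_edges_path_edges[OF cne] pec hdc lastc by blast
  have pep: "path_edges p = {{a k, a (Suc k)} | k. 0 \<le> k \<and> Suc k < Suc m}"
    unfolding p_def rev_map[symmetric] path_edges_rev path_edges_map_upt by blast
  have distp: "distinct p" unfolding p_def
    using aa_eq mlr by (auto simp: distinct_map inj_on_def simp del: upt_Suc)
  have distc: "distinct c" unfolding c_def
    using aa_eq bb_eq ab_eq by (fastforce simp: distinct_map inj_on_def simp del: upt_Suc)
  have lenc: "length c = (Suc r - m) + (r - m)" by (simp add: c_def del: upt_Suc)
  have aR: "(a k, a (Suc k)) \<in> ?R" "(b k, b (Suc k)) \<in> ?R" if "k < r" for k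
    using ab that by (auto simp: two_arms_def)
  have "(a m, b (Suc m)) \<in> ?R" using aR(2)[of m] mlr agree by simp
  then have bm: "{b (Suc m), a m} \<in> E" by (auto simp: adjr_def insert_commute)
  have cE: "cycle_edges c \<subseteq> E" unfolding cyce using aR RE arba bm by auto
  have pE: "path_edges p \<subseteq> E" unfolding pep using aR RE mlr by auto
  have inS: "a k \<in> S" "b k \<in> S" if "k \<le> r" for k
  proof -
    have "k < r \<or> k = r" using that by auto
    then show "a k \<in> S" "b k \<in> S" using aR[of k] arba by (auto simp: adjr_def)
  qed
  have union: "set c \<union> set p = a ` {..r} \<union> b ` {Suc m..r}"
    unfolding setc setp using mlr by (auto simp: image_iff) (metis atMost_iff atLeastAtMost_iff le_cases)
  have cyc: "is_cycle_list E c"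
    unfolding is_cycle_list_def using distc cE lenc mlr by (auto simp: cycle_edges_def)
  have oddc: "odd (length c)" unfolding lenc using mlr by (auto simp: Suc_diff_le)
  have int: "set p \<inter> set c = {hd p}"
  proof
    show "set p \<inter> set c \<subseteq> {hd p}"
    proof
      fix z assume "z \<in> set p \<inter> set c"
      then obtain k where k: "k \<le> m" "z = a k" "z \<in> set c" by (auto simp: setp)
      then consider l where "z = a l" "m \<le> l" "l \<le> r" | l where "z = b l" "Suc m \<le> l" "l \<le> r"
        by (auto simp: setc)
      then show "z \<in> {hd p}"
        by cases (use k aa_eq[of k] ab_eq[of k] mlr hdp in auto)
    qed
    show "{hd p} \<subseteq> set p \<inter> set c" using hdp mlr by (auto simp: setc setp)
  qed
  have "{e\<in>E. e \<subseteq> set c \<union> set p} = cycle_edges c \<union> path_edges p"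
  proof
    show "{e\<in>E. e \<subseteq> set c \<union> set p} \<subseteq> cycle_edges c \<union> path_edges p"
    proof
      fix e assume "e \<in> {e\<in>E. e \<subseteq> set c \<union> set p}"
      then obtain y z where e: "e = {y, z}" "e \<in> E" "y \<in> a ` {..r} \<union> b ` {Suc m..r}" "z \<in> a ` {..r} \<union> b ` {Suc m..r}"
        unfolding union using graphE[OF E] by (smt (verit, best) insert_subset mem_Collect_eq)
      have yzS: "y \<in> S" "z \<in> S" using e inS by auto
      have R: "(y, z) \<in> ?R" "(z, y) \<in> ?R" using e yzS by (auto simp: adjr_def insert_commute)
      have A: "{a k, a (Suc k)} \<in> cycle_edges c \<union> path_edges p" if "Suc k \<le> r" for k
        unfolding cyce pep using that by (cases "m \<le> k") auto
      have B: "{b k, b (Suc k)} \<in> cycle_edges c \<union> path_edges p" if "Suc k \<le> r" "Suc m \<le> k" for k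
        unfolding cyce using that by auto
      have C: "{a k, b l} \<in> cycle_edges c \<union> path_edges p" if "(a k, b l) \<in> ?R" "k \<le> r" "l \<le> r" "m < l" for k l
        using ab_edge[OF that] unfolding cyce by (auto simp: insert_commute)
      consider (aa) k l where "y = a k" "z = a l" "k \<le> r" "l \<le> r"
        | (ab) k l where "y = a k" "z = b l" "k \<le> r" "l \<le> r" "m < l"
        | (ba) k l where "y = b k" "z = a l" "k \<le> r" "l \<le> r" "m < k"
        | (bb) k l where "y = b k" "z = b l" "k \<le> r" "l \<le> r" "m < k" "m < l"
        using e(3,4) by (auto simp: Suc_le_eq)
      then show "e \<in> cycle_edges c \<union> path_edges p"
      proof cases
        case aa
        then show ?thesis using aa_edge[of k l] R(1) A[of k] A[of l] e(1) by (auto simp: insert_commute)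
      next
        case ab
        then show ?thesis using C[of k l] R(1) e(1) by simp
      next
        case ba
        then show ?thesis using C[of l k] R(2) e(1) by (simp add: insert_commute)
      next
        case bb
        then show ?thesis using bb_edge[of k l] R(1) B[of k] B[of l] e(1) by (auto simp: insert_commute)
      qed
    qed
    show "cycle_edges c \<union> path_edges p \<subseteq> {e\<in>E. e \<subseteq> set c \<union> set p}"
      using cE pE unfolding union unfolding cyce pep using mlr by auto
  qed
  moreover have "set c \<union> set p \<subseteq> S" unfolding union using inS by auto
  moreover have "hd p \<in> set c" using int by auto
  ultimately have "lollipop E S x c p"
    unfolding lollipop_def using cyc oddc distp pne lastp int by blast
  then show ?thesis by blast
qed

text \<open>A shortest walk is an induced path, since a repeated vertex or an extra edge would
  shorten it.\<close>

lemma induced_path_exists: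
  assumes E: "graph E" and "(x, y) \<in> (adjr E S)\<^sup>*"
  shows "\<exists>q. distinct q \<and> q \<noteq> [] \<and> hd q = x \<and> last q = y \<and> (\<forall>i. Suc i < length q \<longrightarrow> (q ! i, q ! Suc i) \<in> adjr E S) \<and>
     {e\<in>E. e \<subseteq> set q} = path_edges q \<and> (x \<in> S \<longrightarrow> set q \<subseteq> S)"
proof -
  let ?R = "adjr E S"
  obtain n where "(x, y) \<in> ?R ^^ n" using assms(2) rtrancl_imp_relpow by blast
  then obtain N where N: "(x, y) \<in> ?R ^^ N" "\<And>n. n < N \<Longrightarrow> (x, y) \<notin> ?R ^^ n"
    using exists_least_iff[of "\<lambda>n. (x, y) \<in> ?R ^^ n"] by blast
  obtain f where f: "f 0 = x" "f N = y" "\<And>i. i < N \<Longrightarrow> (f i, f (Suc i)) \<in> ?R"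
    using N(1) unfolding relpow_fun_conv by blast
  have short: "j - i \<le> d" if "i \<le> j" "j \<le> N" "(f i, f j) \<in> ?R ^^ d" for i j d
  proof -
    have 1: "(x, f i) \<in> ?R ^^ i" using relpow_segment[of 0 i f "?R"] f that by auto
    have 2: "(f j, y) \<in> ?R ^^ (N - j)" using relpow_segment[of j N f "?R"] f that by auto
    have "(x, y) \<in> ?R ^^ (i + d + (N - j))" using relpow_trans[OF relpow_trans[OF 1 that(3)] 2] .
    then have "\<not> i + d + (N - j) < N" using N(2) by blast
    then show ?thesis using that by linarith
  qed
  have inj: "i = j" if "f i = f j" "i \<le> j" "j \<le> N" for i j
    using short[of i j 0] that by auto
  have inj': "inj_on f {..N}"
    by (rule inj_onI) (metis inj atMost_iff le_cases)
  have edge: "j = Suc i" if "{f i, f j} \<in> E" "f i \<in> S" "f j \<in> S" "i < j" "j \<le> N" for i j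
    using short[of i j 1] that by (auto simp: adjr_def)
  define q where "q = map f [0..<Suc N]"
  have setq: "set q = f ` {..N}"
    unfolding q_def by (simp only: set_map set_upt) (simp only: atLeastLessThanSuc_atLeastAtMost atMost_atLeast0)
  have q1: "distinct q" unfolding q_def distinct_map using inj'
    by (simp add: atLeast0_lessThan_Suc atMost_atLeast0 atLeastLessThanSuc_atLeastAtMost del: upt_Suc)
  have q2: "q \<noteq> []" "hd q = x" "last q = y" using f
    by (simp_all add: q_def hd_map last_map del: upt_Suc) 
  have q3: "\<forall>i. Suc i < length q \<longrightarrow> (q ! i, q ! Suc i) \<in> ?R"
    using f(3) by (auto simp: q_def simp del: upt_Suc)
  have inS: "set q \<subseteq> S" if "x \<in> S"
  proof
    fix z assume "z \<in> set q"
    then obtain k where k: "z = f k" "k \<le> N" by (auto simp: setq)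
    show "z \<in> S"
    proof (cases k)
      case 0 then show ?thesis using k f that by simp
    next
      case (Suc i) then show ?thesis using f(3)[of i] k by (auto simp: adjr_def)
    qed
  qed
  have "{e\<in>E. e \<subseteq> set q} = path_edges q"
  proof
    show "{e\<in>E. e \<subseteq> set q} \<subseteq> path_edges q"
    proof
      fix e assume "e \<in> {e\<in>E. e \<subseteq> set q}"
      then obtain y z where e: "e = {y, z}" "y \<noteq> z" "e \<in> E" "y \<in> set q" "z \<in> set q"
        using graphE[OF E] by (metis (no_types, lifting) insert_subset mem_Collect_eq)
      then obtain k l where kl: "y = f k" "z = f l" "k \<le> N" "l \<le> N" "k \<noteq> l" by (auto simp: setq)
      \<comment> \<open>\<open>x \<in> S\<close> is not assumed, but two distinct vertices on the
        path mean that there is a first step, and it starts in \<open>S\<close>.\<close>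
      have S: "f i \<in> S" if "i \<le> N" for i
      proof (cases i)
        case 0
        have "N \<noteq> 0" using kl by auto
        then show ?thesis using f(3)[of 0] 0 by (auto simp: adjr_def)
      next
        case (Suc j) then show ?thesis using f(3)[of j] that by (auto simp: adjr_def)
      qed
      have "l = Suc k \<or> k = Suc l"
      proof (cases "k < l")
        case True
        then show ?thesis using edge[of k l] kl e S by auto
      next
        case False
        then show ?thesis using edge[of l k] kl e S by (auto simp: insert_commute)
      qed
      then show "e \<in> path_edges q"
        unfolding q_def path_edges_map_upt using kl e by (auto simp: insert_commute)
    qed
    show "path_edges q \<subseteq> {e\<in>E. e \<subseteq> set q}"
      unfolding setq unfolding q_def path_edges_map_upt using f(3) by (auto simp: adjr_def)
  qed
  then show ?thesis using q1 q2 q3 inS by blast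
qed

text \<open>An induced path from \<open>x\<close> to \<open>y\<close> cannot enter \<open>S1\<close> or \<open>S2\<close> again, so together with induced
  lollipops at its two ends it forms a forbidden subgraph.\<close>

lemma not_sharpI:
  assumes E: "graph E" and W: "S1 \<subseteq> W" "S2 \<subseteq> W" and disj: "S1 \<inter> S2 = {}" and xy: "x \<in> S1" "y \<in> S2"
    and odd1: "odd n1" "(x, x) \<in> adjr E S1 ^^ n1" and odd2: "odd n2" "(y, y) \<in> adjr E S2 ^^ n2"
    and conn: "(x, y) \<in> (adjr E W)\<^sup>*"
    and cut1: "\<And>e. e \<in> E \<Longrightarrow> e \<subseteq> W \<Longrightarrow> e \<inter> (S1 - {x}) \<noteq> {} \<Longrightarrow> e \<subseteq> S1"
    and cut2: "\<And>e. e \<in> E \<Longrightarrow> e \<subseteq> W \<Longrightarrow> e \<inter> (S2 - {y}) \<noteq> {} \<Longrightarrow> e \<subseteq> S2"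
  shows "\<not> sharp_condition V E"
proof -
  obtain c1 p1 where l1: "lollipop E S1 x c1 p1" using lollipop_exists[OF E odd1] by blast
  obtain c2 p2 where l2: "lollipop E S2 y c2 p2" using lollipop_exists[OF E odd2] by blast
  obtain q where q: "distinct q" "q \<noteq> []" "hd q = x" "last q = y"
      "\<forall>i. Suc i < length q \<longrightarrow> (q ! i, q ! Suc i) \<in> adjr E W"
      "{e\<in>E. e \<subseteq> set q} = path_edges q" "set q \<subseteq> W"
    using induced_path_exists[OF E conn] xy W by blast
  note L1 = l1[unfolded lollipop_def] and L2 = l2[unfolded lollipop_def]
  have neq: "x \<noteq> y" using xy disj by auto
  have q0: "q ! 0 = x" and qlast: "q ! (length q - 1) = y"
    using q by (simp_all add: hd_conv_nth last_conv_nth)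
  have qS1: "set q \<inter> S1 = {x}"
  proof
    show "set q \<inter> S1 \<subseteq> {x}"
    proof (rule ccontr)
      assume "\<not> ?thesis"
      then obtain k where k: "k < length q" "q ! k \<in> S1 - {x}" 
        by (metis Diff_iff IntE in_set_conv_nth subsetI)
      \<comment> \<open>By \<open>cut1\<close> a path that is inside \<open>S1 - {x}\<close> cannot
        leave \<open>S1\<close>, and it cannot return to its start \<open>x\<close>; it would end in
        \<open>S1\<close>, whereas \<open>y\<close> lies in \<open>S2\<close>.\<close>
      have "k + i < length q \<Longrightarrow> q ! (k + i) \<in> S1 - {x}" for i
      proof (induction i)
        case (Suc i)
        have in1: "q ! (k + i) \<in> S1 - {x}" using Suc by simp
        have "(q ! (k + i), q ! Suc (k + i)) \<in> adjr E W" using q(5) Suc.prems by simp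
        then have "q ! Suc (k + i) \<in> S1"
          using cut1[of "{q ! (k + i), q ! Suc (k + i)}"] in1 by (auto simp: adjr_def)
        moreover have "q ! Suc (k + i) \<noteq> q ! 0"
          using q(1,2) Suc.prems by (simp add: nth_eq_iff_index_eq)
        ultimately show ?case using q0 by simp
      qed (use k in simp)
      from this[of "length q - 1 - k"] have "y \<in> S1" using qlast k by simp
      then show False using xy disj by blast
    qed
    show "{x} \<subseteq> set q \<inter> S1" using q xy by (metis IntI hd_in_set empty_subsetI insert_subset)
  qed
  have qS2: "set q \<inter> S2 = {y}"
  proof
    show "set q \<inter> S2 \<subseteq> {y}"
    proof (rule ccontr)
      assume "\<not> ?thesis"
      then obtain k where k: "k < length q" "q ! k \<in> S2 - {y}" 
        by (metis Diff_iff IntE in_set_conv_nth subsetI)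
      \<comment> \<open>The mirror image: the path is followed backwards to its start
        \<open>x\<close>.\<close>
      have "i \<le> k \<Longrightarrow> q ! (k - i) \<in> S2 - {y}" for i
      proof (induction i)
        case (Suc i)
        have in1: "q ! (k - i) \<in> S2 - {y}" using Suc by simp
        have sk: "Suc (k - Suc i) = k - i" using Suc.prems by simp
        have "(q ! (k - Suc i), q ! (k - i)) \<in> adjr E W"
          using q(5)[rule_format, of "k - Suc i"] Suc.prems k sk by simp
        then have "q ! (k - Suc i) \<in> S2"
          using cut2[of "{q ! (k - Suc i), q ! (k - i)}"] in1 by (auto simp: adjr_def)
        moreover have "q ! (k - Suc i) \<noteq> q ! (length q - 1)"
          using q(1,2) Suc.prems k by (subst nth_eq_iff_index_eq) auto
        ultimately show ?case using qlast by simp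
      qed (use k in simp)
      from this[of k] have "x \<in> S2" using q0 by simp
      then show False using xy disj by blast
    qed
    show "{y} \<subseteq> set q \<inter> S2" using q xy by (metis IntI last_in_set empty_subsetI insert_subset)
  qed
  define p12 where "p12 = p1 @ tl q"
  define p where "p = p12 @ tl (rev p2)"
  have p1: "p1 \<noteq> []" "last p1 = x" "set p1 \<subseteq> S1" "set c1 \<subseteq> S1" using L1 by auto
  have p2: "p2 \<noteq> []" "last p2 = y" "set p2 \<subseteq> S2" "set c2 \<subseteq> S2" using L2 by auto
  have set_tl: "set (tl l) = set l - {hd l}" if "distinct l" "l \<noteq> []" for l :: "'a list"
    using that by (cases l) auto
  have last12: "last p12 = y" unfolding p12_def using last_join[of q p1] q p1 by simp
  have p12ne: "p12 \<noteq> []" unfolding p12_def using p1 by simp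
  have hdp: "hd p = hd p1" unfolding p_def p12_def using p1 by simp
  have lastp: "last p = hd p2"
    unfolding p_def using last_join[of "rev p2" p12] p12ne last12 p2 by (simp add: hd_rev last_rev)
  have set12: "set p12 = set p1 \<union> set q"
    using set_tl[of q] q p1 last_in_set[of p1] unfolding p12_def by auto
  have ylast: "y \<in> set q" using q last_in_set by metis
  have setp: "set p = set p1 \<union> set q \<union> set p2"
    using set_tl[of "rev p2"] p2 L2 set12 ylast unfolding p_def by (auto simp: hd_rev)
  have dist12: "distinct p12"
    unfolding p12_def using L1 q set_tl[of q] qS1 p1 by (auto simp: distinct_tl)
  have distp: "distinct p"
    unfolding p_def using L2 dist12 set_tl[of "rev p2"] p2 p1 set12 qS2 disj
    by (auto simp: distinct_tl hd_rev)
  have pe12: "path_edges p12 = path_edges p1 \<union> path_edges q"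
    unfolding p12_def by (rule path_edges_join) (use p1 q in auto)
  have pe: "path_edges p = path_edges p1 \<union> path_edges q \<union> path_edges p2"
    unfolding p_def by (subst path_edges_join) (use p12ne last12 p2 pe12 in \<open>auto simp: hd_rev\<close>)
  have E1: "{e\<in>E. e \<subseteq> set c1 \<union> set p1} = cycle_edges c1 \<union> path_edges p1" using L1 by (elim conjE)
  have E2: "{e\<in>E. e \<subseteq> set c2 \<union> set p2} = cycle_edges c2 \<union> path_edges p2" using L2 by (elim conjE)
  have xin: "x \<in> set p1" "y \<in> set p2" using p1 p2 last_in_set by metis+
  have f1: "set q \<inter> S1 \<subseteq> set p1" "(set c2 \<union> set p2) \<inter> S1 = {}" using qS1 xin p2 disj by auto
  have f2: "set q \<inter> S2 \<subseteq> set p2" "(set c1 \<union> set p1) \<inter> S2 = {}" using qS2 xin p1 disj by auto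
  have f3: "set c1 \<union> set p1 \<subseteq> (S1 - {x}) \<union> set q" "set c2 \<union> set p2 \<subseteq> (S2 - {y}) \<union> set q"
    using qS1 qS2 p1 p2 by auto
  have edges: "{e\<in>E. e \<subseteq> set c1 \<union> set c2 \<union> set p} = cycle_edges c1 \<union> cycle_edges c2 \<union> path_edges p"
  proof
    show "cycle_edges c1 \<union> cycle_edges c2 \<union> path_edges p \<subseteq> {e\<in>E. e \<subseteq> set c1 \<union> set c2 \<union> set p}"
      unfolding pe setp using E1 E2 q(6) by blast
    show "{e\<in>E. e \<subseteq> set c1 \<union> set c2 \<union> set p} \<subseteq> cycle_edges c1 \<union> cycle_edges c2 \<union> path_edges p"
    proof
      fix e assume "e \<in> {e\<in>E. e \<subseteq> set c1 \<union> set c2 \<union> set p}"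
      then have e: "e \<in> E" "e \<subseteq> set c1 \<union> set c2 \<union> set p1 \<union> set q \<union> set p2" by (auto simp: setp)
      have eW: "e \<subseteq> W" using e p1 p2 W q(7) by blast
      show "e \<in> cycle_edges c1 \<union> cycle_edges c2 \<union> path_edges p"
      proof (cases "e \<inter> (S1 - {x}) \<noteq> {}")
        case True
        then have "e \<subseteq> S1" using cut1 e eW by blast
        then have "e \<subseteq> set c1 \<union> set p1" using e(2) f1 by auto
        then show ?thesis using E1 e(1) pe by blast
      next
        case no1: False
        show ?thesis
        proof (cases "e \<inter> (S2 - {y}) \<noteq> {}")
          case True
          then have "e \<subseteq> S2" using cut2 e eW by blast
          then have "e \<subseteq> set c2 \<union> set p2" using e(2) f2 by auto
          then show ?thesis using E2 e(1) pe by blast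
        next
          case False
          have "e \<subseteq> set q"
          proof
            fix z assume z: "z \<in> e"
            then have "z \<notin> S1 - {x}" "z \<notin> S2 - {y}" using no1 False by auto
            moreover have "z \<in> (set c1 \<union> set p1) \<union> (set c2 \<union> set p2) \<union> set q" using z e(2) by auto
            ultimately show "z \<in> set q" using f3 by (elim UnE; meson UnE UnI1 UnI2 subsetD)
          qed
          then show ?thesis using q(6) e(1) pe by blast
        qed
      qed
    qed
  qed
  have path: "is_path_list E p"
  proof -
    have "path_edges p \<subseteq> E" unfolding pe using E1 E2 q(6) by blast
    moreover have "card {x, y} \<le> card (set p)"
      by (rule card_mono) (use xin setp in auto)
    then have "2 \<le> length p" using neq distp by (simp add: distinct_card)
    ultimately show ?thesis unfolding is_path_list_def path_edges_def using distp by blast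
  qed
  have "set p1 \<inter> set c1 = {hd p1}" using L1 by (elim conjE)
  moreover have "set p2 \<inter> set c2 = {hd p2}" using L2 by (elim conjE)
  moreover have "set q \<inter> set c1 \<subseteq> set p1" "set q \<inter> set c2 \<subseteq> set p2"
    using p1(4) p2(4) f1(1) f2(1) by auto
  moreover have "set p2 \<inter> set c1 = {}" "set p1 \<inter> set c2 = {}"
    using p1(4) p2(4) f1(2) f2(2) by auto
  ultimately have "set p \<inter> set c1 = {hd p}" "set p \<inter> set c2 = {last p}"
    unfolding setp hdp lastp Int_Un_distrib2 by auto
  then have "\<forall>z\<in>set p - {hd p, last p}. z \<notin> set c1 \<union> set c2" "hd p \<in> set c1" "last p \<in> set c2" by blast+
  moreover have "set c1 \<inter> set c2 = {}" using p1 p2 disj by blast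
  moreover have "is_cycle_list E c1" "odd (length c1)" using L1 by simp_all
  moreover have "is_cycle_list E c2" "odd (length c2)" using L2 by simp_all
  ultimately have "\<exists>c1 c2 p. is_cycle_list E c1 \<and> odd (length c1) \<and> is_cycle_list E c2 \<and> odd (length c2) \<and>
      set c1 \<inter> set c2 = {} \<and> is_path_list E p \<and> hd p \<in> set c1 \<and> last p \<in> set c2 \<and>
      (\<forall>z\<in>set p - {hd p, last p}. z \<notin> set c1 \<union> set c2) \<and>
      {e\<in>E. e \<subseteq> set c1 \<union> set c2 \<union> set p} = cycle_edges c1 \<union> cycle_edges c2 \<union> path_edges p"
    using path edges by (intro exI[of _ c1] exI[of _ c2] exI[of _ p]) (intro conjI)
  then show ?thesis unfolding sharp_condition_def by simp
qed

section \<open>Alternating closed walks\<close>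

lemma sum_sub_split:
  fixes f :: "'a \<Rightarrow> 'b::comm_monoid_add"
  assumes "finite A" "B \<subseteq> A"
  shows "sum f A = sum f B + sum f (A - B)"
  using sum.subset_diff[OF assms(2,1), of f] by (simp add: add.commute)

text \<open>For positions of a walk: edges of \<open>u\<close> and of \<open>v\<close> both occur,
  whichever parity belongs to \<open>u\<close>. Asking this of a set and of its complement keeps the
  later arguments independent of \<open>c\<close>.\<close>

definition both_par :: "nat set \<Rightarrow> bool" where
  "both_par A \<longleftrightarrow> (\<exists>n\<in>A. \<exists>m\<in>A. odd (n + m))"

lemma both_parI: "n \<in> A \<Longrightarrow> m \<in> A \<Longrightarrow> odd (n + m) \<Longrightarrow> both_par A"
  unfolding both_par_def by blast

text \<open>The parity of \<open>c\<close> decides whether \<open>u\<close> consists of the edges in even (0-indexed) or in odd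
  positions.\<close>

locale alt_walk =
  fixes E :: "'v set set" and vs :: "'v list" and c :: nat and u v :: "'v set \<Rightarrow>\<^sub>0 nat"
  assumes E: "graph E" and walk: "is_even_closed_walk E vs"
    and u_def: "u = (\<Sum>n\<in>{n. n < length vs \<and> even (n + c)}. single (cyc_edge vs n) 1)"
    and v_def: "v = (\<Sum>n\<in>{n. n < length vs \<and> odd (n + c)}. single (cyc_edge vs n) 1)"
    and min: "min_mon E u" and neq: "u \<noteq> v"
begin

abbreviation L where "L \<equiv> length vs"

definition mon :: "nat set \<Rightarrow> ('v set \<Rightarrow>\<^sub>0 nat)" where
  "mon A = (\<Sum>n\<in>A. single (cyc_edge vs n) 1)"

text \<open>The reduction modulo \<open>L\<close> lets an arc end at position \<open>L\<close>,
  where the walk is back at its start.\<close>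

definition dl :: "nat \<Rightarrow> 'v \<Rightarrow> int" where
  "dl n x = (if vs ! (n mod L) = x then 1 else 0)"

definition sg :: "nat \<Rightarrow> int" where
  "sg n = (if even (n + c) then 1 else - 1)"

text \<open>\<open>bd J\<close> is the degree of the part of \<open>u\<close> in \<open>J\<close> minus that of the part of \<open>v\<close>; on an
  arc of the walk it telescopes to a contribution of the two ends.\<close>

definition bd :: "nat set \<Rightarrow> 'v \<Rightarrow> int" where
  "bd J x = (\<Sum>n\<in>J. sg n * (dl n x + dl (Suc n) x))"

lemma L_pos: "L > 0" and L_even: "even L" and edge_E: "n < L \<Longrightarrow> cyc_edge vs n \<in> E"
  using walk by (auto simp: is_even_closed_walk_def)

lemma sg_Suc [simp]: "sg (Suc n) = - sg n"
  by (simp add: sg_def)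

lemma sg_cases: "sg n = 1 \<or> sg n = - 1"
  by (simp add: sg_def)

lemma sg_L: "sg L = sg 0"
  using L_even by (simp add: sg_def)

lemma dl_L: "dl L x = dl 0 x"
  by (simp add: dl_def)

lemma sg_odd: "odd (i + j) \<Longrightarrow> sg j = - sg i"
  by (auto simp: sg_def)

lemma sg_even: "even (i + j) \<Longrightarrow> sg j = sg i"
  by (auto simp: sg_def)

lemma dl_cong: "vs ! i = vs ! j \<Longrightarrow> i < L \<Longrightarrow> j < L \<Longrightarrow> dl i = dl j"
  by (simp add: dl_def fun_eq_iff)

lemma cyc_edge_ne: "n < L \<Longrightarrow> vs ! n \<noteq> vs ! (Suc n mod L)"
  using edge_E[of n] graph_irrefl[OF E] by (simp add: cyc_edge_def)

lemma Adeg_mon: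
  assumes "A \<subseteq> {..<L}"
  shows "int (Adeg (mon A) x) = (\<Sum>n\<in>A. dl n x + dl (Suc n) x)"
proof -
  have "int (Adeg (single (cyc_edge vs n) 1) x) = dl n x + dl (Suc n) x" if "n \<in> A" for n
    using cyc_edge_ne[of n] that assms by (auto simp: cyc_edge_def dl_def)
  then show ?thesis by (simp add: mon_def Adeg_sum)
qed

lemma bd_Adeg:
  assumes "J \<subseteq> {..<L}"
  shows "bd J x = int (Adeg (mon {n\<in>J. even (n + c)}) x) - int (Adeg (mon {n\<in>J. odd (n + c)}) x)"
proof -
  have fin: "finite J" using assms finite_subset by blast
  have "bd J x = (\<Sum>n\<in>{n\<in>J. even (n + c)}. sg n * (dl n x + dl (Suc n) x)) +
      (\<Sum>n\<in>J - {n\<in>J. even (n + c)}. sg n * (dl n x + dl (Suc n) x))"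
    unfolding bd_def by (rule sum_sub_split) (use fin in auto)
  also have "J - {n\<in>J. even (n + c)} = {n\<in>J. odd (n + c)}" by auto
  also have "(\<Sum>n\<in>{n\<in>J. even (n + c)}. sg n * (dl n x + dl (Suc n) x)) = int (Adeg (mon {n\<in>J. even (n + c)}) x)"
    using assms by (subst Adeg_mon) (auto simp: sg_def intro!: sum.cong)
  also have "(\<Sum>n\<in>{n\<in>J. odd (n + c)}. sg n * (dl n x + dl (Suc n) x)) = - int (Adeg (mon {n\<in>J. odd (n + c)}) x)"
    using assms by (subst Adeg_mon) (auto simp: sg_def sum_negf[symmetric] intro!: sum.cong)
  finally show ?thesis by simp
qed

lemma bd_arc: "k \<le> l \<Longrightarrow> bd {k..<l} x = sg k * dl k x - sg l * dl l x"
  by (induction l rule: nat_induct_at_least) (auto simp: bd_def algebra_simps)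

lemma bd_Un:
  assumes "A \<inter> B = {}" "finite A" "finite B"
  shows "bd (A \<union> B) x = bd A x + bd B x"
  unfolding bd_def using assms by (simp add: sum.union_disjoint)

lemma bd_all: "bd {..<L} x = 0"
  using bd_arc[of 0 L x] by (simp add: sg_L dl_L lessThan_atLeast0)

lemma bd_compl:
  assumes "J \<subseteq> {..<L}"
  shows "bd ({..<L} - J) x = - bd J x"
proof -
  have "bd {..<L} x = bd J x + bd ({..<L} - J) x"
    unfolding bd_def by (rule sum_sub_split) (use assms in auto)
  then show ?thesis by (simp add: bd_all)
qed

lemma u_mon: "u = mon {n. n < L \<and> even (n + c)}" and v_mon: "v = mon {n. n < L \<and> odd (n + c)}"
  by (simp_all add: u_def v_def mon_def)

lemma keys_mon: "finite A \<Longrightarrow> keys (mon A) = cyc_edge vs ` A"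
  unfolding mon_def by (rule keys_sum_single)

lemma mon_Un:
  assumes "A \<inter> B = {}" "finite A" "finite B"
  shows "mon (A \<union> B) = mon A + mon B"
  unfolding mon_def using assms by (simp add: sum.union_disjoint)

lemma keys_u: "keys u = cyc_edge vs ` {n. n < L \<and> even (n + c)}"
  and keys_v: "keys v = cyc_edge vs ` {n. n < L \<and> odd (n + c)}"
  by (simp_all add: u_mon v_mon keys_mon)

lemma keys_uv_cycle: "keys u \<union> keys v = cycle_edges vs"
  unfolding keys_u keys_v cycle_edges_def by auto

lemma v_E: "keys v \<subseteq> E" and u_E: "keys u \<subseteq> E"
  using edge_E by (auto simp: keys_v keys_u)

lemma Adeg_uv: "Adeg v = Adeg u"
proof
  fix x
  have "bd {..<L} x = int (Adeg u x) - int (Adeg v x)"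
    unfolding u_mon v_mon by (subst bd_Adeg) auto
  then show "Adeg v x = Adeg u x" by (simp add: bd_all)
qed

lemma disjoint: "keys u \<inter> keys v = {}"
  by (rule min_mon_disjoint[OF min v_E neq[symmetric] Adeg_uv])

text \<open>The engine of all structural results: a proper part of \<open>u\<close> cannot have a second monomial
  in its fiber. The set \<open>J\<close> collects the edge positions of an alternating subwalk, closed up
  by the chords in \<open>q\<close>.\<close>

lemma subwalk:
  assumes J: "J \<subseteq> {..<L}" and q: "keys q \<subseteq> E" "\<And>x. int (Adeg q x) = bd J x"
    and n: "n < L" "even (n + c)" "n \<notin> J"
  shows "(\<forall>n\<in>J. even (n + c)) \<and> q = mon J"
proof -
  let ?J0 = "{n\<in>J. even (n + c)}" and ?J1 = "{n\<in>J. odd (n + c)}"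
  let ?R = "{n. n < L \<and> even (n + c)} - ?J0"
  have fin: "finite J" using J finite_subset by blast
  have "u = mon (?J0 \<union> ?R)" unfolding u_mon by (rule arg_cong[of _ _ mon]) (use J in auto)
  also have "\<dots> = mon ?J0 + mon ?R" by (rule mon_Un) (use fin in auto)
  finally have usplit: "u = mon ?J0 + mon ?R" .
  have "n \<in> ?R" using n by auto
  then have "keys (mon ?R) \<noteq> {}" by (subst keys_mon) auto
  then have R: "mon ?R \<noteq> 0" by auto
  \<comment> \<open>The part of \<open>v\<close> in \<open>J\<close> together with \<open>q\<close>
    replaces the part of \<open>u\<close> in \<open>J\<close>. The position \<open>n\<close> makes
    the latter a proper divisor of \<open>u\<close>, so the two must coincide; as \<open>u\<close>
    and \<open>v\<close> share no variable, the part of \<open>v\<close> is then empty.\<close>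
  have "Adeg (mon ?J1 + q) = Adeg (mon ?J0)"
  proof
    fix x
    have "int (Adeg (mon ?J1 + q) x) = int (Adeg (mon ?J0) x)"
      using bd_Adeg[OF J, of x] q(2)[of x] by simp
    then show "Adeg (mon ?J1 + q) x = Adeg (mon ?J0) x" by simp
  qed
  moreover have "keys (mon ?J1) \<subseteq> E" using fin J edge_E by (subst keys_mon) auto
  then have "keys (mon ?J1 + q) \<subseteq> E" using q(1) by (simp add: keys_plus_nat)
  ultimately have eq: "mon ?J1 + q = mon ?J0" using min_monD[OF min usplit] R by blast
  then have "keys (mon ?J1) \<subseteq> keys (mon ?J0)" unfolding eq[symmetric] keys_plus_nat by blast
  moreover have "keys (mon ?J1) \<subseteq> keys v" using fin J by (subst keys_mon) (auto simp: keys_v)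
  moreover have "keys (mon ?J0) \<subseteq> keys u" using fin J by (subst keys_mon) (auto simp: keys_u)
  ultimately have "keys (mon ?J1) = {}" using disjoint by blast
  then have J1: "?J1 = {}" using fin by (subst (asm) keys_mon) auto
  then have "?J0 = J" by auto
  moreover have "mon ?J1 = 0" unfolding J1 mon_def by simp
  ultimately have "mon J = q" using eq by simp
  then show ?thesis using J1 by auto
qed

text \<open>For \<open>s = - 1\<close> the complement of \<open>J\<close> takes its place, since the
  closed walk as a whole has boundary zero.\<close>

lemma subwalk_False:
  assumes J: "J \<subseteq> {..<L}" and q: "keys q \<subseteq> E" "\<And>x. bd J x = s * int (Adeg q x)"
    and s: "s = 1 \<or> s = - 1" and par: "both_par J" "both_par ({..<L} - J)"
  shows False
proof -
  have pick: "\<exists>n. n \<in> A \<and> even (n + c)" "\<exists>n. n \<in> A \<and> odd (n + c)" if "both_par A" for A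
    using that unfolding both_par_def by (metis even_add)+
  show False
  proof (cases "s = 1")
    case True
    obtain n where "n < L" "even (n + c)" "n \<notin> J" using pick(1)[OF par(2)] by auto
    moreover have "int (Adeg q x) = bd J x" for x using q(2)[of x] True by simp
    ultimately have "\<forall>n\<in>J. even (n + c)" using subwalk[of J q n] J q(1) by blast
    then show ?thesis using pick(2)[OF par(1)] by blast
  next
    case False
    then have "s = - 1" using s by simp
    then have "int (Adeg q x) = bd ({..<L} - J) x" for x
      using bd_compl[OF J, of x] q(2)[of x] by simp
    moreover obtain n where "n < L" "even (n + c)" "n \<notin> {..<L} - J" using pick(1)[OF par(1)] J by auto
    ultimately have "\<forall>n\<in>{..<L} - J. even (n + c)" using subwalk[of "{..<L} - J" q n] q(1) by blast
    then show ?thesis using pick(2)[OF par(2)] by blast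
  qed
qed

section \<open>Repeated vertices and chords of a rigid walk\<close>

lemma Adeg_edge:
  assumes "k < L" "l < L" "{vs ! k, vs ! l} \<in> E"
  shows "int (Adeg (single {vs ! k, vs ! l} 1) x) = dl k x + dl l x"
  using graph_irrefl[OF E assms(3)] assms by (auto simp: dl_def)

text \<open>Otherwise the arc between the two visits is an even closed walk on its own: the parts of
  \<open>u\<close> and \<open>v\<close> on it have equal degree without any chord
  (\<open>q = 0\<close>).\<close>

lemma repeat_odd:
  assumes "i < j" "j < L" "vs ! i = vs ! j"
  shows "odd (i + j)"
proof (rule ccontr)
  assume ev: "\<not> ?thesis"
  have i2: "Suc i < j" using assms ev by (cases "j = Suc i") auto
  have "bd {i..<j} x = 1 * int (Adeg 0 x)" for x
    using assms dl_cong[of i j] sg_even[of i j] ev by (simp add: bd_arc)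
  moreover have "both_par {i..<j}" by (rule both_parI[of i _ "Suc i"]) (use i2 in auto)
  moreover have "both_par ({..<L} - {i..<j})"
  proof (cases "Suc j < L")
    case True
    then show ?thesis by (intro both_parI[of j _ "Suc j"]) auto
  next
    case False
    then have j: "Suc j = L" using assms by simp
    then have "odd j" using L_even by (metis even_Suc)
    then have "i > 0" using ev by (cases i) auto
    then show ?thesis using j \<open>odd j\<close> by (intro both_parI[of 0 _ j]) auto
  qed
  moreover have "{i..<j} \<subseteq> {..<L}" "keys 0 \<subseteq> E" "1 = (1::int) \<or> 1 = (- 1::int)" using assms by auto
  ultimately show False using subwalk_False[of "{i..<j}" 0 1] by blast
qed

text \<open>The arcs from \<open>a\<close> to \<open>b\<close> and from \<open>a'\<close> to
  \<open>b'\<close>, one of them run backwards, form a closed walk; the odd distances from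
  \<open>repeat_odd\<close> make it alternate.\<close>

lemma repeat_no_cross:
  assumes "a < b" "b < a'" "a' < b'" "b' < L" "vs ! a = vs ! a'" "vs ! b = vs ! b'"
  shows False
proof -
  have odd: "odd (a + a')" "odd (b + b')" using repeat_odd assms by auto
  have "bd ({a..<b} \<union> {a'..<b'}) x = 1 * int (Adeg 0 x)" for x
  proof -
    have "bd ({a..<b} \<union> {a'..<b'}) x = bd {a..<b} x + bd {a'..<b'} x"
      by (rule bd_Un) (use assms in auto)
    then show ?thesis
      using assms dl_cong[of a a'] dl_cong[of b b'] sg_odd[OF odd(1)] sg_odd[OF odd(2)]
      by (simp add: bd_arc)
  qed
  moreover have "both_par ({a..<b} \<union> {a'..<b'})"
    by (rule both_parI[of a _ a']) (use assms odd in auto)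
  moreover have "both_par ({..<L} - ({a..<b} \<union> {a'..<b'}))"
    by (rule both_parI[of b _ b']) (use assms odd in auto)
  moreover have "{a..<b} \<union> {a'..<b'} \<subseteq> {..<L}" "keys 0 \<subseteq> E" "1 = (1::int) \<or> 1 = (- 1::int)" using assms by auto
  ultimately show False using subwalk_False[of "{a..<b} \<union> {a'..<b'}" 0 1] by blast
qed

text \<open>Positions of opposite parity bound an arc that begins and ends with edges of
  \<open>u\<close>, so the edge between them can stand in for \<open>v\<close>. If an edge of
  \<open>u\<close> is left outside, the arc has no edge of \<open>v\<close> and is a single edge; if
  none is left, the complementary arc is a single edge.\<close>

lemma chord_adjacent:
  assumes "k < L" "l < L" "odd (k + l)" "{vs ! k, vs ! l} \<in> E"
  shows "l = Suc k mod L \<or> k = Suc l mod L"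
proof -
  have main: "l = Suc k mod L \<or> k = Suc l mod L"
    if kl: "k < L" "l < L" "even (k + c)" "odd (l + c)" and e: "{vs ! k, vs ! l} \<in> E" for k l
  proof -
    let ?q = "single {vs ! k, vs ! l} (1::nat)"
    have q: "keys ?q \<subseteq> E" using e by simp
    have s: "sg k = 1" "sg l = - 1" using kl by (simp_all add: sg_def)
    show ?thesis
    proof (cases "k < l")
      case True
      have bd: "int (Adeg ?q x) = bd {k..<l} x" for x
        using True s by (subst Adeg_edge[OF kl(1,2) e]) (simp add: bd_arc)
      show ?thesis
      proof (cases "k = 0 \<and> Suc l = L")
        case False
        have "\<exists>n<L. even (n + c) \<and> n \<notin> {k..<l}"
        proof (cases "Suc l < L")
          case True
          then show ?thesis using kl by (intro exI[of _ "Suc l"]) auto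
        next
          case F: False
          then have l: "Suc l = L" using kl by simp
          then have "odd l" using L_even by (metis even_Suc)
          moreover have "k \<noteq> 0" using False l by simp
          ultimately show ?thesis using kl L_pos by (intro exI[of _ 0]) auto
        qed
        moreover have "{k..<l} \<subseteq> {..<L}" using kl by auto
        ultimately have "\<forall>n\<in>{k..<l}. even (n + c)" using subwalk[of "{k..<l}" ?q] q bd by blast
        then have "\<not> Suc k < l" using kl by (metis atLeastLessThan_iff even_Suc add_Suc le_SucI order_refl)
        then have "l = Suc k" using True by simp
        then show ?thesis using kl by simp
      qed auto
    next
      case False
      then have lk: "l < k" using kl by (cases "l = k") auto
      let ?J = "{..<L} - {l..<k}"
      have "{l..<k} \<subseteq> {..<L}" using kl by auto
      then have bd: "int (Adeg ?q x) = bd ?J x" for x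
        using lk s by (subst Adeg_edge[OF kl(1,2) e]) (simp add: bd_compl bd_arc)
      show ?thesis
      proof (cases "k = Suc l")
        case F: False
        have "Suc l < L \<and> even (Suc l + c) \<and> Suc l \<notin> ?J" using F lk kl by auto
        moreover have "?J \<subseteq> {..<L}" by blast
        ultimately have ev: "\<forall>n\<in>?J. even (n + c)" using subwalk[of ?J ?q "Suc l"] q bd by blast
        have "Suc k = L"
        proof (rule ccontr)
          assume "Suc k \<noteq> L"
          then have "Suc k \<in> ?J" using kl by auto
          then have "even (Suc k + c)" using ev by blast
          then show False using kl by simp
        qed
        moreover have "l = 0"
        proof (rule ccontr)
          assume "l \<noteq> 0"
          then have "0 \<in> ?J" using L_pos by auto
          then have "even (0 + c)" using ev by blast
          then have "even c" by simp
          moreover have "odd k" using \<open>Suc k = L\<close> L_even by (metis even_Suc)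
          ultimately show False using kl by simp
        qed
        ultimately show ?thesis by auto
      qed (use kl in simp)
    qed
  qed
  show ?thesis
  proof (cases "even (k + c)")
    case True
    then show ?thesis using main[of k l] assms by auto
  next
    case False
    then show ?thesis using main[of l k] assms by (auto simp: insert_commute)
  qed
qed

text \<open>Opposite parities are excluded by \<open>chord_adjacent\<close>. For equal parities, two
  arcs meeting in the repeated vertex are closed up by the edge to an alternating walk, and both
  these arcs and their complement contain edges of both colours.\<close>

lemma repeat_separates:
  assumes ij: "i < j" "j < L" "vs ! i = vs ! j" and k: "i < k" "k < j"
    and l: "l < L" "l < i \<or> j < l" and e: "{vs ! k, vs ! l} \<in> E"
  shows False
proof (cases "odd (k + l)")
  case True
  have "l = Suc k mod L \<or> k = Suc l mod L"
    using chord_adjacent[of k l] True e ij k l by auto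
  moreover have "Suc k mod L = Suc k" using ij k by simp
  moreover have "Suc l mod L = Suc l \<or> Suc l mod L = 0" using l by (cases "Suc l = L") auto
  ultimately show False using ij k l by linarith
next
  case ev: False
  let ?q = "single {vs ! k, vs ! l} (1::nat)"
  have q: "keys ?q \<subseteq> E" using e by simp
  have kL: "k < L" using k ij by simp
  have oij: "odd (i + j)" using repeat_odd ij by blast
  note facts = dl_cong[OF ij(3) _ ij(2)] sg_odd[OF oij] sg_even[of k l] ev ij k l
  show False
  proof (cases "j < l")
    case True
    let ?J = "{i..<k} \<union> {j..<l}"
    have "bd ?J x = - sg k * int (Adeg ?q x)" for x
    proof -
      have "bd ?J x = bd {i..<k} x + bd {j..<l} x"
        by (rule bd_Un) (use k in auto)
      then show ?thesis using facts True
        by (subst Adeg_edge[OF kL l(1) e]) (simp add: bd_arc algebra_simps)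
    qed
    moreover have "both_par ?J" by (rule both_parI[of i _ j]) (use oij k True in auto)
    moreover have "both_par ({..<L} - ?J)"
    proof -
      consider "Suc k < j" | "Suc k = j" "Suc l < L" | "Suc k = j" "Suc l = L" using k l by linarith
      then show ?thesis
      proof cases
        case 1 then show ?thesis by (intro both_parI[of k _ "Suc k"]) (use k ij in auto)
      next
        case 2 then show ?thesis by (intro both_parI[of l _ "Suc l"]) (use k True in auto)
      next
        case 3
        then have "odd l" using L_even by (metis even_Suc)
        then have "i > 0" using oij ev 3 by (cases i) auto
        then show ?thesis using \<open>odd l\<close> 3 by (intro both_parI[of 0 _ l]) (use k True in auto)
      qed
    qed
    moreover have "- sg k = 1 \<or> - sg k = - 1" using sg_cases[of k] by auto
    moreover have "?J \<subseteq> {..<L}" using ij k l by auto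
    ultimately show False using subwalk_False[of ?J ?q "- sg k"] q by blast
  next
    case False
    then have li: "l < i" using l by simp
    let ?J = "{l..<i} \<union> {k..<j}"
    have "bd ?J x = sg k * int (Adeg ?q x)" for x
    proof -
      have "bd ?J x = bd {l..<i} x + bd {k..<j} x"
        by (rule bd_Un) (use k in auto)
      then show ?thesis using facts li
        by (subst Adeg_edge[OF kL l(1) e]) (simp add: bd_arc algebra_simps)
    qed
    moreover have "both_par ({..<L} - ?J)" by (rule both_parI[of i _ j]) (use oij k li ij in auto)
    moreover have "both_par ?J"
    proof -
      consider "Suc k < j" | "Suc k = j" "Suc l < i" | "Suc k = j" "Suc l = i" using k li by linarith
      then show ?thesis
      proof cases
        case 1 then show ?thesis by (intro both_parI[of k _ "Suc k"]) (use k ij in auto)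
      next
        case 2 then show ?thesis by (intro both_parI[of l _ "Suc l"]) auto
      next
        case 3
        then show ?thesis using oij ev by auto
      qed
    qed
    moreover have "?J \<subseteq> {..<L}" using ij k l by auto
    ultimately show False using subwalk_False[of ?J ?q "sg k"] q sg_cases[of k] by blast
  qed
qed

lemma repeat_twice:
  assumes "i < j" "j < L" "vs ! i = vs ! j" "m < L" "vs ! m = vs ! i"
  shows "m = i \<or> m = j"
proof (rule ccontr)
  assume "\<not> ?thesis"
  then have m: "m \<noteq> i" "m \<noteq> j" by auto
  have "odd (m + i)" using repeat_odd[of m i] repeat_odd[of i m] m assms by (cases "m < i") (auto simp: add.commute)
  moreover have "odd (m + j)" using repeat_odd[of m j] repeat_odd[of j m] m assms by (cases "m < j") (auto simp: add.commute)
  moreover have "odd (i + j)" using repeat_odd assms by blast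
  ultimately show False by simp
qed

lemma repeat_inner_outer:
  assumes "i < j" "j < L" "vs ! i = vs ! j" "i < k" "k < j" "l < L" "l \<le> i \<or> j \<le> l"
  shows "vs ! k \<noteq> vs ! l"
proof
  assume eq: "vs ! k = vs ! l"
  consider "l = i \<or> l = j" | "l < i" | "j < l" using assms by linarith
  then show False
  proof cases
    case 1 then show ?thesis using repeat_twice[of i j k] assms eq by auto
  next
    case 2 then show ?thesis using repeat_no_cross[of l i k j] assms eq by auto
  next
    case 3 then show ?thesis using repeat_no_cross[of i k j l] assms eq by auto
  qed
qed

section \<open>The two odd closed walks at a repeated vertex\<close>

definition inner :: "nat \<Rightarrow> nat \<Rightarrow> 'v set" where
  "inner i j = (\<lambda>n. vs ! n) ` {i<..<j}"

definition outer :: "nat \<Rightarrow> nat \<Rightarrow> 'v set" where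
  "outer i j = (\<lambda>n. vs ! n) ` ({..<i} \<union> {j<..<L})"

lemma step_adj: "n < L \<Longrightarrow> {vs ! n, vs ! (Suc n mod L)} \<in> E"
  using edge_E[of n] by (simp add: cyc_edge_def)

lemma set_vs_split:
  assumes "i < j" "j < L" "vs ! i = vs ! j"
  shows "set vs = insert (vs ! i) (inner i j \<union> outer i j)"
proof -
  have "{..<L} = insert i (insert j ({i<..<j} \<union> ({..<i} \<union> {j<..<L})))" using assms by auto
  then have "(\<lambda>n. vs ! n) ` {..<L} = insert (vs ! i) (inner i j \<union> outer i j)"
    using assms unfolding inner_def outer_def by (simp add: image_Un)
  then show ?thesis by (metis lessThan_atLeast0 list.set_map map_nth set_upt)
qed

lemma innerE:
  assumes "a \<in> inner i j"
  obtains k where "i < k" "k < j" "a = vs ! k"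
  using assms unfolding inner_def by auto

lemma outerE:
  assumes "a \<in> outer i j" "i < j" "j < L"
  obtains k where "k < i \<or> j < k" "k < L" "a = vs ! k"
  using assms unfolding outer_def by force

lemma inner_outer_disjoint:
  assumes "i < j" "j < L" "vs ! i = vs ! j"
  shows "inner i j \<inter> outer i j = {}" "vs ! i \<notin> inner i j" "vs ! i \<notin> outer i j"
proof -
  show "inner i j \<inter> outer i j = {}"
  proof (rule ccontr)
    assume "\<not> ?thesis"
    then obtain z where "z \<in> inner i j" "z \<in> outer i j" by blast
    then obtain k l where "i < k" "k < j" "l < i \<or> j < l" "l < L" "vs ! k = vs ! l"
      using assms(1,2) by (metis innerE outerE)
    then show False using repeat_inner_outer[OF assms, of k l] by auto
  qed
  show "vs ! i \<notin> inner i j"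
    using repeat_inner_outer[OF assms, of _ i] assms(1,2) by (metis innerE less_trans order_refl)
  show "vs ! i \<notin> outer i j"
    using repeat_twice[OF assms] assms(1,2) by (metis outerE less_irrefl less_trans)
qed

lemma no_edge_inner_outer:
  assumes "i < j" "j < L" "vs ! i = vs ! j" "a \<in> inner i j" "b \<in> outer i j"
  shows "{a, b} \<notin> E"
proof
  assume e: "{a, b} \<in> E"
  obtain k l where "i < k" "k < j" "l < i \<or> j < l" "l < L" "a = vs ! k" "b = vs ! l"
    using assms by (metis innerE outerE)
  then show False using repeat_separates[OF assms(1-3), of k l] e by auto
qed

lemma inner_closed_walk:
  assumes "i < j" "j < L" "vs ! i = vs ! j" "i \<le> a" "a \<le> b" "b \<le> j"
  shows "(vs ! a, vs ! b) \<in> adjr E (insert (vs ! i) (inner i j)) ^^ (b - a)"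
proof -
  have mem: "vs ! n \<in> insert (vs ! i) (inner i j)" if "i \<le> n" "n \<le> j" for n
    using that assms(3) unfolding inner_def by (cases "n = i \<or> n = j") auto
  show ?thesis
    by (rule relpow_segment)
      (use assms mem step_adj in \<open>auto simp: adjr_def\<close>, metis Suc_lessI less_le_trans less_or_eq_imp_le mod_less nat_less_le not_less_eq)
qed

text \<open>The outer arc wraps around the end of the list, so it is indexed by the offset from
  \<open>j\<close>; its total length is \<open>L - j + i\<close>.\<close>

lemma outer_closed_walk:
  assumes "i < j" "j < L" "vs ! i = vs ! j" "a \<le> b" "b \<le> L - j + i"
  shows "(vs ! ((j + a) mod L), vs ! ((j + b) mod L)) \<in> adjr E (insert (vs ! i) (outer i j)) ^^ (b - a)"
proof -
  have mem: "vs ! ((j + n) mod L) \<in> insert (vs ! i) (outer i j)" if "n \<le> L - j + i" for n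
  proof (cases "j + n < L")
    case True
    then show ?thesis using assms by (cases "n = 0") (auto simp: outer_def)
  next
    case False
    then have "(j + n) mod L = j + n - L" using that assms by (simp add: mod_if)
    moreover have "j + n - L \<le> i" using that assms False by linarith
    ultimately show ?thesis using assms by (cases "j + n - L = i") (auto simp: outer_def)
  qed
  have "(vs ! ((j + n) mod L), vs ! ((j + Suc n) mod L)) \<in> adjr E (insert (vs ! i) (outer i j))"
    if "n < L - j + i" for n
    using mem[of n] mem[of "Suc n"] step_adj[of "(j + n) mod L"] that L_pos
    by (simp add: adjr_def mod_Suc_eq)
  then show ?thesis by (intro relpow_segment[of a b "\<lambda>n. vs ! ((j + n) mod L)"]) (use assms in auto)
qed

lemma walk_connected:
  assumes "a < L" "b < L"
  shows "(vs ! a, vs ! b) \<in> (adjr E (set vs))\<^sup>*"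
proof -
  have *: "(vs ! a, vs ! b) \<in> adjr E (set vs) ^^ (b - a)" if "a \<le> b" "b < L" for a b
  proof (rule relpow_segment[OF that(1)])
    fix k assume "a \<le> k" "k < b"
    then show "(vs ! k, vs ! Suc k) \<in> adjr E (set vs)"
      using step_adj[of k] that by (simp add: adjr_def)
  qed
  show ?thesis
  proof (cases "a \<le> b")
    case True then show ?thesis using *[of a b] assms relpow_imp_rtrancl by blast
  next
    case False then show ?thesis using adjr_relpow_sym[OF *[of b a]] assms relpow_imp_rtrancl by fastforce
  qed
qed

lemma cut_inner:
  assumes "i < j" "j < L" "vs ! i = vs ! j" "e \<in> E" "e \<subseteq> set vs"
    "e \<inter> (insert (vs ! i) (inner i j) - {vs ! i}) \<noteq> {}"
  shows "e \<subseteq> insert (vs ! i) (inner i j)"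
proof -
  obtain a where a: "a \<in> e" "a \<in> inner i j" using assms by auto
  obtain b where b: "e = {a, b}" using graphE[OF E assms(4)] a(1) by (metis insertE insert_commute singletonD)
  have "b \<notin> outer i j" using no_edge_inner_outer[OF assms(1-3) a(2)] b assms(4) by blast
  then show ?thesis using a b assms(5) set_vs_split[OF assms(1-3)] by auto
qed

lemma cut_outer:
  assumes "i < j" "j < L" "vs ! i = vs ! j" "e \<in> E" "e \<subseteq> set vs"
    "e \<inter> (insert (vs ! i) (outer i j) - {vs ! i}) \<noteq> {}"
  shows "e \<subseteq> insert (vs ! i) (outer i j)"
proof -
  obtain a where a: "a \<in> e" "a \<in> outer i j" using assms by auto
  obtain b where b: "e = {a, b}" using graphE[OF E assms(4)] a(1) by (metis insertE insert_commute singletonD)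
  have "b \<notin> inner i j" using no_edge_inner_outer[OF assms(1-3) _ a(2)] b assms(4) by (metis insert_commute)
  then show ?thesis using a b assms(5) set_vs_split[OF assms(1-3)] by auto
qed

lemma inner_odd_walk:
  assumes "i < j" "j < L" "vs ! i = vs ! j"
  shows "odd (j - i)" "(vs ! i, vs ! i) \<in> adjr E (insert (vs ! i) (inner i j)) ^^ (j - i)"
  using inner_closed_walk[of i j i j] repeat_odd[of i j] assms by auto

lemma outer_odd_walk:
  assumes "i < j" "j < L" "vs ! i = vs ! j"
  shows "odd (L - j + i)" "(vs ! i, vs ! i) \<in> adjr E (insert (vs ! i) (outer i j)) ^^ (L - j + i)"
proof -
  have "(j + (L - j + i)) mod L = i" using assms by simp
  then show "(vs ! i, vs ! i) \<in> adjr E (insert (vs ! i) (outer i j)) ^^ (L - j + i)"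
    using outer_closed_walk[of i j 0 "L - j + i"] assms by simp
  show "odd (L - j + i)" using repeat_odd[of i j] assms L_even by auto
qed

end

section \<open>The sharp condition allows at most one repeated vertex\<close>

locale sharp_walk = alt_walk +
  fixes V :: "'a set"
  assumes sharp: "sharp_condition V E"
begin

text \<open>Repeats that do not cross lie side by side or are nested. Either way there are two odd
  closed walks on disjoint vertex sets, each attached to the rest only through its repeated vertex,
  as needed for \<open>not_sharpI\<close>; in the nested case they are the outer part of the larger
  and the inner part of the smaller repeat.\<close>

lemma repeat_unique_aux:
  assumes ij: "i < j" "j < L" "vs ! i = vs ! j" and ij': "i' < j'" "j' < L" "vs ! i' = vs ! j'"
    and less: "i < i'"
  shows False
proof -
  have x: "i' \<noteq> j" "j' \<noteq> j" using repeat_twice[OF ij', of i] ij less ij' by auto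
  have y: "vs ! i' \<noteq> vs ! i" using repeat_twice[OF ij, of i'] x less ij' by auto
  consider "j < i'" | "i' < j" "j < j'" | "i' < j" "j' < j" using x by linarith
  then show False
  proof cases
    case 1
    have "inner i' j' \<subseteq> outer i j" "vs ! i' \<in> outer i j"
      unfolding inner_def outer_def using 1 ij' by auto
    then have disj: "insert (vs ! i) (inner i j) \<inter> insert (vs ! i') (inner i' j') = {}"
      using inner_outer_disjoint[OF ij] y by auto
    have "insert (vs ! i) (inner i j) \<subseteq> set vs" "insert (vs ! i') (inner i' j') \<subseteq> set vs"
      using set_vs_split[OF ij] set_vs_split[OF ij'] by blast+
    note barbell = not_sharpI[OF E this disj insertI1 insertI1 inner_odd_walk[OF ij] inner_odd_walk[OF ij']
        walk_connected cut_inner[OF ij] cut_inner[OF ij'], of V]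
    have "\<not> sharp_condition V E" by (rule barbell) (assumption | use ij ij' in simp)+
    then show ?thesis using sharp by simp
  next
    case 2
    then show ?thesis using repeat_no_cross[of i i' j j'] assms by auto
  next
    case 3
    have "inner i' j' \<subseteq> inner i j" "vs ! i' \<in> inner i j"
      unfolding inner_def using 3 ij' less by auto
    then have disj: "insert (vs ! i) (outer i j) \<inter> insert (vs ! i') (inner i' j') = {}"
      using inner_outer_disjoint[OF ij] y by auto
    have "insert (vs ! i) (outer i j) \<subseteq> set vs" "insert (vs ! i') (inner i' j') \<subseteq> set vs"
      using set_vs_split[OF ij] set_vs_split[OF ij'] by blast+
    note barbell = not_sharpI[OF E this disj insertI1 insertI1 outer_odd_walk[OF ij] inner_odd_walk[OF ij']
        walk_connected cut_outer[OF ij] cut_inner[OF ij'], of V]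
    have "\<not> sharp_condition V E" by (rule barbell) (assumption | use ij ij' in simp)+
    then show ?thesis using sharp by simp
  qed
qed

lemma repeat_unique:
  assumes ij: "i < j" "j < L" "vs ! i = vs ! j" and ij': "i' < j'" "j' < L" "vs ! i' = vs ! j'"
  shows "i = i' \<and> j = j'"
proof -
  have "i = i'" using repeat_unique_aux[OF ij ij'] repeat_unique_aux[OF ij' ij] by (meson linorder_cases)
  then show ?thesis using repeat_twice[OF ij, of j'] ij' by auto
qed

text \<open>Parity excludes running through the edge twice in the same direction; the opposite
  direction gives two different repeated vertices.\<close>

lemma inj_cyc_edge:
  assumes "n < L" "m < L" "even (n + m)" "cyc_edge vs n = cyc_edge vs m"
  shows "n = m"
proof -
  have False if nm: "n < m" "m < L" "even (n + m)" "cyc_edge vs n = cyc_edge vs m" for n m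
  proof -
    have n1: "Suc n < m" using nm by (cases "m = Suc n") auto
    have "vs ! n \<noteq> vs ! m" using repeat_odd[of n m] nm by auto
    then have eq: "vs ! n = vs ! (Suc m mod L)" "vs ! Suc n = vs ! m"
      using nm n1 by (auto simp: cyc_edge_def doubleton_eq_iff)
    show False
    proof (cases "Suc m = L")
      case True
      then have "odd m" using L_even by (metis even_Suc)
      then have "n > 0" using nm by (cases n) auto
      then show False using repeat_unique[of 0 n "Suc n" m] eq n1 nm True by auto
    next
      case False
      then have "Suc m < L" using nm by simp
      then show False using repeat_unique[of n "Suc m" "Suc n" m] eq n1 nm by auto
    qed
  qed
  then show ?thesis using assms by (metis add.commute nat_neq_iff)
qed

lemma squarefree: "lookup u e \<le> 1"
proof -
  have "lookup u e = (\<Sum>n\<in>{n. n < L \<and> even (n + c)}. if cyc_edge vs n = e then 1 else 0)"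
    unfolding u_def lookup_sum_pm by (rule sum.cong) (auto simp: lookup_single when_def)
  also have "\<dots> = card {n. n < L \<and> even (n + c) \<and> cyc_edge vs n = e}"
    by (subst sum.inter_filter[symmetric]) (simp_all add: conj_assoc)
  also have "\<dots> \<le> 1"
  proof -
    have "finite {n. n < L \<and> even (n + c) \<and> cyc_edge vs n = e}" by simp
    then show ?thesis
      by (auto simp: card_le_Suc0_iff_eq intro!: inj_cyc_edge)
  qed
  finally show ?thesis .
qed

text \<open>A position that is not repeated. By \<open>repeat_unique\<close> all but at most two
  positions are of this kind.\<close>

definition nr :: "nat \<Rightarrow> bool" where
  "nr n \<longleftrightarrow> n < L \<and> (\<forall>m<L. vs ! m = vs ! n \<longrightarrow> m = n)"

text \<open>By \<open>chord_adjacent\<close> the ends of a chord have equal parity. A second visit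
  to one end has the other parity and would make the same chord join positions of unequal
  parity.\<close>

lemma chord_nr:
  assumes "k < L" "l < L" "{vs ! k, vs ! l} \<in> E" "{vs ! k, vs ! l} \<notin> cycle_edges vs"
  shows "nr k \<and> nr l \<and> even (k + l)"
proof -
  have par: "even (k + l)" if "k < L" "l < L" "{vs ! k, vs ! l} \<in> E" "{vs ! k, vs ! l} \<notin> cycle_edges vs" for k l
  proof (rule ccontr)
    assume "\<not> even (k + l)"
    then have "l = Suc k mod L \<or> k = Suc l mod L" using chord_adjacent that by blast
    then have "{vs ! k, vs ! l} = cyc_edge vs k \<or> {vs ! k, vs ! l} = cyc_edge vs l"
      by (auto simp: cyc_edge_def)
    then show False using that unfolding cycle_edges_def by auto
  qed
  have nr: "nr k" if kl: "k < L" "l < L" "{vs ! k, vs ! l} \<in> E" "{vs ! k, vs ! l} \<notin> cycle_edges vs" for k l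
    unfolding nr_def
  proof (intro conjI allI impI)
    fix m assume m: "m < L" "vs ! m = vs ! k"
    show "m = k"
    proof (rule ccontr)
      assume "m \<noteq> k"
      then have "odd (m + k)" using repeat_odd[of m k] repeat_odd[of k m] m kl
        by (cases "m < k") (auto simp: add.commute)
      then show False using par[of k l] par[of m l] kl m by auto
    qed
  qed (rule kl)
  show ?thesis using par[OF assms] nr[OF assms] nr[of l k] assms by (auto simp: insert_commute)
qed

end

section \<open>Blocks and effective crossings\<close>

lemma sg_connected_sequence:
  assumes "\<And>k. k < N \<Longrightarrow> {f k, f (Suc k)} \<in> EH" "W = f ` {..N}"
  shows "sg_connected W EH"
proof -
  have *: "(f a, f b) \<in> adjr EH W ^^ (b - a)" if "a \<le> b" "b \<le> N" for a b
    by (rule relpow_segment) (use that assms in \<open>auto simp: adjr_def\<close>)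
  have "(f a, f b) \<in> (adjr EH W)\<^sup>*" if "a \<le> N" "b \<le> N" for a b
  proof (cases "a \<le> b")
    case True then show ?thesis using *[of a b] that relpow_imp_rtrancl by blast
  next
    case False then show ?thesis using adjr_relpow_sym[OF *[of b a]] that relpow_imp_rtrancl by fastforce
  qed
  moreover have "(\<lambda>a b. a \<in> W \<and> b \<in> W \<and> {a, b} \<in> EH)\<^sup>*\<^sup>* x y \<longleftrightarrow> (x, y) \<in> (adjr EH W)\<^sup>*" for x y
    unfolding adjr_def by (rule rtranclp_rtrancl_eq)
  ultimately show ?thesis unfolding sg_connected_def assms(2) by auto
qed

lemma block_exists:
  assumes "finite VH" "finite EH" "is_subgraph VB EB VH EH" "sg_connected VB EB" "no_cut_vertex VB EB"
  shows "\<exists>VB' EB'. is_block VH EH VB' EB' \<and> VB \<subseteq> VB'"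
proof -
  define S where "S = {(A, B). is_subgraph A B VH EH \<and> sg_connected A B \<and> no_cut_vertex A B \<and> VB \<subseteq> A \<and> EB \<subseteq> B}"
  have "S \<subseteq> Pow VH \<times> Pow EH" unfolding S_def is_subgraph_def by auto
  then have finS: "finite S" using assms(1,2) by (meson finite_Pow_iff finite_SigmaI finite_subset)
  define f where "f p = card (fst p) + card (snd p)" for p :: "'a set \<times> 'a set set"
  have "(VB, EB) \<in> S" using assms unfolding S_def by auto
  then have "Max (f ` S) \<in> f ` S" using finS by (intro Max_in) auto
  then obtain A B where AB: "(A, B) \<in> S" "f (A, B) = Max (f ` S)" by force
  have "is_block VH EH A B"
    unfolding is_block_def
  proof (intro conjI allI impI)
    show "is_subgraph A B VH EH" "sg_connected A B" "no_cut_vertex A B" using AB unfolding S_def by auto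
    fix A' B' assume h: "is_subgraph A' B' VH EH \<and> sg_connected A' B' \<and> no_cut_vertex A' B' \<and> A \<subseteq> A' \<and> B \<subseteq> B'"
    then have "(A', B') \<in> S" using AB unfolding S_def by auto
    then have le: "f (A', B') \<le> f (A, B)" unfolding AB(2) using finS by (intro Max_ge) auto
    have fin: "finite A'" "finite B'" using h assms(1,2) unfolding is_subgraph_def by (meson finite_subset)+
    then have "card A \<le> card A'" "card B \<le> card B'" using h card_mono by blast+
    then have "card A' \<le> card A" "card B' \<le> card B" using le unfolding f_def by auto
    then show "A' = A" "B' = B" using h fin card_seteq by blast+
  qed
  then show ?thesis using AB unfolding S_def by auto
qed

text \<open>A cycle stays connected when a vertex is deleted, so some block contains it. Positions
  in \<open>{a..<b}\<close> rather than a list allow for arcs that run past the end of the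
  walk.\<close>

lemma closed_sequence_block:
  fixes f :: "nat \<Rightarrow> 'v"
  assumes fin: "finite VH" "finite EH" and ab: "a + 2 \<le> b" and cl: "f b = f a"
    and inj: "inj_on f {a..<b}"
    and steps: "\<And>n. a \<le> n \<Longrightarrow> n < b \<Longrightarrow> {f n, f (Suc n)} \<in> EH" and VH: "f ` {a..<b} \<subseteq> VH"
  shows "\<exists>VB EB. is_block VH EH VB EB \<and> f ` {a..<b} \<subseteq> VB"
proof -
  define EB where "EB = {{f n, f (Suc n)} | n. a \<le> n \<and> n < b}"
  define VB where "VB = f ` {a..<b}"
  have mem: "f n \<in> VB" if "a \<le> n" "n \<le> b" for n
  proof (cases "n = b")
    case True then show ?thesis using cl ab unfolding VB_def by auto
  next
    case False then show ?thesis using that unfolding VB_def by auto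
  qed
  have "is_subgraph VB EB VH EH"
    unfolding is_subgraph_def
  proof (intro conjI ballI)
    show "VB \<subseteq> VH" using VH by (simp add: VB_def)
    show "EB \<subseteq> EH" using steps by (auto simp: EB_def)
    fix e assume "e \<in> EB"
    then obtain n where "a \<le> n" "n < b" "e = {f n, f (Suc n)}" unfolding EB_def by blast
    then show "e \<subseteq> VB" using mem[of n] mem[of "Suc n"] by auto
  qed
  moreover have "sg_connected VB EB"
  proof (rule sg_connected_sequence[of "b - a - 1" "\<lambda>k. f (a + k)"])
    fix k assume "k < b - a - 1"
    then show "{f (a + k), f (a + Suc k)} \<in> EB" unfolding EB_def by (auto intro!: exI[of _ "a + k"])
  next
    have "{a..<b} \<subseteq> (\<lambda>k. a + k) ` {..b - a - 1}"
    proof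
      fix n assume "n \<in> {a..<b}"
      then show "n \<in> (\<lambda>k. a + k) ` {..b - a - 1}" by (intro image_eqI[of _ _ "n - a"]) auto
    qed
    then have "{a..<b} = (\<lambda>k. a + k) ` {..b - a - 1}" using ab by auto
    then show "VB = (\<lambda>k. f (a + k)) ` {..b - a - 1}" unfolding VB_def by (simp add: image_image)
  qed
  moreover have "no_cut_vertex VB EB"
    unfolding no_cut_vertex_def
  proof (intro ballI impI)
    fix x assume "x \<in> VB"
    then obtain m where m: "x = f m" "a \<le> m" "m < b" unfolding VB_def by auto
    \<comment> \<open>Enumerates the rest of the cycle from the successor of the deleted vertex,
      jumping back from \<open>b\<close> to \<open>a\<close>.\<close>
    define g where "g k = (if m + 1 + k < b then f (m + 1 + k) else f (m + 1 + k + a - b))" for k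
    show "sg_connected (VB - {x}) {e \<in> EB. x \<notin> e}"
    proof (rule sg_connected_sequence[of "b - a - 2" g])
      have img: "VB - {x} = f ` ({a..<b} - {m})" unfolding VB_def using inj m
        by (auto simp: inj_on_def)
      show gimg: "VB - {x} = g ` {..b - a - 2}"
      proof
        have "(if m + 1 + k < b then m + 1 + k else m + 1 + k + a - b) \<in> {a..<b} - {m}"
          if "k \<le> b - a - 2" for k using that m ab by auto
        moreover have "g k = f (if m + 1 + k < b then m + 1 + k else m + 1 + k + a - b)" for k
          by (simp add: g_def)
        ultimately show "g ` {..b - a - 2} \<subseteq> VB - {x}" unfolding img by auto
        show "VB - {x} \<subseteq> g ` {..b - a - 2}"
        proof
          fix z assume "z \<in> VB - {x}"
          then have "z \<in> f ` ({a..<b} - {m})" using img by simp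
          then obtain n where n: "z = f n" "a \<le> n" "n < b" "n \<noteq> m" by (elim imageE) auto
          show "z \<in> g ` {..b - a - 2}"
          proof (cases "m < n")
            case True
            then have "z = g (n - m - 1)" unfolding g_def using n by simp
            then show ?thesis using n m ab True by auto
          next
            case False
            then have "z = g (n + b - a - m - 1)" unfolding g_def using n m by auto
            moreover have "n + b - a - m - 1 \<le> b - a - 2" using n m False by linarith
            ultimately show ?thesis by auto
          qed
        qed
      qed
      fix k assume k: "k < b - a - 2"
      have g: "\<exists>n. a \<le> n \<and> n < b \<and> {g k, g (Suc k)} = {f n, f (Suc n)}"
      proof -
        consider "m + 1 + Suc k < b" | "m + 1 + Suc k = b" | "m + 1 + k \<ge> b" by linarith
        then show ?thesis
        proof cases
          case 1
          then show ?thesis using m by (intro exI[of _ "m + 1 + k"]) (auto simp: g_def)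
        next
          case 2
          then have "m + 1 + Suc k + a - b = a" by simp
          then have "g (Suc k) = f b" using 2 cl by (simp add: g_def)
          moreover have "g k = f (m + 1 + k)" using 2 by (simp add: g_def)
          ultimately show ?thesis using 2 m by (intro exI[of _ "m + 1 + k"]) auto
        next
          case 3
          then have "g k = f (m + 1 + k + a - b)" "g (Suc k) = f (Suc (m + 1 + k + a - b))"
            by (auto simp: g_def Suc_diff_le)
          then show ?thesis using 3 k m by (intro exI[of _ "m + 1 + k + a - b"]) auto
        qed
      qed
      have "g k \<in> VB - {x}" "g (Suc k) \<in> VB - {x}"
        unfolding gimg using k by auto
      then show "{g k, g (Suc k)} \<in> {e \<in> EB. x \<notin> e}" using g unfolding EB_def by blast
    qed
  qed
  ultimately show ?thesis using block_exists[OF fin, of VB EB] unfolding VB_def by blast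
qed

lemma has_F4I:
  assumes "p < length vs" "q < length vs" "even p \<longleftrightarrow> even q" "is_odd_chord E vs t j" "is_odd_chord E vs t' j'"
    "cross_effectively t j t' j'" "distinct [a, b, c, d]" "cyc_edge vs p = {a, b}" "{vs ! t, vs ! j} = {b, c}"
    "cyc_edge vs q = {c, d}" "{vs ! t', vs ! j'} = {d, a}"
  shows "has_F4 E vs"
  unfolding has_F4_def
  by (rule exI[of _ p], rule exI[of _ q], rule exI[of _ t], rule exI[of _ j], rule exI[of _ t'], rule exI[of _ j'],
      intro conjI, (rule assms)+, rule exI[of _ a], rule exI[of _ b], rule exI[of _ c], rule exI[of _ d],
      intro conjI, (rule assms)+)

section \<open>Rigidity of effective crossings\<close>

context alt_walk
begin

text \<open>Of the four arcs cut out by the chords, two opposite ones form with them an alternating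
  walk in which the chords stand in for \<open>v\<close>; the colour of \<open>t\<close> decides
  which two. Since chords are not edges of the walk, \<open>subwalk\<close> leaves only the case
  that no edge of \<open>u\<close> remains outside. The other two arcs begin and end with edges of
  \<open>v\<close> and are therefore single edges.\<close>

lemma crossing_tight:
  assumes ord: "t < t'" "t' < j" "j < j'" "j' < L"
    and par: "even (t + j)" "even (t' + j')" "odd (t + t')"
    and e: "{vs ! t, vs ! j} \<in> E" "{vs ! t, vs ! j} \<notin> cycle_edges vs"
    and e': "{vs ! t', vs ! j'} \<in> E" "{vs ! t', vs ! j'} \<notin> cycle_edges vs"
  shows "even (t + c) \<Longrightarrow> j = Suc t' \<and> t = 0 \<and> Suc j' = L"
    and "odd (t + c) \<Longrightarrow> t' = Suc t \<and> j' = Suc j"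
proof -
  let ?q = "single {vs ! t, vs ! j} (1::nat) + single {vs ! t', vs ! j'} 1"
  let ?J = "{t..<t'} \<union> {j..<j'}"
  have J: "?J \<subseteq> {..<L}" using ord by auto
  have qE: "keys ?q \<subseteq> E" using e e' by (simp add: keys_plus_nat)
  have s: "sg t' = - sg t" "sg j = sg t" "sg j' = - sg t"
    using sg_odd[of t t'] sg_even[of t j] sg_odd[of t j'] par by auto
  have bdJ: "bd ?J x = sg t * int (Adeg ?q x)" for x
  proof -
    have "bd ?J x = bd {t..<t'} x + bd {j..<j'} x" by (rule bd_Un) (use ord in auto)
    moreover have "int (Adeg ?q x) = dl t x + dl j x + (dl t' x + dl j' x)"
      using Adeg_edge[of t j x] Adeg_edge[of t' j' x] ord e e' by simp
    ultimately show ?thesis using ord s by (simp add: bd_arc algebra_simps)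
  qed
  have no: "?q \<noteq> mon A" if "A \<subseteq> {..<L}" for A
  proof
    assume "?q = mon A"
    then have "keys ?q = keys (mon A)" by simp
    also have "\<dots> \<subseteq> cycle_edges vs"
      using that finite_subset[OF that] by (subst keys_mon) (auto simp: cycle_edges_def)
    finally show False using e by (simp add: keys_plus_nat)
  qed
  show "j = Suc t' \<and> t = 0 \<and> Suc j' = L" if c: "even (t + c)"
  proof -
    have all: "n \<in> ?J" if "n < L" "even (n + c)" for n
    proof (rule ccontr)
      assume n: "n \<notin> ?J"
      have "int (Adeg ?q x) = bd ?J x" for x using bdJ[of x] c by (simp add: sg_def)
      then have "?q = mon ?J" using subwalk[of ?J ?q n] J qE that n by blast
      then show False using no[OF J] by (rule notE[rotated])
    qed
    have "even (Suc t' + c)" using par c by auto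
    then have 1: "j = Suc t'" using all[of "Suc t'"] ord by auto
    have j'c: "odd (j' + c)" using par c by auto
    then have 2: "Suc j' = L" using all[of "Suc j'"] ord by (cases "Suc j' < L") auto
    then have "odd j'" using L_even by (metis even_Suc)
    then have "even (0 + c)" using j'c by simp
    then have "t = 0" using all[of 0] L_pos ord by auto
    then show ?thesis using 1 2 by simp
  qed
  show "t' = Suc t \<and> j' = Suc j" if c: "odd (t + c)"
  proof -
    have none: "n \<notin> ?J" if "n < L" "even (n + c)" for n
    proof
      assume n: "n \<in> ?J"
      have "int (Adeg ?q x) = bd ({..<L} - ?J) x" for x
        using bdJ[of x] bd_compl[OF J, of x] c by (simp add: sg_def)
      then have "?q = mon ({..<L} - ?J)" using subwalk[of "{..<L} - ?J" ?q n] qE that n by blast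
      then show False using no[of "{..<L} - ?J"] by (metis Diff_subset)
    qed
    show ?thesis using none[of "Suc t"] none[of "Suc j"] ord par c by auto
  qed
qed

lemma swap: "min_mon E v \<Longrightarrow> alt_walk E vs (Suc c) v u"
  using E walk neq unfolding alt_walk_def u_def v_def by simp

text \<open>If \<open>v\<close> is minimal too, \<open>crossing_tight\<close> holds for both
  colourings, so all four arcs between the chord ends have length one.\<close>

lemma F4_not_both_minimal:
  assumes F4: "has_F4 E vs" and vmin: "min_mon E v"
  shows "L = 4"
proof -
  interpret sw: alt_walk E vs "Suc c" v u using swap[OF vmin] .
  have main: "L = 4"
    if ord: "t < t'" "t' < j" "j < j'" and par: "odd (t + t')"
      and ch: "is_odd_chord E vs t j" "is_odd_chord E vs t' j'" for t j t' j'
  proof -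
    have h: "j' < L" "even (t + j)" "even (t' + j')" "{vs ! t, vs ! j} \<in> E" "{vs ! t, vs ! j} \<notin> cycle_edges vs"
      "{vs ! t', vs ! j'} \<in> E" "{vs ! t', vs ! j'} \<notin> cycle_edges vs"
      using ch unfolding is_odd_chord_def is_chord_def by (auto simp: even_diff_nat split: if_splits)
    note t1 = crossing_tight[OF ord h(1-3) par h(4-7)] and t2 = sw.crossing_tight[OF ord h(1-3) par h(4-7)]
    show ?thesis using t1 t2 by (cases "even (t + c)") auto
  qed
  obtain t j t' j' where h: "is_odd_chord E vs t j" "is_odd_chord E vs t' j'" "cross_effectively t j t' j'"
    using F4 unfolding has_F4_def by blast
  have odd: "odd (t + t')"
    using h(3) unfolding cross_effectively_def by presburger
  show ?thesis using h odd main[of t t' j j'] main[of t' t j' j] unfolding cross_effectively_def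
    by (auto simp: add.commute)
qed

lemma tot_u: "2 * tot u = L"
proof -
  have "tot u = card {n. n < L \<and> even (n + c)}" by (simp add: u_def tot_sum)
  moreover have "2 * card {n. n < 2 * m \<and> even (n + c)} = 2 * m" for m
  proof (induction m)
    case (Suc m)
    have "{n. n < 2 * Suc m \<and> even (n + c)} = insert (if even c then 2 * m else Suc (2 * m)) {n. n < 2 * m \<and> even (n + c)}"
      by (auto simp: less_Suc_eq)
    then show ?case using Suc by simp
  qed simp
  moreover obtain m where "L = 2 * m" using L_even by (metis evenE)
  ultimately show ?thesis by simp
qed

end

section \<open>Every chord is an odd chord, and effective crossings give an F4\<close>

context sharp_walk
begin

lemma not_nrE:
  assumes "n < L" "\<not> nr n"
  obtains i j where "i < j" "j < L" "vs ! i = vs ! j" "n = i \<or> n = j"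
proof -
  obtain m where m: "m < L" "vs ! m = vs ! n" "m \<noteq> n" using assms unfolding nr_def by auto
  then show ?thesis using that[of m n] that[of n m] assms by (cases "m < n") auto
qed

lemma nr_eq: "nr n \<Longrightarrow> m < L \<Longrightarrow> vs ! m = vs ! n \<Longrightarrow> m = n"
  unfolding nr_def by blast

text \<open>Two neighbouring repeated positions would belong to the same pair, and the edge would be
  a loop.\<close>

lemma nr_edge:
  assumes "n < L"
  shows "nr n \<or> nr (Suc n mod L)"
proof (rule ccontr)
  assume "\<not> ?thesis"
  then have h: "\<not> nr n" "\<not> nr (Suc n mod L)" by auto
  obtain i j where ij: "i < j" "j < L" "vs ! i = vs ! j" "n = i \<or> n = j" using not_nrE[OF assms h(1)] .
  obtain i' j' where ij': "i' < j'" "j' < L" "vs ! i' = vs ! j'" "Suc n mod L = i' \<or> Suc n mod L = j'"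
    using not_nrE[OF _ h(2)] L_pos by (metis mod_less_divisor)
  have "i = i' \<and> j = j'" using repeat_unique ij ij' by blast
  then have "vs ! n = vs ! (Suc n mod L)" using ij ij' by auto
  then show False using cyc_edge_ne[OF assms] by simp
qed

text \<open>So no chord is a bridge. Without a repeat the walk is a cycle; otherwise no edge joins
  the inner to the outer part, and both ends lie on one of the two cycles through the repeated
  vertex.\<close>

lemma chord_same_block:
  assumes kl: "k < l" "l < L" "{vs ! k, vs ! l} \<in> E" "{vs ! k, vs ! l} \<notin> cycle_edges vs"
  shows "\<exists>VB EB. is_block (set vs) (cycle_edges vs) VB EB \<and> vs ! k \<in> VB \<and> vs ! l \<in> VB"
proof -
  let ?f = "\<lambda>n. vs ! (n mod L)"
  have nr: "nr k" "nr l" "even (k + l)" using chord_nr[of k l] kl by auto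
  have k2: "k + 2 \<le> l" using nr(3) kl(1) by (cases "l = Suc k") auto
  have fin: "finite (set vs)" "finite (cycle_edges vs)" by (simp_all add: cycle_edges_def)
  have steps: "{?f n, ?f (Suc n)} \<in> cycle_edges vs" for n
  proof -
    have "cyc_edge vs (n mod L) = {?f n, ?f (Suc n)}" by (simp add: cyc_edge_def mod_Suc_eq)
    then show ?thesis unfolding cycle_edges_def using L_pos by force
  qed
  have inset: "?f ` A \<subseteq> set vs" for A using L_pos by auto
  have inj: "inj_on ?f {a..<b}"
    if "b \<le> a + L" "\<And>i j. i < j \<Longrightarrow> j < L \<Longrightarrow> vs ! i = vs ! j \<Longrightarrow> (\<forall>n. a \<le> n \<and> n < b \<longrightarrow> n mod L \<noteq> i) \<or> (\<forall>n. a \<le> n \<and> n < b \<longrightarrow> n mod L \<noteq> j)" for a b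
  proof (rule inj_onI)
    fix n m assume nm: "n \<in> {a..<b}" "m \<in> {a..<b}" "?f n = ?f m"
    have "n mod L = m mod L"
    proof (rule ccontr)
      assume "n mod L \<noteq> m mod L"
      then consider "n mod L < m mod L" | "m mod L < n mod L" by linarith
      then show False
      proof cases
        case 1 then show ?thesis using that(2)[of "n mod L" "m mod L"] nm L_pos by auto
      next
        case 2 then show ?thesis using that(2)[of "m mod L" "n mod L"] nm L_pos by auto
      qed
    qed
    then have "(n - m) mod L = 0 \<and> (m - n) mod L = 0"
      by (metis diff_is_0_eq mod_0 mod_eq_dvd_iff_nat mod_greater_zero_iff_not_dvd nat_le_linear neq0_conv)
    moreover have "n - m < L" "m - n < L" using nm that(1) by auto
    ultimately show "n = m" by simp
  qed
  show ?thesis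
  proof (cases "\<exists>i j. i < j \<and> j < L \<and> vs ! i = vs ! j")
    case False
    have "inj_on ?f {0..<L}" by (rule inj) (use False in auto)
    from closed_sequence_block[OF fin _ _ this steps inset] obtain VB EB
      where "is_block (set vs) (cycle_edges vs) VB EB" "?f ` {0..<L} \<subseteq> VB"
      using k2 kl by auto
    moreover have "?f k \<in> ?f ` {0..<L}" "?f l \<in> ?f ` {0..<L}" using kl by auto
    ultimately have "?f k \<in> VB" "?f l \<in> VB" by blast+
    then have "vs ! k \<in> VB" "vs ! l \<in> VB" using kl by auto
    then show ?thesis using \<open>is_block (set vs) (cycle_edges vs) VB EB\<close> by blast
  next
    case True
    then obtain i j where ij: "i < j" "j < L" "vs ! i = vs ! j" by blast
    have ne: "k \<noteq> i" "k \<noteq> j" "l \<noteq> i" "l \<noteq> j" 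
      using nr_eq[OF nr(1), of i] nr_eq[OF nr(1), of j] nr_eq[OF nr(2), of i] nr_eq[OF nr(2), of j] ij by auto
    have uni: "i' = i \<and> j' = j" if "i' < j'" "j' < L" "vs ! i' = vs ! j'" for i' j'
      using repeat_unique[OF that ij] .
    have "vs ! n \<in> inner i j" if "i < n" "n < j" for n using that unfolding inner_def by auto
    moreover have "vs ! n \<in> outer i j" if "n < i \<or> j < n" "n < L" for n
      using that ij unfolding outer_def by auto
    ultimately have both: "(i < k \<and> k < j) = (i < l \<and> l < j)"
      using no_edge_inner_outer[OF ij] kl ne by (metis (no_types, lifting) insert_commute less_trans linorder_neqE_nat)
    show ?thesis
    proof (cases "i < k \<and> k < j")
      case True
      have "inj_on ?f {i..<j}"
      proof (rule inj)
        fix i' j' assume "i' < j'" "j' < L" "vs ! i' = vs ! j'"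
        then have "j' = j" using uni by blast
        moreover have "n mod L \<noteq> j" if "n < j" for n using that ij by simp
        ultimately show "(\<forall>n. i \<le> n \<and> n < j \<longrightarrow> n mod L \<noteq> i') \<or> (\<forall>n. i \<le> n \<and> n < j \<longrightarrow> n mod L \<noteq> j')"
          by blast
      qed (use ij in auto)
      from closed_sequence_block[OF fin _ _ this steps inset] obtain VB EB
        where "is_block (set vs) (cycle_edges vs) VB EB" "?f ` {i..<j} \<subseteq> VB"
        using k2 kl True both ij by auto
      moreover have "?f k \<in> ?f ` {i..<j}" "?f l \<in> ?f ` {i..<j}" using True both by auto
      ultimately have "?f k \<in> VB" "?f l \<in> VB" by blast+
      then have "vs ! k \<in> VB" "vs ! l \<in> VB" using kl by auto
      then show ?thesis using \<open>is_block (set vs) (cycle_edges vs) VB EB\<close> by blast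
    next
      case out: False
      have modL: "n mod L = (if n < L then n else n - L)" if "n < i + L" for n
        using that ij by (auto simp: mod_if)
      \<comment> \<open>The outer cycle, unrolled past \<open>L\<close> back to position
        \<open>i\<close>; \<open>j\<close> represents the repeated vertex.\<close>
      have "inj_on ?f {j..<i + L}"
      proof (rule inj)
        fix i' j' assume "i' < j'" "j' < L" "vs ! i' = vs ! j'"
        then have "i' = i" using uni by blast
        have "n mod L \<noteq> i" if "j \<le> n" "n < i + L" for n using that ij modL[of n] by auto
        then show "(\<forall>n. j \<le> n \<and> n < i + L \<longrightarrow> n mod L \<noteq> i') \<or> (\<forall>n. j \<le> n \<and> n < i + L \<longrightarrow> n mod L \<noteq> j')"
          using \<open>i' = i\<close> by blast
      qed (use ij in auto)
      have mem: "?f n \<in> ?f ` {j..<i + L}" "n < i \<Longrightarrow> n + L \<in> {j<..<i + L}" "j < n \<Longrightarrow> n \<in> {j<..<i + L}"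
        if "n < L" "n < i \<or> j < n" for n
        using that ij by (auto intro: image_eqI[of _ _ n] image_eqI[of _ _ "n + L"])
      have k': "k < i \<or> j < k" "l < i \<or> j < l" using out both ne by linarith+
      have "j + 2 \<le> i + L" using k' kl ij by linarith
      from closed_sequence_block[OF fin this _ \<open>inj_on ?f {j..<i + L}\<close> steps inset] obtain VB EB
        where "is_block (set vs) (cycle_edges vs) VB EB" "?f ` {j..<i + L} \<subseteq> VB"
        using ij by auto
      moreover have "?f k \<in> ?f ` {j..<i + L}" "?f l \<in> ?f ` {j..<i + L}" using mem(1) k' kl by auto
      ultimately have "?f k \<in> VB" "?f l \<in> VB" by blast+
      then have "vs ! k \<in> VB" "vs ! l \<in> VB" using kl by auto
      then show ?thesis using \<open>is_block (set vs) (cycle_edges vs) VB EB\<close> by blast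
    qed
  qed
qed

lemma odd_chordI:
  assumes "k < l" "l < L" "{vs ! k, vs ! l} \<in> E" "{vs ! k, vs ! l} \<notin> cycle_edges vs"
  shows "is_odd_chord E vs k l"
proof -
  have "even (k + l)" using chord_nr[of k l] assms by auto
  then have "even (l - k)" using assms by simp
  then have "odd (L - (l - k) + 1)" using L_even assms by simp
  then show ?thesis unfolding is_odd_chord_def is_bridge_def is_chord_def
    using assms chord_same_block[OF assms] \<open>even (l - k)\<close> by auto
qed

text \<open>The arcs of length one from \<open>crossing_tight\<close> supply the two remaining sides
  of the 4-cycle: the edges at positions \<open>j'\<close> and \<open>t'\<close>, or those at
  \<open>t\<close> and \<open>j\<close>, according to the colour of \<open>t\<close>.\<close>

lemma crossing_F4:
  assumes ord: "t < t'" "t' < j" "j < j'" "j' < L" and par: "odd (t + t')"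
    and e: "{vs ! t, vs ! j} \<in> E" "{vs ! t, vs ! j} \<notin> cycle_edges vs"
    and e': "{vs ! t', vs ! j'} \<in> E" "{vs ! t', vs ! j'} \<notin> cycle_edges vs"
  shows "has_F4 E vs"
proof -
  have nr: "nr t" "nr j" "nr t'" "nr j'" and pars: "even (t + j)" "even (t' + j')"
    using chord_nr[of t j] chord_nr[of t' j'] ord e e' by auto
  have dist: "distinct [vs ! t, vs ! t', vs ! j, vs ! j']"
    using nr_eq[OF nr(1), of t'] nr_eq[OF nr(1), of j] nr_eq[OF nr(1), of j'] nr_eq[OF nr(3), of j]
      nr_eq[OF nr(3), of j'] nr_eq[OF nr(2), of j'] ord by auto
  have oc: "is_odd_chord E vs t j" "is_odd_chord E vs t' j'" using odd_chordI ord e e' by auto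
  have cr: "cross_effectively t j t' j'" unfolding cross_effectively_def using ord par by auto
  note tight = crossing_tight[OF ord pars par e e']
  show ?thesis
  proof (cases "even (t + c)")
    case True
    then have h: "j = Suc t'" "t = 0" "Suc j' = L" using tight(1) by auto
    show ?thesis
      by (rule has_F4I[OF _ _ _ oc cr, of j' t' "vs ! j'" "vs ! t" "vs ! j" "vs ! t'"])
        (use h ord pars dist in \<open>auto simp: cyc_edge_def insert_commute\<close>)
  next
    case False
    then have h: "t' = Suc t" "j' = Suc j" using tight(2) by auto
    show ?thesis
      by (rule has_F4I[OF _ _ _ oc cr, of t j "vs ! t'" "vs ! t" "vs ! j" "vs ! j'"])
        (use h ord pars dist in \<open>auto simp: cyc_edge_def insert_commute\<close>)
  qed
qed

end

section \<open>Uniqueness of the fiber in the absence of effective crossings\<close>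

lemma even_card_involution:
  assumes "finite A" "\<And>x. x \<in> A \<Longrightarrow> g x \<in> A" "\<And>x. x \<in> A \<Longrightarrow> g x \<noteq> x" "\<And>x. x \<in> A \<Longrightarrow> g (g x) = x"
  shows "even (card A)"
  using assms
proof (induction "card A" arbitrary: A rule: less_induct)
  case less
  show ?case
  proof (cases "A = {}")
    case False
    then obtain x where x: "x \<in> A" by blast
    let ?B = "A - {x, g x}"
    have "card {x, g x} = 2" using less.prems(3)[OF x] by simp
    moreover have "{x, g x} \<subseteq> A" using x less.prems by auto
    ultimately have cA: "card A = card ?B + 2"
      using less.prems(1) by (metis card_Diff_subset card_mono finite.emptyI finite.insertI le_add_diff_inverse2)
    have "even (card ?B)"
    proof (rule less.hyps)
      show "g y \<in> ?B" if "y \<in> ?B" for y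
        using that less.prems(2)[of y] less.prems(4)[of y] less.prems(4)[OF x] by auto
    qed (use less.prems cA in auto)
    then show ?thesis using cA by simp
  qed simp
qed

lemma sum_if_card:
  assumes "finite A"
  shows "(\<Sum>n\<in>A. if P n then 1 else 0) = (of_nat (card {n\<in>A. P n}) :: 'b::semiring_1)"
  using assms by (subst sum.inter_filter[symmetric]) auto

context sharp_walk
begin

lemma parity_shift: "n < L \<Longrightarrow> odd (n + Suc n mod L)"
  using L_even by (cases "Suc n = L") (auto simp: even_Suc[symmetric] simp del: even_Suc)

lemma shift_surj:
  assumes "m < L"
  obtains n where "n < L" "Suc n mod L = m"
proof (cases m)
  case 0
  then show ?thesis using that[of "L - 1"] L_pos by simp
next
  case (Suc k)
  then show ?thesis using that[of k] assms by simp
qed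

lemma shift_inj: "n < L \<Longrightarrow> m < L \<Longrightarrow> Suc n mod L = Suc m mod L \<Longrightarrow> n = m"
  by (cases "Suc n = L"; cases "Suc m = L") auto

lemma dl_shift: "dl (Suc n) x = dl (Suc n mod L) x"
  by (simp add: dl_def)

text \<open>Every position is the end of exactly one edge of each colour, so a set closed under this
  pairing is matched perfectly by its edges. With \<open>d = c\<close> these are edges of
  \<open>u\<close>, with \<open>d = Suc c\<close> edges of \<open>v\<close>.\<close>

lemma pair_sum:
  assumes X: "X \<subseteq> {..<L}" and cl: "\<And>n. n < L \<Longrightarrow> even (n + d) \<Longrightarrow> n \<in> X \<longleftrightarrow> Suc n mod L \<in> X"
  shows "int (Adeg (mon {n\<in>X. even (n + d)}) x) = (\<Sum>n\<in>X. dl n x)"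
proof -
  let ?A = "{n\<in>X. even (n + d)}" and ?B = "{n\<in>X. odd (n + d)}"
  have fin: "finite X" using X finite_subset by blast
  have img: "?B = (\<lambda>n. Suc n mod L) ` ?A"
  proof
    show "?B \<subseteq> (\<lambda>n. Suc n mod L) ` ?A"
    proof
      fix m assume m: "m \<in> ?B"
      then obtain n where n: "n < L" "Suc n mod L = m" using shift_surj[of m] X by auto
      then have "even (n + d)" using parity_shift[of n] m by auto
      then show "m \<in> (\<lambda>n. Suc n mod L) ` ?A" using n cl[of n] m by auto
    qed
    show "(\<lambda>n. Suc n mod L) ` ?A \<subseteq> ?B"
    proof
      fix m assume "m \<in> (\<lambda>n. Suc n mod L) ` ?A"
      then obtain n where n: "n \<in> X" "even (n + d)" "m = Suc n mod L" by auto
      then have "n < L" using X by auto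
      then show "m \<in> ?B" using cl[of n] parity_shift[of n] n by auto
    qed
  qed
  have inj: "inj_on (\<lambda>n. Suc n mod L) ?A"
    by (rule inj_onI) (use shift_inj X in blast)
  have "int (Adeg (mon ?A) x) = (\<Sum>n\<in>?A. dl n x + dl (Suc n mod L) x)"
    using X by (subst Adeg_mon) (auto simp: dl_shift[symmetric])
  also have "\<dots> = (\<Sum>n\<in>?A. dl n x) + (\<Sum>n\<in>?B. dl n x)"
    unfolding img by (subst sum.reindex[OF inj]) (simp add: sum.distrib)
  also have "\<dots> = (\<Sum>n\<in>?A \<union> ?B. dl n x)"
    by (rule sum.union_disjoint[symmetric]) (use fin in auto)
  also have "?A \<union> ?B = X" by auto
  finally show ?thesis .
qed

lemma Adeg_u: "int (Adeg u x) = (\<Sum>n<L. dl n x)"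
proof -
  have "{n. n < L \<and> even (n + c)} = {n\<in>{..<L}. even (n + c)}" by auto
  then show ?thesis unfolding u_mon using pair_sum[of "{..<L}" c x] L_pos by auto
qed

lemma Adeg_u_card: "Adeg u x = card {n. n < L \<and> vs ! n = x}"
proof -
  have "int (Adeg u x) = (\<Sum>n<L. if vs ! n = x then 1 else 0)"
    unfolding Adeg_u by (rule sum.cong) (auto simp: dl_def)
  also have "\<dots> = int (card {n. n < L \<and> vs ! n = x})"
    by (subst sum_if_card) auto
  finally show ?thesis by simp
qed

lemma Adeg_u_nr: "nr n \<Longrightarrow> Adeg u (vs ! n) = 1"
proof -
  assume "nr n"
  then have "{m. m < L \<and> vs ! m = vs ! n} = {n}" unfolding nr_def by auto
  then show ?thesis by (simp add: Adeg_u_card)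
qed

lemma Adeg_u_repeat:
  assumes "i < j" "j < L" "vs ! i = vs ! j"
  shows "Adeg u (vs ! i) = 2"
proof -
  have "{m. m < L \<and> vs ! m = vs ! i} = {i, j}" using repeat_twice[OF assms] assms by auto
  then show ?thesis using assms by (simp add: Adeg_u_card)
qed

section \<open>Monomials in the fiber of \<open>u\<close>\<close>

context
  fixes p :: "'a set \<Rightarrow>\<^sub>0 nat"
  assumes pE: "keys p \<subseteq> E" and pu: "Adeg p = Adeg u"
begin

lemma p_subset: "e \<in> keys p \<Longrightarrow> e \<subseteq> set vs"
proof
  fix x assume "e \<in> keys p" "x \<in> e"
  then have "Adeg u x \<noteq> 0" unfolding pu[symmetric] Adeg_eq_0_iff by blast
  then have "{n. n < L \<and> vs ! n = x} \<noteq> {}" unfolding Adeg_u_card by (metis card.empty)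
  then show "x \<in> set vs" by auto
qed

lemma p_edge_ex:
  assumes "n < L" shows "\<exists>e\<in>keys p. vs ! n \<in> e"
proof -
  have "Adeg p (vs ! n) \<noteq> 0" unfolding pu Adeg_u_card using assms by (auto simp: card_eq_0_iff)
  then show ?thesis unfolding Adeg_eq_0_iff by auto
qed

lemma p_edge_unique: "nr n \<Longrightarrow> e \<in> keys p \<Longrightarrow> e' \<in> keys p \<Longrightarrow> vs ! n \<in> e \<Longrightarrow> vs ! n \<in> e' \<Longrightarrow> e = e'"
  using Adeg_ge_2[of e p e' "vs ! n"] Adeg_u_nr[of n] pu by fastforce

lemma p_lookup_nr: "nr n \<Longrightarrow> e \<in> keys p \<Longrightarrow> vs ! n \<in> e \<Longrightarrow> lookup p e = 1"
proof -
  assume h: "nr n" "e \<in> keys p" "vs ! n \<in> e"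
  then have "lookup p e \<le> 1" using Adeg_le[of e p "vs ! n"] Adeg_u_nr[of n] pu by simp
  moreover have "lookup p e \<noteq> 0" using h by (simp add: in_keys_iff)
  ultimately show ?thesis by simp
qed

lemma p_cycle_or_chord:
  assumes "e \<in> keys p"
  obtains (cyc) n where "n < L" "e = cyc_edge vs n"
  | (chord) k l where "k < L" "l < L" "k \<noteq> l" "e = {vs ! k, vs ! l}" "e \<notin> cycle_edges vs" "nr k" "nr l" "even (k + l)"
proof (cases "e \<in> cycle_edges vs")
  case True
  then show ?thesis using cyc unfolding cycle_edges_def by auto
next
  case False
  have "e \<in> E" using assms pE by auto
  then obtain a b where ab: "a \<noteq> b" "e = {a, b}" using graphE[OF E] by blast
  then obtain k l where "k < L" "l < L" "a = vs ! k" "b = vs ! l"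
    using p_subset[OF assms] by (metis in_set_conv_nth insert_subset)
  then show ?thesis using chord[of k l] chord_nr[of k l] ab False \<open>e \<in> E\<close> by auto
qed

text \<open>Every edge of \<open>p\<close> has an end that the walk visits only once, where the
  degree is 1.\<close>

lemma p_lookup:
  assumes "e \<in> keys p" shows "lookup p e = 1"
  using assms
proof (cases rule: p_cycle_or_chord)
  case (cyc n)
  then show ?thesis using nr_edge[of n] p_lookup_nr[of n e] p_lookup_nr[of "Suc n mod L" e] assms
    by (auto simp: cyc_edge_def)
next
  case (chord k l)
  then show ?thesis using p_lookup_nr[of k e] assms by auto
qed

end

lemma v_lookup: "e \<in> keys v \<Longrightarrow> lookup v e = 1"
  using p_lookup[OF v_E Adeg_uv] .

text \<open>Each edge of \<open>v\<close> has an end visited only once. There \<open>p\<close> needs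
  an edge too, and the only candidate in \<open>v\<close> is that edge.\<close>

lemma fiber_eq_v:
  assumes pE: "keys p \<subseteq> E" and pu: "Adeg p = Adeg u" and sub: "keys p \<subseteq> keys v"
  shows "p = v"
proof (rule poly_mapping_eqI)
  fix e
  show "lookup p e = lookup v e"
  proof (cases "e \<in> keys v")
    case True
    then obtain n where n: "n < L" "e = cyc_edge vs n" by (auto simp: keys_v)
    then obtain m where m: "nr m" "m < L" "vs ! m \<in> e"
      using nr_edge[of n] by (auto simp: cyc_edge_def nr_def)
    obtain e' where e': "e' \<in> keys p" "vs ! m \<in> e'" using p_edge_ex[OF pE pu] m by blast
    then have "e' = e" using p_edge_unique[OF v_E Adeg_uv m(1), of e' e] True sub m by blast
    then show ?thesis using p_lookup[OF pE pu] e' v_lookup True by simp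
  next
    case False
    then have "e \<notin> keys p" using sub by blast
    then show ?thesis using False by (simp add: in_keys_iff)
  qed
qed

text \<open>The edges of \<open>p\<close> outside \<open>v\<close> are chords joining positions of equal parity. The positions \<open>n\<close>
  preceded by an even number of chord ends of the colour \<open>Od\<close> form a set \<open>W\<close> closed under the
  edges of \<open>u\<close> and of \<open>p\<close>, because chords of different colours do not cross. If there is a chord,
  \<open>W\<close> is proper, so the part of \<open>u\<close> on \<open>W\<close> is a proper divisor with a nontrivial fiber.\<close>

lemma fiber_unique:
  assumes pE: "keys p \<subseteq> E" and pu: "Adeg p = Adeg u" and ne: "p \<noteq> u" and noF4: "\<not> has_F4 E vs"
  shows "p = v"
proof (rule ccontr)
  assume pv: "p \<noteq> v"
  have disj: "keys u \<inter> keys p = {}" by (rule min_mon_disjoint[OF min pE ne pu])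
  \<comment> \<open>As \<open>p\<close> shares no edge with \<open>u\<close>, these are the chords
    in \<open>p\<close>; \<open>CP\<close> collects their end positions.\<close>
  define C where "C = keys p - keys v"
  have Cne: "C \<noteq> {}" using fiber_eq_v[OF pE pu] pv unfolding C_def by blast
  have Cp: "e \<in> keys p" "e \<in> E" "e \<notin> cycle_edges vs" if "e \<in> C" for e
    using that disj keys_uv_cycle pE unfolding C_def by blast+
  have CI: "e \<in> C" if "e \<in> keys p" "e \<notin> cycle_edges vs" for e
    using that keys_uv_cycle unfolding C_def by blast
  define CP where "CP = {n. n < L \<and> (\<exists>e\<in>C. vs ! n \<in> e)}"
  have chordE: "\<exists>k l. k < L \<and> l < L \<and> k \<noteq> l \<and> e = {vs ! k, vs ! l} \<and> nr k \<and> nr l \<and> even (k + l)" if "e \<in> C" for e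
    using Cp(1)[OF that]
  proof (cases rule: p_cycle_or_chord[OF pE pu, consumes 1])
    case (1 n)
    then show ?thesis using Cp(3)[OF that] by (auto simp: cycle_edges_def)
  next
    case (2 k l)
    then show ?thesis by blast
  qed
  have CP_nr: "nr n" if n: "n \<in> CP" for n
  proof -
    obtain e where e: "e \<in> C" "vs ! n \<in> e" "n < L" using n unfolding CP_def by blast
    obtain k l where "k < L" "l < L" "e = {vs ! k, vs ! l}" "nr k" "nr l" using chordE[OF e(1)] by blast
    then show ?thesis using e nr_eq[of k n] nr_eq[of l n] by auto
  qed
  have partner: "\<exists>m. m \<in> CP \<and> m \<noteq> n \<and> {vs ! n, vs ! m} \<in> C \<and> even (n + m)" if n: "n \<in> CP" for n
  proof -
    obtain e where e: "e \<in> C" "vs ! n \<in> e" "n < L" using n unfolding CP_def by blast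
    obtain k l where kl: "k < L" "l < L" "k \<noteq> l" "e = {vs ! k, vs ! l}" "nr k" "nr l" "even (k + l)"
      using chordE[OF e(1)] by blast
    then consider "n = k" | "n = l" using e nr_eq[of k n] nr_eq[of l n] by auto
    then show ?thesis
    proof cases
      case 1 then show ?thesis using kl e unfolding CP_def by (intro exI[of _ l]) auto
    next
      case 2 then show ?thesis using kl e unfolding CP_def
        by (intro exI[of _ k]) (auto simp: insert_commute add.commute)
    qed
  qed
  \<comment> \<open>All vertices in \<open>CP\<close> have degree 1, so the chords in
    \<open>p\<close> match up the positions in \<open>CP\<close>.\<close>
  define pt where "pt n = (SOME m. m \<in> CP \<and> m \<noteq> n \<and> {vs ! n, vs ! m} \<in> C \<and> even (n + m))" for n
  have pt: "pt n \<in> CP" "pt n \<noteq> n" "{vs ! n, vs ! pt n} \<in> C" "even (n + pt n)" if "n \<in> CP" for n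
    using someI_ex[OF partner[OF that]] unfolding pt_def by blast+
  have CPL: "n < L" if "n \<in> CP" for n using that unfolding CP_def by blast
  have Cuniq: "e = e'" if "e \<in> C" "e' \<in> keys p" "vs ! n \<in> e" "vs ! n \<in> e'" "n \<in> CP" for e e' n
    using p_edge_unique[OF pE pu CP_nr[OF that(5)]] that Cp by blast
  have ptpt: "pt (pt n) = n" if n: "n \<in> CP" for n
  proof -
    have "{vs ! n, vs ! pt n} = {vs ! pt n, vs ! pt (pt n)}"
      using Cuniq[of "{vs ! n, vs ! pt n}" "{vs ! pt n, vs ! pt (pt n)}" "pt n"] pt[OF n] pt[OF pt(1)[OF n]] Cp by blast
    then have "vs ! pt (pt n) = vs ! n" by (auto simp: doubleton_eq_iff)
    then show ?thesis by (rule nr_eq[OF CP_nr[OF n] CPL[OF pt(1)[OF pt(1)[OF n]]]])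
  qed
  have cyc_notCP: "n \<notin> CP \<and> Suc n mod L \<notin> CP" if "n < L" "cyc_edge vs n \<in> keys p" for n
  proof -
    have cyc: "cyc_edge vs n \<in> cycle_edges vs" using that unfolding cycle_edges_def by auto
    have "m \<notin> CP" if m: "vs ! m \<in> cyc_edge vs n" for m
    proof
      assume mCP: "m \<in> CP"
      then obtain e where "e \<in> C" "vs ! m \<in> e" unfolding CP_def by blast
      then have "e = cyc_edge vs n" using Cuniq mCP m \<open>cyc_edge vs n \<in> keys p\<close> by blast
      then show False using Cp \<open>e \<in> C\<close> cyc by blast
    qed
    then show ?thesis by (simp add: cyc_edge_def)
  qed
  have v_edge: "\<exists>k. k < L \<and> odd (k + c) \<and> e = cyc_edge vs k" if "e \<in> keys p" "e \<notin> C" for e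
    using that unfolding C_def keys_v by auto
  have notCP_cyc: "cyc_edge vs n \<in> keys p"
    if n: "n < L" "odd (n + c)" and m: "m \<notin> CP" "m = n \<or> m = Suc n mod L" "nr m" for n m
  proof -
    have mL: "m < L" using m(3) unfolding nr_def by blast
    obtain e where e: "e \<in> keys p" "vs ! m \<in> e" using p_edge_ex[OF pE pu mL] by blast
    then have "e \<notin> C" using m(1) mL unfolding CP_def by blast
    then obtain k where k: "k < L" "odd (k + c)" "e = cyc_edge vs k" using v_edge e by blast
    then consider "vs ! k = vs ! m" | "vs ! (Suc k mod L) = vs ! m" using e by (auto simp: cyc_edge_def)
    then have "k = m \<or> Suc k mod L = m"
      by cases (use nr_eq[OF m(3)] k L_pos in auto)
    then have "k = n" using m(2) parity_shift[OF k(1)] parity_shift[OF n(1)] shift_inj[OF k(1) n(1)] k n by auto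
    then show ?thesis using k e by simp
  qed
  \<comment> \<open>At the repeated vertex \<open>p\<close> has degree 2 and no chord, hence only
    edges of \<open>v\<close>, which has one position there for each visit. Without the edge at
    \<open>n\<close> just one edge with exponent 1 would remain.\<close>
  have rep_cyc: "cyc_edge vs n \<in> keys p"
    if n: "n < L" "odd (n + c)" and m: "m = n \<or> m = Suc n mod L" "\<not> nr m" for n m
  proof (rule ccontr)
    assume no: "cyc_edge vs n \<notin> keys p"
    have mL: "m < L" using m n L_pos by auto
    obtain i j where ij: "i < j" "j < L" "vs ! i = vs ! j" "m = i \<or> m = j" using not_nrE[OF mL m(2)] .
    let ?x = "vs ! i"
    have x: "vs ! m = ?x" using ij by auto
    have A2: "Adeg p ?x = 2" using Adeg_u_repeat[OF ij(1-3)] pu by simp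
    have edges: "\<exists>k. k < L \<and> odd (k + c) \<and> k \<noteq> n \<and> e = cyc_edge vs k" if e: "e \<in> keys p" "?x \<in> e" for e
    proof -
      have "e \<notin> C"
      proof
        assume "e \<in> C"
        then have "m \<in> CP" using e x mL unfolding CP_def by auto
        then show False using CP_nr m(2) by blast
      qed
      then show ?thesis using v_edge e(1) no by blast
    qed
    have uniq: "e = e'" if ee: "e \<in> keys p" "?x \<in> e" "e' \<in> keys p" "?x \<in> e'" for e e'
    proof -
      obtain k where k: "k < L" "odd (k + c)" "k \<noteq> n" "e = cyc_edge vs k" using edges[OF ee(1,2)] by blast
      obtain k' where k': "k' < L" "odd (k' + c)" "k' \<noteq> n" "e' = cyc_edge vs k'" using edges[OF ee(3,4)] by blast
      have pos: "k = i \<or> k = j \<or> Suc k mod L = i \<or> Suc k mod L = j" if "?x \<in> cyc_edge vs k" "k < L" for k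
        using that repeat_twice[OF ij(1-3), of k] repeat_twice[OF ij(1-3), of "Suc k mod L"] L_pos
        unfolding cyc_edge_def by auto
      have oij: "odd (i + j)" using repeat_odd ij by blast
      have posk: "k = i \<or> k = j \<or> Suc k mod L = i \<or> Suc k mod L = j" using pos k ee by blast
      have posk': "k' = i \<or> k' = j \<or> Suc k' mod L = i \<or> Suc k' mod L = j" using pos k' ee by blast
      have inj: "Suc k mod L = Suc k' mod L \<Longrightarrow> k = k'" "Suc k mod L = Suc n mod L \<Longrightarrow> k = n"
        "Suc k' mod L = Suc n mod L \<Longrightarrow> k' = n" using shift_inj k k' n by blast+
      have par: "odd (k + Suc k mod L)" "odd (k' + Suc k' mod L)" "odd (n + Suc n mod L)"
        using parity_shift k k' n by blast+
      define a where "a = Suc k mod L"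
      define a' where "a' = Suc k' mod L"
      define b where "b = Suc n mod L"
      \<comment> \<open>Of the two walk edges at each visit exactly one is in \<open>v\<close>. At
        the visit \<open>m\<close> this is \<open>n\<close>, so \<open>k\<close> and
        \<open>k'\<close> both belong to the other visit.\<close>
      have "k = k'"
        using posk posk' inj par oij k(2,3) k'(2,3) n(2) m(1) ij(4)
        unfolding a_def[symmetric] a'_def[symmetric] b_def[symmetric] by (smt (verit) even_add)
      then show ?thesis using k k' by simp
    qed
    obtain e where e: "e \<in> keys p" "?x \<in> e" using A2 Adeg_eq_0_iff[of p ?x] by force
    have "{e\<in>keys p. ?x \<in> e} = {e}" using uniq e by auto
    then have "Adeg p ?x = lookup p e" unfolding Adeg_def by simp
    then show False using A2 p_lookup[OF pE pu e(1)] by simp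
  qed
  \<comment> \<open>An edge of \<open>v\<close> is either in \<open>p\<close>, with no chord at its
    ends, or both of its ends are chord ends.\<close>
  have CP_shift: "n \<in> CP \<longleftrightarrow> Suc n mod L \<in> CP" if n: "n < L" "odd (n + c)" for n
  proof -
    have "m \<in> CP \<or> cyc_edge vs n \<in> keys p" if "m = n \<or> m = Suc n mod L" for m
      using notCP_cyc[OF n, of m] rep_cyc[OF n, of m] that by blast
    then show ?thesis using cyc_notCP[OF n(1)] by blast
  qed
  \<comment> \<open>Interleaving chords whose ends have different parities cross effectively and
    give an F4.\<close>
  have nocross: "k < pt m \<and> pt m < pt k" if "k \<in> CP" "m \<in> CP" "odd (k + m)" "k < m" "m < pt k" for k m
  proof (rule ccontr)
    assume no: "\<not> ?thesis"
    note a = pt[OF that(1)] and b = pt[OF that(2)]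
    have "pt m \<noteq> k" "pt m \<noteq> pt k" using a b that(3) by auto
    then consider "pt k < pt m" | "pt m < k" using no by linarith
    then have "has_F4 E vs"
    proof cases
      case 1
      show ?thesis by (rule crossing_F4[of k m "pt k" "pt m"]) (use that 1 a b CPL Cp in auto)
    next
      case 2
      show ?thesis by (rule crossing_F4[of "pt m" k m "pt k"])
          (use that 2 a b CPL[OF a(1)] Cp[OF a(3)] Cp[OF b(3)] in \<open>auto simp: insert_commute\<close>)
    qed
    then show False using noF4 by blast
  qed
  \<comment> \<open>A position in \<open>Od\<close> is the first end of an edge of \<open>v\<close>
    missing from \<open>p\<close>. Passing such an edge is the only way to change the parity of
    \<open>cnt\<close>, that is, to enter or leave \<open>W\<close> along the walk.\<close>
  define Od where "Od = {n\<in>CP. odd (n + c)}"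
  have finCP: "finite CP" unfolding CP_def by simp
  have finO: "finite Od" unfolding Od_def using finCP by simp
  define cnt where "cnt n = card {k\<in>Od. k < n}" for n
  define W where "W = {n. n < L \<and> even (cnt n)}"
  have ptO: "pt n \<in> Od" if "n \<in> Od" for n using that pt[of n] unfolding Od_def by auto
  \<comment> \<open>\<open>pt\<close> preserves parity and so acts on \<open>Od\<close>; evenness
    makes \<open>W\<close> consistent where the walk closes up.\<close>
  have evO: "even (card Od)"
    by (rule even_card_involution[of Od pt]) (use finO ptO pt ptpt in \<open>auto simp: Od_def\<close>)
  have cnt_Suc: "cnt (Suc n) = (if n \<in> Od then Suc (cnt n) else cnt n)" for n
  proof -
    have "{k\<in>Od. k < Suc n} = (if n \<in> Od then insert n {k\<in>Od. k < n} else {k\<in>Od. k < n})"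
      by (auto simp: less_Suc_eq)
    then show ?thesis unfolding cnt_def using finO by simp
  qed
  have cnt_L: "cnt L = card Od"
    unfolding cnt_def by (rule arg_cong[of _ _ card]) (auto simp: Od_def CP_def)
  have cnt0: "cnt 0 = 0" by (simp add: cnt_def)
  have W_shift: "n \<in> W \<longleftrightarrow> Suc n mod L \<in> W" if n: "n < L" "n \<notin> Od" for n
  proof (cases "Suc n = L")
    case True
    then have "even (cnt n)" using cnt_Suc[of n] n cnt_L evO by simp
    then show ?thesis using True n cnt0 L_pos unfolding W_def by simp
  next
    case False
    then show ?thesis using n cnt_Suc[of n] unfolding W_def by simp
  qed
  have cnt_diff: "cnt b = cnt a + card {k\<in>Od. a \<le> k \<and> k < b}" if "a \<le> b" for a b
  proof -
    have "{k\<in>Od. k < b} = {k\<in>Od. k < a} \<union> {k\<in>Od. a \<le> k \<and> k < b}" using that by auto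
    then show ?thesis unfolding cnt_def using finO by (simp add: card_Un_disjoint disjoint_iff)
  qed
  have W_lt: "n \<in> W \<longleftrightarrow> pt n \<in> W" if n: "n \<in> CP" "n < pt n" for n
  proof -
    \<comment> \<open>Chords of the other parity cannot cross the chord at \<open>n\<close>, so
      those with one end between \<open>n\<close> and its partner have both ends there.\<close>
    have between: "even (card {k\<in>CP. odd (n + k) \<and> n < k \<and> k < pt n})"
    proof (rule even_card_involution[of _ pt])
      fix m assume m: "m \<in> {k\<in>CP. odd (n + k) \<and> n < k \<and> k < pt n}"
      then have mCP: "m \<in> CP" by blast
      show "pt m \<in> {k\<in>CP. odd (n + k) \<and> n < k \<and> k < pt n}"
        using nocross[OF n(1) mCP] m pt[OF mCP] by auto
      show "pt m \<noteq> m" "pt (pt m) = m" using pt(2)[OF mCP] ptpt[OF mCP] by auto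
    qed (use finCP in simp)
    have "even (card {k\<in>Od. n \<le> k \<and> k < pt n})"
    proof (cases "even (n + c)")
      case True
      then have "{k\<in>Od. n \<le> k \<and> k < pt n} = {k\<in>CP. odd (n + k) \<and> n < k \<and> k < pt n}"
        unfolding Od_def by (auto simp: le_less)
      then show ?thesis using between by simp
    next
      case False
      \<comment> \<open>Here \<open>n\<close> itself has the colour of \<open>Od\<close>. Each
        position of \<open>Od\<close> counted here is followed by a chord end of the other parity,
        which transfers the count to the set treated in \<open>between\<close>.\<close>
      have "Suc ` {k\<in>Od. n \<le> k \<and> k < pt n} = {k\<in>CP. odd (n + k) \<and> n < k \<and> k < pt n}"
      proof
        show "Suc ` {k\<in>Od. n \<le> k \<and> k < pt n} \<subseteq> {k\<in>CP. odd (n + k) \<and> n < k \<and> k < pt n}"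
        proof
          fix m assume "m \<in> Suc ` {k\<in>Od. n \<le> k \<and> k < pt n}"
          then obtain k where k: "m = Suc k" "k \<in> CP" "odd (k + c)" "n \<le> k" "k < pt n" unfolding Od_def by auto
          have "Suc k \<noteq> pt n"
          proof
            assume "Suc k = pt n"
            then have "even (n + Suc k)" using pt(4)[OF n(1)] by simp
            then show False using k False by auto
          qed
          then have "Suc k < pt n" using k by simp
          moreover have "pt n < L" using CPL pt n by blast
          ultimately show "m \<in> {k\<in>CP. odd (n + k) \<and> n < k \<and> k < pt n}"
            using CP_shift[of k] k False CPL[of k] by auto
        qed
        show "{k\<in>CP. odd (n + k) \<and> n < k \<and> k < pt n} \<subseteq> Suc ` {k\<in>Od. n \<le> k \<and> k < pt n}"
        proof
          fix m assume m: "m \<in> {k\<in>CP. odd (n + k) \<and> n < k \<and> k < pt n}"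
          then obtain k where k: "m = Suc k" by (cases m) auto
          then have "k \<in> Od" using CP_shift[of k] m False CPL[of m] unfolding Od_def by auto
          then show "m \<in> Suc ` {k\<in>Od. n \<le> k \<and> k < pt n}" using k m by auto
        qed
      qed
      then show ?thesis using between card_image[of Suc "{k\<in>Od. n \<le> k \<and> k < pt n}"] by simp
    qed
    then show ?thesis using cnt_diff[of n "pt n"] n CPL[OF n(1)] CPL[OF pt(1)[OF n(1)]] unfolding W_def by auto
  qed
  have W_pt: "n \<in> W \<longleftrightarrow> pt n \<in> W" if n: "n \<in> CP" for n
  proof (cases "n < pt n")
    case True then show ?thesis using W_lt n by blast
  next
    case False
    then have "pt n < pt (pt n)" using ptpt[OF n] pt(2)[OF n] by simp
    then show ?thesis using W_lt[OF pt(1)[OF n]] ptpt[OF n] by simp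
  qed
  define D where "D = {e\<in>C. e \<subseteq> (\<lambda>n. vs ! n) ` W}"
  define uW where "uW = mon {n\<in>W. even (n + c)}"
  define q1 where "q1 = mon {n\<in>W - CP. even (n + Suc c)}"
  \<comment> \<open>A second monomial in the fiber of \<open>uW\<close>: the edges of
    \<open>v\<close> in \<open>p\<close> and the chords in \<open>p\<close>, both restricted to
    \<open>W\<close>.\<close>
  define q where "q = q1 + (\<Sum>e\<in>D. single e 1)"
  have WL: "W \<subseteq> {..<L}" unfolding W_def by auto
  have finW: "finite W" using WL finite_subset by blast
  have finD: "finite D" unfolding D_def C_def by simp
  have uWdeg: "int (Adeg uW x) = (\<Sum>n\<in>W. dl n x)" for x
    unfolding uW_def by (rule pair_sum[OF WL]) (use W_shift in \<open>auto simp: Od_def\<close>)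
  have q1deg: "int (Adeg q1 x) = (\<Sum>n\<in>W - CP. dl n x)" for x
    unfolding q1_def
  proof (rule pair_sum)
    fix n assume n: "n < L" "even (n + Suc c)"
    then have "odd (n + c)" by simp
    then show "n \<in> W - CP \<longleftrightarrow> Suc n mod L \<in> W - CP" using CP_shift[of n] W_shift[of n] n
      unfolding Od_def by blast
  qed (use WL in auto)
  have Ddeg: "int (Adeg (\<Sum>e\<in>D. single e 1) x) = (\<Sum>n\<in>W \<inter> CP. dl n x)" for x
  proof -
    have l: "Adeg (\<Sum>e\<in>D. single e 1) x = card {e\<in>D. x \<in> e}"
      unfolding Adeg_sum Adeg_single using finD by (subst sum_if_card) auto
    have "(\<Sum>n\<in>W \<inter> CP. dl n x) = (\<Sum>n\<in>W \<inter> CP. if vs ! n = x then 1 else 0)"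
      by (rule sum.cong) (use WL in \<open>auto simp: dl_def\<close>)
    also have "\<dots> = int (card {n\<in>W \<inter> CP. vs ! n = x})"
      using finW by (subst sum_if_card) auto
    finally have r: "(\<Sum>n\<in>W \<inter> CP. dl n x) = int (card {n\<in>W \<inter> CP. vs ! n = x})" .
    have "card {e\<in>D. x \<in> e} = card {n\<in>W \<inter> CP. vs ! n = x}"
    proof (cases "\<exists>n\<in>W \<inter> CP. vs ! n = x")
      case True
      then obtain n where n: "n \<in> W" "n \<in> CP" "vs ! n = x" by blast
      have "{n\<in>W \<inter> CP. vs ! n = x} = {n}" using n nr_eq[OF CP_nr[OF n(2)]] CPL by auto
      moreover have "{e\<in>D. x \<in> e} = {{vs ! n, vs ! pt n}}"
      proof
        show "{{vs ! n, vs ! pt n}} \<subseteq> {e\<in>D. x \<in> e}"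
          using n pt[OF n(2)] W_pt[OF n(2)] unfolding D_def by auto
        show "{e\<in>D. x \<in> e} \<subseteq> {{vs ! n, vs ! pt n}}"
        proof
          fix e assume "e \<in> {e\<in>D. x \<in> e}"
          then have "e \<in> C" "vs ! n \<in> e" using n unfolding D_def by auto
          then show "e \<in> {{vs ! n, vs ! pt n}}"
            using Cuniq[of e "{vs ! n, vs ! pt n}" n] n pt[OF n(2)] Cp by blast
        qed
      qed
      ultimately show ?thesis by simp
    next
      case False
      have "{e\<in>D. x \<in> e} = {}"
      proof (rule ccontr)
        assume "{e\<in>D. x \<in> e} \<noteq> {}"
        then obtain e where e: "e \<in> C" "e \<subseteq> (\<lambda>n. vs ! n) ` W" "x \<in> e" unfolding D_def by auto
        then obtain n where n: "n \<in> W" "vs ! n = x" by auto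
        then have "n \<in> CP" using e WL unfolding CP_def by auto
        then show False using False n by blast
      qed
      moreover have "{n\<in>W \<inter> CP. vs ! n = x} = {}" using False by blast
      ultimately show ?thesis by (simp only: card.empty)
    qed
    then show ?thesis using l r by simp
  qed
  have "Adeg q x = Adeg uW x" for x
  proof -
    have "W = (W - CP) \<union> (W \<inter> CP)" by auto
    then have "(\<Sum>n\<in>W. dl n x) = (\<Sum>n\<in>W - CP. dl n x) + (\<Sum>n\<in>W \<inter> CP. dl n x)"
      using sum.Int_Diff[OF finW, of "\<lambda>n. dl n x" CP] by simp
    then have "int (Adeg q x) = int (Adeg uW x)" unfolding q_def using q1deg Ddeg uWdeg by simp
    then show ?thesis by simp
  qed
  then have deg: "Adeg q = Adeg uW" by blast
  have kq: "keys q \<subseteq> keys v \<union> C"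
    unfolding q_def keys_plus_nat q1_def using WL finW
    by (subst keys_mon, simp, subst keys_sum_single[OF finD]) (auto simp: keys_v D_def)
  then have qE: "keys q \<subseteq> E" using v_E Cp by blast
  have kuW: "keys uW \<subseteq> keys u" unfolding uW_def using WL finW by (subst keys_mon) (auto simp: keys_u)
  have "keys u \<inter> C = {}" using disj unfolding C_def by blast
  then have kdisj: "keys q \<inter> keys uW = {}" using kq kuW disjoint by blast
  have z: "0 \<in> W" using cnt0 L_pos unfolding W_def by simp
  \<comment> \<open>Position 0 lies in \<open>W\<close>; if it is not an edge of \<open>u\<close>,
    then the closing edge at \<open>L - 1\<close> is one, and it keeps \<open>L - 1\<close> in
    \<open>W\<close> together with 0.\<close>
  have "\<exists>n\<in>W. even (n + c)"
  proof (cases "even c")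
    case True then show ?thesis using z by auto
  next
    case False
    have "L - 1 \<in> W \<longleftrightarrow> Suc (L - 1) mod L \<in> W" 
      by (rule W_shift) (use False L_even L_pos in \<open>auto simp: Od_def\<close>)
    then have "L - 1 \<in> W" using z L_pos by simp
    moreover have "even (L - 1 + c)" using False L_even L_pos by auto
    ultimately show ?thesis by blast
  qed
  then have "keys uW \<noteq> {}" unfolding uW_def using finW by (subst keys_mon) auto
  then have "q \<noteq> uW" using kdisj by auto
  let ?R = "{n. n < L \<and> even (n + c)} - {n\<in>W. even (n + c)}"
  have "u = mon ({n\<in>W. even (n + c)} \<union> ?R)" unfolding u_mon by (rule arg_cong[of _ _ mon]) (use WL in auto)
  also have "\<dots> = uW + mon ?R" unfolding uW_def by (rule mon_Un) (use finW in auto)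
  finally have "mon ?R = 0" using min_monD[OF min _ qE deg \<open>q \<noteq> uW\<close>] by blast
  then have "keys (mon ?R) = {}" by simp
  then have R: "?R = {}" by (subst (asm) keys_mon) (simp_all only: image_is_empty finite_Diff finite_Collect_conjI finite_Collect_less_nat disjI1)
  obtain e where "e \<in> C" using Cne by blast
  then obtain k where k: "k \<in> CP" using chordE[of e] unfolding CP_def by blast
  have "Od \<noteq> {}"
  proof (cases "odd (k + c)")
    case True then show ?thesis using k unfolding Od_def by blast
  next
    case False
    obtain n where n: "n < L" "Suc n mod L = k" using shift_surj[OF CPL[OF k]] .
    then have "odd (n + c)" using parity_shift[of n] False by auto
    then have "n \<in> Od" using CP_shift[of n] n k unfolding Od_def by blast
    then show ?thesis by blast
  qed
  \<comment> \<open>\<open>W\<close> is left for the first time after \<open>n0\<close>, so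
    \<open>Suc n0\<close> is a position of \<open>u\<close> outside \<open>W\<close>; the partner of
    \<open>n0\<close> in \<open>Od\<close> keeps it below \<open>L\<close>.\<close>
  define n0 where "n0 = Min Od"
  have n0: "n0 \<in> Od" "\<And>k. k \<in> Od \<Longrightarrow> n0 \<le> k" unfolding n0_def using finO \<open>Od \<noteq> {}\<close> by auto
  have "{k\<in>Od. k < n0} = {}" using n0 by fastforce
  then have "cnt n0 = 0" by (simp add: cnt_def)
  then have cnt1: "cnt (Suc n0) = 1" using cnt_Suc[of n0] n0 by simp
  have "pt n0 \<in> Od" "pt n0 \<noteq> n0" using ptO pt n0 unfolding Od_def by auto
  then have "Suc n0 \<le> pt n0" using n0(2)[of "pt n0"] by simp
  then have "Suc n0 < L" using CPL[of "pt n0"] \<open>pt n0 \<in> Od\<close> \<open>pt n0 \<noteq> n0\<close> unfolding Od_def by auto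
  moreover have "even (Suc n0 + c)" using n0 unfolding Od_def by auto
  ultimately have "Suc n0 \<in> ?R" using cnt1 unfolding W_def by auto
  then show False using R by blast
qed

end

section \<open>Existence of alternating closed walks\<close>

lemma graph_edge_at:
  assumes "graph E" "e \<in> E" "p \<in> e"
  obtains q where "e = {p, q}"
  using graphE[OF assms(1,2)] assms(3) by (metis insertE insert_commute singletonD)

text \<open>Carries along the monomials \<open>U\<close> and \<open>W\<close> of the edges in the
  roles of \<open>u\<close> and \<open>v\<close>, so that a trail is compared with \<open>u\<close>
  and \<open>v\<close> by divisibility. The length counts vertices: when it is odd, an edge of
  \<open>u\<close> is next.\<close>

inductive alt_trail :: "'v set set \<Rightarrow> 'v list \<Rightarrow> ('v set \<Rightarrow>\<^sub>0 nat) \<Rightarrow> ('v set \<Rightarrow>\<^sub>0 nat) \<Rightarrow> bool" for E where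
  start: "alt_trail E [x] 0 0"
| stepU: "alt_trail E xs U W \<Longrightarrow> odd (length xs) \<Longrightarrow> {last xs, y} \<in> E \<Longrightarrow>
    alt_trail E (xs @ [y]) (U + single {last xs, y} 1) W"
| stepW: "alt_trail E xs U W \<Longrightarrow> even (length xs) \<Longrightarrow> {last xs, y} \<in> E \<Longrightarrow>
    alt_trail E (xs @ [y]) U (W + single {last xs, y} 1)"

lemma alt_trail_length:
  "alt_trail E xs U W \<Longrightarrow> xs \<noteq> [] \<and> length xs = Suc (tot U + tot W)"
  by (induction rule: alt_trail.induct) auto

lemma alt_trail_boundary:
  assumes "graph E" "alt_trail E xs U W"
  shows "int (Adeg U z) - int (Adeg W z) =
    (if hd xs = z then 1 else 0) + (if even (length xs) then 1 else - 1) * (if last xs = z then 1 else 0)"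
  using assms(2)
proof (induction rule: alt_trail.induct)
  case (stepU xs U W y)
  then have "last xs \<noteq> y" "xs \<noteq> []" using graph_irrefl[OF assms(1)] alt_trail_length by blast+
  then show ?case using stepU by auto
next
  case (stepW xs U W y)
  then have "last xs \<noteq> y" "xs \<noteq> []" using graph_irrefl[OF assms(1)] alt_trail_length by blast+
  then show ?case using stepW by auto
qed auto

definition trail_mon :: "nat \<Rightarrow> 'v list \<Rightarrow> ('v set \<Rightarrow>\<^sub>0 nat)" where
  "trail_mon d xs = (\<Sum>n\<in>{n. Suc n < length xs \<and> even (n + d)}. single {xs ! n, xs ! Suc n} 1)"

lemma trail_mon_snoc:
  assumes "xs \<noteq> []"
  shows "trail_mon d (xs @ [y]) = trail_mon d xs + (if odd (length xs + d) then single {last xs, y} 1 else 0)"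
proof -
  obtain m where m: "length xs = Suc m" using assms by (cases xs) auto
  have last: "(xs @ [y]) ! m = last xs" "(xs @ [y]) ! Suc m = y"
    using assms m by (simp_all add: nth_append last_conv_nth)
  have S: "{n. Suc n < length (xs @ [y]) \<and> even (n + d)} =
      (if even (m + d) then {m} else {}) \<union> {n. Suc n < length xs \<and> even (n + d)}"
    using m by (auto simp: less_Suc_eq)
  have "(\<Sum>n\<in>{n. Suc n < length xs \<and> even (n + d)}. single {(xs @ [y]) ! n, (xs @ [y]) ! Suc n} (1::nat)) = trail_mon d xs"
    unfolding trail_mon_def by (rule sum.cong) (auto simp: nth_append)
  then show ?thesis
    unfolding trail_mon_def[of d "xs @ [y]"] S using last m by (subst sum.union_disjoint) (auto simp: add.commute)
qed

lemma alt_trail_sums: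
  assumes "alt_trail E xs U W"
  shows "U = trail_mon 0 xs \<and> W = trail_mon 1 xs \<and> path_edges xs \<subseteq> E"
  using assms
proof (induction rule: alt_trail.induct)
  case (start x)
  then show ?case by (simp add: trail_mon_def)
next
  case (stepU xs U W y)
  then have "xs \<noteq> []" using alt_trail_length by blast
  then show ?case using stepU trail_mon_snoc[of xs _ y] by (auto simp: path_edges_append)
next
  case (stepW xs U W y)
  then have "xs \<noteq> []" using alt_trail_length by blast
  then show ?case using stepW trail_mon_snoc[of xs _ y] by (auto simp: path_edges_append)
qed

text \<open>A trail of maximal length whose two parts divide \<open>u\<close> and \<open>v\<close> is closed, because
  \<open>u\<close> and \<open>v\<close> have the same degree at its last vertex.\<close>

lemma alt_walk_exists:
  assumes E: "graph E" and min: "min_mon E u" and vE: "keys v \<subseteq> E" and deg: "Adeg v = Adeg u" and ne: "v \<noteq> u"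
  shows "\<exists>vs. alt_walk E vs 0 u v"
proof -
  have uE: "keys u \<subseteq> E" using min by (rule min_mon_keys)
  have disj: "keys u \<inter> keys v = {}" by (rule min_mon_disjoint[OF min vE ne deg])
  define S where "S = {k. \<exists>xs U W r r'. alt_trail E xs U W \<and> u = U + r \<and> v = W + r' \<and> length xs = k}"
  have "S \<subseteq> {..Suc (tot u + tot v)}" unfolding S_def using alt_trail_length by fastforce
  then have finS: "finite S" using finite_subset by blast
  have "u \<noteq> 0"
  proof
    assume "u = 0"
    then have "Adeg v = (\<lambda>_. 0)" using deg by (simp add: fun_eq_iff)
    then show False using Adeg_zero_imp_zero[OF E vE] ne \<open>u = 0\<close> by simp
  qed
  then obtain e where e: "e \<in> keys u" by fastforce
  then obtain a b where ab: "a \<noteq> b" "e = {a, b}" using graphE[OF E] uE by blast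
  obtain r where r: "u = single e 1 + r" using keys_le_split[OF e] .
  have "alt_trail E ([a] @ [b]) (0 + single {last [a], b} 1) 0"
    by (rule alt_trail.stepU[OF alt_trail.start]) (use ab e uE in auto)
  moreover have "u = (0 + single {last [a], b} 1) + r" using r ab by simp
  moreover have "v = 0 + v" by simp
  ultimately have two: "2 \<in> S" unfolding S_def by fastforce
  define k where "k = Max S"
  have "k \<in> S" unfolding k_def using finS two by (intro Max_in) auto
  then obtain xs U W r r' where tr: "alt_trail E xs U W" and u: "u = U + r" and v: "v = W + r'" and len: "length xs = k"
    unfolding S_def by blast
  have k2: "k \<ge> 2" unfolding k_def using Max_ge[OF finS two] .
  have max: "m \<le> k" if "m \<in> S" for m unfolding k_def using Max_ge[OF finS that] .
  have rE: "keys r \<subseteq> E" "keys r' \<subseteq> E" and UE: "keys U \<subseteq> keys u" "keys W \<subseteq> keys v"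
    using uE vE u v by (auto simp: keys_plus_nat)
  have bal: "Adeg U z + Adeg r z = Adeg W z + Adeg r' z" for z
    using fun_cong[OF deg, of z] u v by simp
  have edge_at: "\<exists>y s. {z, y} \<in> E \<and> t = single {z, y} 1 + s" if tz: "Adeg t z > 0" "keys t \<subseteq> E" for t :: "'a set \<Rightarrow>\<^sub>0 nat" and z
  proof -
    obtain f where f: "f \<in> keys t" "z \<in> f" using tz(1) Adeg_eq_0_iff[of t z] by auto
    then obtain y where "f = {z, y}" using graph_edge_at[OF E] tz(2) by blast
    moreover obtain s where "t = single f 1 + s" using keys_le_split[OF f(1)] .
    ultimately show ?thesis using f that(2) by blast
  qed
  note boundary = alt_trail_boundary[OF E tr]
  have oddk: "odd k"
  proof
    assume ev: "even k"
    have "Adeg r' (last xs) > 0" using boundary[of "last xs"] bal[of "last xs"] ev len by (auto split: if_splits)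
    then obtain y s where y: "{last xs, y} \<in> E" "r' = single {last xs, y} 1 + s" using edge_at rE by blast
    have "alt_trail E (xs @ [y]) U (W + single {last xs, y} 1)"
      by (rule alt_trail.stepW[OF tr]) (use ev len y in auto)
    moreover have "v = (W + single {last xs, y} 1) + s" using v y by (simp add: add.assoc)
    moreover have "length (xs @ [y]) = Suc k" using len by simp
    ultimately have "Suc k \<in> S" unfolding S_def using u by blast
    then show False using max by fastforce
  qed
  have closed: "hd xs = last xs"
  proof (rule ccontr)
    assume ne': "hd xs \<noteq> last xs"
    have "Adeg r (last xs) > 0" using boundary[of "last xs"] bal[of "last xs"] oddk len ne' by auto
    then obtain y s where y: "{last xs, y} \<in> E" "r = single {last xs, y} 1 + s" using edge_at rE by blast
    have "alt_trail E (xs @ [y]) (U + single {last xs, y} 1) W"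
      by (rule alt_trail.stepU[OF tr]) (use oddk len y in auto)
    moreover have "u = (U + single {last xs, y} 1) + s" using u y by (simp add: add.assoc)
    moreover have "length (xs @ [y]) = Suc k" using len by simp
    ultimately have "Suc k \<in> S" unfolding S_def using v by blast
    then show False using max by fastforce
  qed
  have UW: "Adeg W = Adeg U"
  proof
    fix z show "Adeg W z = Adeg U z" using boundary[of z] oddk len closed by (auto split: if_splits)
  qed
  have "W \<noteq> U"
  proof
    assume "W = U"
    then have "keys U = {}" using UE disj by blast
    then have "U = 0" "W = 0" using \<open>W = U\<close> by auto
    then show False using alt_trail_length[OF tr] k2 len by (simp add: tot_def)
  qed
  \<comment> \<open>The closed trail makes \<open>U\<close> a divisor of \<open>u\<close> with a
    nontrivial fiber, so by minimality it uses up \<open>u\<close>, and then \<open>v\<close> as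
    well.\<close>
  then have r0: "r = 0" using min_monD[OF min u _ UW] UE vE by blast
  have "Adeg r' = (\<lambda>_. 0)"
  proof
    fix z show "Adeg r' z = 0" using bal[of z] UW r0 by simp
  qed
  then have r0': "r' = 0" using Adeg_zero_imp_zero[OF E rE(2)] by blast
  define vs where "vs = butlast xs"
  obtain l where l: "k = Suc l" using k2 by (cases k) auto
  have L: "length vs = l" unfolding vs_def using len l by simp
  have nth: "vs ! n = xs ! n" if "n < l" for n using that len l unfolding vs_def by (simp add: nth_butlast)
  have xl: "xs ! l = xs ! 0"
    using closed len l by (metis hd_conv_nth last_conv_nth diff_Suc_1 length_0_conv nat.simps(3))
  have cyc: "cyc_edge vs n = {xs ! n, xs ! Suc n}" if "n < l" for n
  proof (cases "Suc n = l")
    case True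
    then show ?thesis using that L nth[of n] nth[of 0] xl by (simp add: cyc_edge_def)
  next
    case False
    then show ?thesis using that L nth[of n] nth[of "Suc n"] by (simp add: cyc_edge_def)
  qed
  note sums = alt_trail_sums[OF tr, unfolded trail_mon_def path_edges_def]
  have "alt_walk E vs 0 u v"
  proof
    show "graph E" "min_mon E u" "u \<noteq> v" using E min ne by auto
    show "is_even_closed_walk E vs"
      unfolding is_even_closed_walk_def using L l oddk k2 cyc sums len by auto
    show "u = (\<Sum>n | n < length vs \<and> even (n + 0). single (cyc_edge vs n) 1)"
      using sums u r0 L len l cyc by (auto intro!: sum.cong)
    show "v = (\<Sum>n | n < length vs \<and> odd (n + 0). single (cyc_edge vs n) 1)"
      using sums v r0' L len l cyc by (auto intro!: sum.cong)
  qed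
  then show ?thesis by blast
qed

section \<open>Cycles and bow ties\<close>

text \<open>The degree of an even cycle. The parity of the number of vertices separates this case
  from \<open>bow\<close>, where that number is odd.\<close>

definition flat :: "('v set \<Rightarrow>\<^sub>0 nat) \<Rightarrow> bool" where
  "flat u \<longleftrightarrow> even (card (\<Union>(keys u))) \<and> Adeg u = (\<lambda>z. if z \<in> \<Union>(keys u) then 1 else 0)"

text \<open>The degree of \<open>u\<close> comes from two odd cycles through \<open>x\<close>, on \<open>insert x A\<close> and \<open>insert x B\<close>;
  both edges of \<open>u\<close> at \<open>x\<close> lead into \<open>A\<close>.\<close>

definition bow :: "'v set set \<Rightarrow> ('v set \<Rightarrow>\<^sub>0 nat) \<Rightarrow> 'v \<Rightarrow> 'v set \<Rightarrow> 'v set \<Rightarrow> bool" where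
  "bow E u x A B \<longleftrightarrow> \<Union>(keys u) = insert x (A \<union> B) \<and> x \<notin> A \<and> x \<notin> B \<and> A \<inter> B = {} \<and>
     finite A \<and> finite B \<and> even (card A) \<and> even (card B) \<and>
     (\<forall>a\<in>A. \<forall>b\<in>B. {a, b} \<notin> E) \<and> (\<forall>a\<in>A. {x, a} \<in> E \<longrightarrow> {x, a} \<in> keys u) \<and>
     (\<exists>n. odd n \<and> (x, x) \<in> adjr E (insert x A) ^^ n) \<and>
     (\<forall>a\<in>A. (x, a) \<in> (adjr E (insert x A))\<^sup>*) \<and>
     Adeg u = (\<lambda>z. if z = x then 2 else if z \<in> A \<union> B then 1 else 0) \<and>
     (\<forall>a\<in>\<Union>(keys u). \<forall>b\<in>\<Union>(keys u). (a, b) \<in> (adjr E (\<Union>(keys u)))\<^sup>*)"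

lemma bowD:
  assumes "bow E u x A B"
  shows "\<Union>(keys u) = insert x (A \<union> B)" "x \<notin> A" "x \<notin> B" "A \<inter> B = {}" "finite A" "finite B"
    "even (card A)" "even (card B)" "\<And>a b. a \<in> A \<Longrightarrow> b \<in> B \<Longrightarrow> {a, b} \<notin> E"
    "\<And>a. a \<in> A \<Longrightarrow> {x, a} \<in> E \<Longrightarrow> {x, a} \<in> keys u"
    "\<exists>n. odd n \<and> (x, x) \<in> adjr E (insert x A) ^^ n"
    "\<And>a. a \<in> A \<Longrightarrow> (x, a) \<in> (adjr E (insert x A))\<^sup>*"
    "Adeg u = (\<lambda>z. if z = x then 2 else if z \<in> A \<union> B then 1 else 0)"
    "\<And>a b. a \<in> \<Union>(keys u) \<Longrightarrow> b \<in> \<Union>(keys u) \<Longrightarrow> (a, b) \<in> (adjr E (\<Union>(keys u)))\<^sup>*"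
proof -
  note h = assms[unfolded bow_def]
  show "\<Union>(keys u) = insert x (A \<union> B)" using h by (elim conjE)
  show "x \<notin> A" using h by (elim conjE)
  show "x \<notin> B" using h by (elim conjE)
  show "A \<inter> B = {}" using h by (elim conjE)
  show "finite A" using h by (elim conjE)
  show "finite B" using h by (elim conjE)
  show "even (card A)" using h by (elim conjE)
  show "even (card B)" using h by (elim conjE)
  have "\<forall>a\<in>A. \<forall>b\<in>B. {a, b} \<notin> E" using h by (elim conjE)
  then show "{a, b} \<notin> E" if "a \<in> A" "b \<in> B" for a b using that by blast
  have "\<forall>a\<in>A. {x, a} \<in> E \<longrightarrow> {x, a} \<in> keys u" using h by (elim conjE)
  then show "{x, a} \<in> keys u" if "a \<in> A" "{x, a} \<in> E" for a using that by blast
  show "\<exists>n. odd n \<and> (x, x) \<in> adjr E (insert x A) ^^ n" using h by (elim conjE)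
  have "\<forall>a\<in>A. (x, a) \<in> (adjr E (insert x A))\<^sup>*" using h by (elim conjE)
  then show "(x, a) \<in> (adjr E (insert x A))\<^sup>*" if "a \<in> A" for a using that by blast
  show "Adeg u = (\<lambda>z. if z = x then 2 else if z \<in> A \<union> B then 1 else 0)" using h by (elim conjE)
  have "\<forall>a\<in>\<Union>(keys u). \<forall>b\<in>\<Union>(keys u). (a, b) \<in> (adjr E (\<Union>(keys u)))\<^sup>*" using h by (elim conjE)
  then show "(a, b) \<in> (adjr E (\<Union>(keys u)))\<^sup>*" if "a \<in> \<Union>(keys u)" "b \<in> \<Union>(keys u)" for a b
    using that by blast
qed

context sharp_walk
begin

lemma vertices_u: "\<Union>(keys u) = set vs"
proof -
  have "x \<in> \<Union>(keys u) \<longleftrightarrow> x \<in> set vs" for x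
  proof -
    have "x \<in> \<Union>(keys u) \<longleftrightarrow> Adeg u x \<noteq> 0" by (simp only: Adeg_eq_0_iff not_not)
    also have "\<dots> \<longleftrightarrow> {n. n < L \<and> vs ! n = x} \<noteq> {}" unfolding Adeg_u_card by simp
    also have "\<dots> \<longleftrightarrow> x \<in> set vs" by (auto simp: in_set_conv_nth)
    finally show ?thesis .
  qed
  then show ?thesis by blast
qed

lemma connected_vertices: "a \<in> set vs \<Longrightarrow> b \<in> set vs \<Longrightarrow> (a, b) \<in> (adjr E (set vs))\<^sup>*"
  using walk_connected by (metis in_set_conv_nth)

lemma flat_or_repeat: "flat u \<or> (\<exists>i j. i < j \<and> j < L \<and> vs ! i = vs ! j)"
proof (rule disjCI)
  assume no: "\<not> (\<exists>i j. i < j \<and> j < L \<and> vs ! i = vs ! j)"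
  then have dist: "distinct vs" by (metis distinct_conv_nth linorder_neqE_nat)
  then have nr: "nr n" if "n < L" for n using that unfolding nr_def by (simp add: nth_eq_iff_index_eq)
  show "flat u"
    unfolding flat_def vertices_u
  proof (intro conjI ext)
    show "even (card (set vs))" using dist L_even by (simp add: distinct_card)
    fix z
    show "Adeg u z = (if z \<in> set vs then 1 else 0)"
    proof (cases "z \<in> set vs")
      case True
      then show ?thesis using Adeg_u_nr nr by (auto simp: in_set_conv_nth)
    next
      case False
      then have "Adeg u z = 0" unfolding Adeg_eq_0_iff vertices_u .
      then show ?thesis using False by simp
    qed
  qed
qed

lemma nr_outside:
  assumes ij: "i < j" "j < L" "vs ! i = vs ! j" and n: "n < L" "n \<noteq> i" "n \<noteq> j"
  shows "nr n"
proof (rule ccontr)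
  assume "\<not> nr n"
  then obtain i' j' where "i' < j'" "j' < L" "vs ! i' = vs ! j'" "n = i' \<or> n = j'" using not_nrE n by metis
  then show False using repeat_unique[OF ij] n by blast
qed

text \<open>The visits \<open>i\<close> and \<open>j\<close> have opposite parities, so both edges
  of \<open>u\<close> at the repeated vertex lead to the same side: inwards if position
  \<open>i\<close> is in \<open>u\<close>, outwards otherwise. That side becomes
  \<open>A\<close>.\<close>

lemma repeat_bow:
  assumes ij: "i < j" "j < L" "vs ! i = vs ! j"
  shows "\<exists>x A B. bow E u x A B"
proof -
  let ?x = "vs ! i" and ?I = "inner i j" and ?O = "outer i j"
  note nr = nr_outside[OF ij]
  have oij: "odd (i + j)" using repeat_odd ij by blast
  have un: "\<Union>(keys u) = insert ?x (?I \<union> ?O)" unfolding vertices_u by (rule set_vs_split[OF ij])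
  note io = inner_outer_disjoint[OF ij]
  have fin: "finite ?I" "finite ?O" unfolding inner_def outer_def by auto
  have injI: "inj_on (\<lambda>n. vs ! n) {i<..<j}"
  proof (rule inj_onI)
    fix n m assume h: "n \<in> {i<..<j}" "m \<in> {i<..<j}" "vs ! n = vs ! m"
    then have "nr m" using ij by (intro nr) auto
    then show "n = m" using nr_eq h ij by auto
  qed
  have injO: "inj_on (\<lambda>n. vs ! n) ({..<i} \<union> {j<..<L})"
  proof (rule inj_onI)
    fix n m assume h: "n \<in> {..<i} \<union> {j<..<L}" "m \<in> {..<i} \<union> {j<..<L}" "vs ! n = vs ! m"
    then have "nr m" using ij by (intro nr) auto
    then show "n = m" using nr_eq h ij by auto
  qed
  have cI: "even (card ?I)" unfolding inner_def card_image[OF injI] using oij ij by auto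
  have cO: "even (card ?O)"
  proof -
    have "card ?O = i + (L - Suc j)"
      unfolding outer_def card_image[OF injO] using ij by (subst card_Un_disjoint) auto
    then show ?thesis using oij ij L_even by auto
  qed
  have noIO: "\<forall>a\<in>?I. \<forall>b\<in>?O. {a, b} \<notin> E" using no_edge_inner_outer[OF ij] by blast
  have noOI: "\<forall>a\<in>?O. \<forall>b\<in>?I. {a, b} \<notin> E" using noIO by (metis insert_commute)
  have adegu: "Adeg u = (\<lambda>z. if z = ?x then 2 else if z \<in> ?I \<union> ?O then 1 else 0)"
  proof
    fix z
    show "Adeg u z = (if z = ?x then 2 else if z \<in> ?I \<union> ?O then 1 else 0)"
    proof (cases "z = ?x")
      case True then show ?thesis using Adeg_u_repeat[OF ij] by simp
    next
      case neq: False
      show ?thesis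
      proof (cases "z \<in> ?I \<union> ?O")
        case True
        then have "z \<in> set vs" using un vertices_u by blast
        then obtain n where n: "n < L" "z = vs ! n" by (auto simp: in_set_conv_nth)
        then have "n \<noteq> i" "n \<noteq> j" using neq ij by auto
        then show ?thesis using Adeg_u_nr[OF nr[OF n(1)]] n True neq by auto
      next
        case False
        then have "z \<notin> \<Union>(keys u)" using un neq by blast
        then show ?thesis using Adeg_eq_0_iff[of u z] False neq by simp
      qed
    qed
  qed
  have conn: "\<forall>a\<in>\<Union>(keys u). \<forall>b\<in>\<Union>(keys u). (a, b) \<in> (adjr E (\<Union>(keys u)))\<^sup>*"
    unfolding vertices_u using connected_vertices by blast
  \<comment> \<open>One of the two visits has the parity opposite to \<open>k\<close>, so
    \<open>chord_adjacent\<close> makes every edge from the repeated vertex into the walk an edge of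
    the walk.\<close>
  have xE: "\<exists>n<L. {?x, vs ! k} = cyc_edge vs n \<and> (n = m \<and> k = Suc m mod L \<or> n = k \<and> m = Suc k mod L)"
    if "{?x, vs ! k} \<in> E" "k < L" "m = i \<or> m = j" "odd (m + k)" for k m
  proof -
    have "vs ! m = ?x" "m < L" using that ij by auto
    then have "k = Suc m mod L \<or> m = Suc k mod L" using chord_adjacent[of m k] that by auto
    then show ?thesis
    proof
      assume "k = Suc m mod L"
      then show ?thesis using \<open>vs ! m = ?x\<close> \<open>m < L\<close> by (intro exI[of _ m]) (auto simp: cyc_edge_def)
    next
      assume "m = Suc k mod L"
      then show ?thesis using \<open>vs ! m = ?x\<close> that by (intro exI[of _ k]) (auto simp: cyc_edge_def)
    qed
  qed
  have keyI: "cyc_edge vs n \<in> keys u" if "n < L" "even (n + c)" for n using that by (auto simp: keys_u)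
  show ?thesis
  proof (cases "even (i + c)")
    case True
    have xA: "\<forall>a\<in>?I. {?x, a} \<in> E \<longrightarrow> {?x, a} \<in> keys u"
    proof (intro ballI impI)
      fix a assume a: "a \<in> ?I" "{?x, a} \<in> E"
      obtain k where k: "i < k" "k < j" "a = vs ! k" using innerE[OF a(1)] .
      define m where "m = (if odd (i + k) then i else j)"
      have m: "m = i \<or> m = j" "odd (m + k)" unfolding m_def using oij by auto
      have kL: "k < L" using k ij by simp
      obtain n where n: "n < L" "{?x, vs ! k} = cyc_edge vs n" "n = m \<and> k = Suc m mod L \<or> n = k \<and> m = Suc k mod L"
        using xE[OF _ kL m] a k by auto
      have "Suc k mod L = Suc k" using k ij by simp
      moreover have "Suc j mod L = Suc j \<or> Suc j mod L = 0" using ij by (cases "Suc j = L") auto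
      ultimately have "n = i \<or> n = k \<and> m = j" using n(3) m(1) k by auto
      then have "even (n + c)" using True m oij by auto
      then show "{?x, a} \<in> keys u" using keyI[OF n(1)] n k by simp
    qed
    have "\<forall>a\<in>?I. (?x, a) \<in> (adjr E (insert ?x ?I))\<^sup>*"
    proof
      fix a assume "a \<in> ?I"
      then obtain k where k: "i < k" "k < j" "a = vs ! k" by (rule innerE)
      then show "(?x, a) \<in> (adjr E (insert ?x ?I))\<^sup>*"
        using inner_closed_walk[OF ij, of i k] relpow_imp_rtrancl by fastforce
    qed
    moreover have "\<exists>n. odd n \<and> (?x, ?x) \<in> adjr E (insert ?x ?I) ^^ n" using inner_odd_walk[OF ij] by blast
    ultimately have "bow E u ?x ?I ?O"
      unfolding bow_def using un io fin cI cO noIO xA adegu conn by (intro conjI) assumption+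
    then show ?thesis by blast
  next
    case False
    then have jc: "even (j + c)" using oij by auto
    have xA: "\<forall>a\<in>?O. {?x, a} \<in> E \<longrightarrow> {?x, a} \<in> keys u"
    proof (intro ballI impI)
      fix a assume a: "a \<in> ?O" "{?x, a} \<in> E"
      obtain k where k: "k < i \<or> j < k" "k < L" "a = vs ! k" using outerE[OF a(1) ij(1,2)] .
      define m where "m = (if odd (i + k) then i else j)"
      have m: "m = i \<or> m = j" "odd (m + k)" unfolding m_def using oij by auto
      obtain n where n: "n < L" "{?x, vs ! k} = cyc_edge vs n" "n = m \<and> k = Suc m mod L \<or> n = k \<and> m = Suc k mod L"
        using xE[OF _ k(2) m] a k by auto
      have "Suc i mod L = Suc i" using ij by simp
      moreover have "Suc k mod L = Suc k \<or> Suc k mod L = 0" using k by (cases "Suc k = L") auto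
      ultimately have "n = j \<or> n = k \<and> m = i" using n(3) m(1) k ij by auto
      then have "even (n + c)" using False jc m oij by auto
      then show "{?x, a} \<in> keys u" using keyI[OF n(1)] n k by simp
    qed
    have "\<forall>a\<in>?O. (?x, a) \<in> (adjr E (insert ?x ?O))\<^sup>*"
    proof
      fix a assume "a \<in> ?O"
      then obtain k where k: "k < i \<or> j < k" "k < L" "a = vs ! k" using outerE ij by metis
      define b where "b = (if j < k then k - j else L - j + k)"
      have "(j + b) mod L = k" "b \<le> L - j + i" unfolding b_def using k ij by auto
      then show "(?x, a) \<in> (adjr E (insert ?x ?O))\<^sup>*"
        using outer_closed_walk[OF ij, of 0 b] relpow_imp_rtrancl k ij by fastforce
    qed
    moreover have "\<exists>n. odd n \<and> (?x, ?x) \<in> adjr E (insert ?x ?O) ^^ n" using outer_odd_walk[OF ij] by blast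
    moreover have "\<Union>(keys u) = insert ?x (?O \<union> ?I)" "?O \<inter> ?I = {}" using un io by auto
    moreover have "Adeg u = (\<lambda>z. if z = ?x then 2 else if z \<in> ?O \<union> ?I then 1 else 0)"
      using adegu by (simp only: Un_commute)
    ultimately have "bow E u ?x ?O ?I"
      unfolding bow_def using io fin cI cO noOI xA conn by (intro conjI) assumption+
    then show ?thesis by blast
  qed
qed

text \<open>If \<open>v = a + b\<close> and \<open>q\<close> is another monomial of the degree of
  \<open>a\<close>, then \<open>q + b\<close> is in the fiber of \<open>u\<close> and differs from
  \<open>v\<close>, so it equals \<open>u\<close>; hence \<open>b\<close> divides both
  \<open>u\<close> and \<open>v\<close>.\<close>

lemma v_minimal:
  assumes noF4: "\<not> has_F4 E vs" shows "min_mon E v"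
  unfolding min_mon_def
proof (intro conjI allI impI)
  show "nontriv E v" unfolding nontriv_def using v_E u_E neq Adeg_uv by metis
  fix a b assume h: "v = a + b \<and> nontriv E a"
  then obtain q where q: "keys q \<subseteq> E" "q \<noteq> a" "Adeg q = Adeg a" unfolding nontriv_def by blast
  have bE: "keys b \<subseteq> E" using h v_E by (auto simp: keys_plus_nat)
  have "Adeg (q + b) = Adeg u"
  proof
    fix x
    show "Adeg (q + b) x = Adeg u x" using fun_cong[OF Adeg_uv, of x] h q(3) by simp
  qed
  moreover have "q + b \<noteq> v" using h q by auto
  moreover have "keys (q + b) \<subseteq> E" using q bE by (simp add: keys_plus_nat)
  ultimately have "q + b = u" using fiber_unique noF4 by blast
  then have "keys b \<subseteq> keys u \<inter> keys v" using h by (auto simp: keys_plus_nat)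
  then show "b = 0" using disjoint by auto
qed

end

section \<open>Degrees of minimal monomials with the same vertices\<close>

lemma sharp_walkI: "alt_walk E vs c u v \<Longrightarrow> sharp_condition V E \<Longrightarrow> sharp_walk E vs c u v V"
  by (simp add: sharp_walk_def sharp_walk_axioms_def)

lemma min_mon_walk:
  assumes "graph E" "sharp_condition V E" "min_mon E u"
  obtains vs v where "sharp_walk E vs 0 u v V"
proof -
  obtain v where "keys v \<subseteq> E" "v \<noteq> u" "Adeg v = Adeg u"
    using min_mon_nontriv[OF assms(3)] unfolding nontriv_def by blast
  then obtain vs where "alt_walk E vs 0 u v" using alt_walk_exists assms by blast
  then show ?thesis using that sharp_walkI assms by blast
qed

lemma min_mon_shape:
  assumes "graph E" "sharp_condition V E" "min_mon E u"
  shows "flat u \<or> (\<exists>x A B. bow E u x A B)"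
proof -
  obtain vs v where "sharp_walk E vs 0 u v V" using min_mon_walk[OF assms] .
  then interpret sharp_walk E vs 0 u v V .
  show ?thesis using flat_or_repeat repeat_bow by blast
qed

text \<open>The edges of \<open>b\<close> would match up the vertices of \<open>insert x B\<close>, whose number is odd.\<close>

lemma bow_other_center:
  assumes E: "graph E" and bow: "bow E a x A B" and bE: "keys b \<subseteq> E" and disj: "keys a \<inter> keys b = {}"
    and un: "\<Union>(keys a) = \<Union>(keys b)" and one: "\<And>z. z \<in> insert x B \<Longrightarrow> Adeg b z = 1"
  shows False
proof -
  let ?S = "insert x B"
  have xB: "x \<notin> B" "even (card B)" "finite B" using bowD[OF bow] by simp_all
  then have finS: "finite ?S" by simp
  have "(\<Sum>z\<in>?S. Adeg b z) = card ?S" using one by simp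
  also have "\<dots> = Suc (card B)" using xB by simp
  finally have odd: "odd (\<Sum>z\<in>?S. Adeg b z)" using xB by simp
  have "(\<Sum>z\<in>?S. Adeg b z) = (\<Sum>z\<in>?S. \<Sum>e\<in>keys b. if z \<in> e then lookup b e else 0)"
    by (rule sum.cong) (auto intro!: Adeg_eq)
  also have "\<dots> = (\<Sum>e\<in>keys b. \<Sum>z\<in>?S. if z \<in> e then lookup b e else 0)" by (rule sum.swap)
  also have "\<dots> = (\<Sum>e\<in>keys b. lookup b e * card (?S \<inter> e))"
    by (rule sum.cong) (use finS in \<open>auto simp: sum.If_cases Int_def mult.commute\<close>)
  finally have sum: "(\<Sum>z\<in>?S. Adeg b z) = (\<Sum>e\<in>keys b. lookup b e * card (?S \<inter> e))" .
  have "even (card (?S \<inter> e))" if e: "e \<in> keys b" for e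
  proof -
    have eE: "e \<in> E" using e bE by blast
    obtain p q where pq: "p \<noteq> q" "e = {p, q}" using graphE[OF E eE] .
    have "e \<subseteq> \<Union>(keys a)" unfolding un using e by (rule Union_upper)
    then have "e \<subseteq> insert x (A \<union> B)" unfolding bowD(1)[OF bow] .
    have no: False if "p' \<in> ?S" "q' \<in> A" "e = {p', q'}" for p' q'
    proof (cases "p' = x")
      case True
      then have "{x, q'} \<in> keys a" using bowD(10)[OF bow that(2)] that eE by simp
      then show False using disj e that True by blast
    next
      case False
      then have "{q', p'} \<notin> E" using bowD(9)[OF bow that(2), of p'] that by simp
      then show False using eE that by (simp add: insert_commute)
    qed
    \<comment> \<open>Edges between \<open>insert x B\<close> and \<open>A\<close> can only start in
      \<open>x\<close> and belong to \<open>a\<close>, which is disjoint from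
      \<open>b\<close>.\<close>
    have "?S \<inter> e = {} \<or> ?S \<inter> e = e"
    proof (rule ccontr)
      assume h: "\<not> ?thesis"
      have "(p \<in> ?S \<and> q \<in> A) \<or> (q \<in> ?S \<and> p \<in> A)"
        using h pq \<open>e \<subseteq> insert x (A \<union> B)\<close> by auto
      then show False using no[of p q] no[of q p] pq by (auto simp: insert_commute)
    qed
    then show ?thesis using pq by auto
  qed
  then have "even (\<Sum>e\<in>keys b. lookup b e * card (?S \<inter> e))" by (intro dvd_sum) auto
  then show False using odd sum by simp
qed

text \<open>If the centres differ, each lies in the \<open>B\<close>-part of the other by
  \<open>bow_other_center\<close>. Then \<open>A\<close>, connected to \<open>x\<close> and avoiding
  \<open>y\<close>, stays in \<open>B'\<close>, so the odd closed walks on \<open>insert x A\<close>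
  and \<open>insert y A'\<close> are disjoint and lead to a forbidden subgraph.\<close>

lemma bow_same_center:
  assumes E: "graph E" and sharp: "sharp_condition V E" and a: "bow E a x A B" and b: "bow E b y A' B'"
    and aE: "keys a \<subseteq> E" and bE: "keys b \<subseteq> E" and disj: "keys a \<inter> keys b = {}" and un: "\<Union>(keys a) = \<Union>(keys b)"
  shows "x = y"
proof (rule ccontr)
  assume xy: "x \<noteq> y"
  let ?W = "\<Union>(keys a)"
  have aW: "?W = insert x (A \<union> B)" "x \<notin> A" "x \<notin> B" "A \<inter> B = {}"
    and bW: "?W = insert y (A' \<union> B')" "y \<notin> A'" "y \<notin> B'" "A' \<inter> B' = {}"
    using bowD[OF a] bowD[OF b] un by simp_all
  have center: "y \<in> B"
    if E: "graph E" and a: "bow E a x A B" and b: "bow E b y A' B'" and bE: "keys b \<subseteq> E"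
      and disj: "keys a \<inter> keys b = {}" and un: "\<Union>(keys a) = \<Union>(keys b)" and xy: "x \<noteq> y"
    for a b x y and A B A' B' :: "'a set"
  proof (rule ccontr)
    assume yB: "y \<notin> B"
    have un': "insert x (A \<union> B) = insert y (A' \<union> B')" using bowD(1)[OF a] bowD(1)[OF b] un by simp
    have "Adeg b z = 1" if z: "z \<in> insert x B" for z
    proof -
      have "z \<noteq> y" using z yB xy by blast
      moreover have "z \<in> A' \<union> B'" using un' z calculation by blast
      ultimately show ?thesis unfolding bowD(13)[OF b] by simp
    qed
    then show False using bow_other_center[OF E a bE disj un] by blast
  qed
  have yB: "y \<in> B" by (rule center[OF E a b bE disj un xy])
  have xB': "x \<in> B'" by (rule center[OF E b a aE _ un[symmetric] xy[symmetric]]) (use disj in blast)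
  have noA: "{p, q} \<notin> E" if "p \<in> A" "q \<in> B" for p q using bowD(9)[OF a that] .
  have noA': "{p, q} \<notin> E" if "p \<in> A'" "q \<in> B'" for p q using bowD(9)[OF b that] .
  have AB': "A \<subseteq> B'"
  proof
    fix z assume "z \<in> A"
    then have "(x, z) \<in> (adjr E (insert x A))\<^sup>*" by (rule bowD(12)[OF a])
    then show "z \<in> B'"
    proof (induction rule: rtrancl_induct)
      case (step p q)
      then have q: "q \<in> insert x A" "{p, q} \<in> E" unfolding adjr_def by auto
      then have "q \<noteq> y" using yB xy aW by blast
      moreover have "q \<notin> A'" using noA'[of q p] step q by (auto simp: insert_commute)
      moreover have "q \<in> ?W" using q aW by blast
      ultimately show ?case using bW by blast
    qed (rule xB')
  qed
  obtain n where n: "odd n" "(x, x) \<in> adjr E (insert x A) ^^ n" using bowD(11)[OF a] by blast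
  obtain m where m: "odd m" "(y, y) \<in> adjr E (insert y A') ^^ m" using bowD(11)[OF b] by blast
  have "\<not> sharp_condition V E"
  proof (rule not_sharpI[OF E _ _ _ insertI1 insertI1 n m, of ?W])
    show "insert x A \<subseteq> ?W" "insert y A' \<subseteq> ?W" using aW bW by blast+
    have "y \<notin> A" using yB aW(4) by auto
    moreover have "A' \<inter> A = {}" "x \<notin> A'" using AB' xB' bW(4) by auto
    ultimately show "insert x A \<inter> insert y A' = {}" using xy by auto
    show "(x, y) \<in> (adjr E ?W)\<^sup>*" using bowD(14)[OF a, of x y] aW bW by auto
  next
    fix e assume e: "e \<in> E" "e \<subseteq> ?W" "e \<inter> (insert x A - {x}) \<noteq> {}"
    then obtain p where p: "p \<in> A" "p \<in> e" by auto
    obtain q where "e = {p, q}" using graph_edge_at[OF E e(1) p(2)] .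
    then show "e \<subseteq> insert x A" using noA[OF p(1), of q] p e aW(1) by auto
  next
    fix e assume e: "e \<in> E" "e \<subseteq> ?W" "e \<inter> (insert y A' - {y}) \<noteq> {}"
    then obtain p where p: "p \<in> A'" "p \<in> e" by auto
    obtain q where "e = {p, q}" using graph_edge_at[OF E e(1) p(2)] .
    then show "e \<subseteq> insert y A'" using noA'[OF p(1), of q] p e bW(1) by auto
  qed
  then show False using sharp by simp
qed

text \<open>The degree is determined by the vertex set and, for a bow tie, the centre; the parity of
  the number of vertices tells which case applies.\<close>

lemma min_mon_same_degree:
  assumes E: "graph E" and sharp: "sharp_condition V E" and a: "min_mon E a" and b: "min_mon E b"
    and disj: "keys a \<inter> keys b = {}" and un: "\<Union>(keys a) = \<Union>(keys b)"
  shows "Adeg a = Adeg b"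
proof -
  have aE: "keys a \<subseteq> E" and bE: "keys b \<subseteq> E" using a b min_mon_keys by auto
  have odd: "odd (card (\<Union>(keys u)))" if "bow E u x A B" for u x A B
  proof -
    have "\<Union>(keys u) = insert x (A \<union> B)" "x \<notin> A \<union> B" "finite (A \<union> B)" "card (A \<union> B) = card A + card B"
      "even (card A)" "even (card B)"
      using bowD[OF that] card_Un_disjoint[of A B] by simp_all
    then show ?thesis by simp
  qed
  consider "flat a" "flat b" | x A B y A' B' where "bow E a x A B" "bow E b y A' B'"
    | x A B where "flat a" "bow E b x A B" | x A B where "bow E a x A B" "flat b"
    using min_mon_shape[OF E sharp a] min_mon_shape[OF E sharp b] by blast
  then show ?thesis
  proof cases
    case 1
    then show ?thesis using un unfolding flat_def by metis
  next
    case 2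
    then have "x = y" using bow_same_center[OF E sharp _ _ aE bE disj un] by blast
    have un': "insert x (A \<union> B) = insert y (A' \<union> B')" using bowD(1)[OF 2(1)] bowD(1)[OF 2(2)] un by simp
    have "(z \<in> A \<union> B) = (z \<in> A' \<union> B')" if "z \<noteq> x" for z using un' that \<open>x = y\<close> by blast
    then show ?thesis unfolding bowD(13)[OF 2(1)] bowD(13)[OF 2(2)] using \<open>x = y\<close> by auto
  next
    case 3
    then show ?thesis using odd[OF 3(2)] un unfolding flat_def by metis
  next
    case 4
    then show ?thesis using odd[OF 4(1)] un unfolding flat_def by metis
  qed
qed

lemma min_mon_squarefree:
  assumes "graph E" "sharp_condition V E" "min_mon E u"
  shows "lookup u e \<le> 1"
proof -
  obtain vs v where "sharp_walk E vs 0 u v V" using min_mon_walk[OF assms] .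
  then interpret sharp_walk E vs 0 u v V .
  show ?thesis by (rule squarefree)
qed

text \<open>Exponents are at most 1, so inclusion of supports is divisibility.\<close>

lemma min_mon_keys_subset:
  assumes "graph E" "sharp_condition V E" "min_mon E a" "min_mon E b" "keys a \<subseteq> keys b"
  shows "a = b"
proof -
  have "lookup a e \<le> lookup b e" for e
  proof (cases "e \<in> keys a")
    case True
    then have "e \<in> keys b" using assms(5) by blast
    then have "lookup b e \<noteq> 0" by (simp add: in_keys_iff)
    then show ?thesis using min_mon_squarefree[OF assms(1-3), of e] by linarith
  qed (simp add: in_keys_iff)
  then obtain r where r: "b = a + r" using le_split by metis
  then have "r = 0" using assms(3,4) unfolding min_mon_def by blast
  then show ?thesis using r by simp
qed

section \<open>The complex of minimal supports\<close>

text \<open>Supports of distinct minimal monomials are incomparable, so each of them is already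
  inclusion-minimal.\<close>

lemma T_min_iff:
  fixes K :: "'k::field itself"
  assumes E: "graph E" and sharp: "sharp_condition V E"
  shows "T \<in> T_min K E \<longleftrightarrow> (\<exists>u. min_mon E u \<and> keys u = T)"
proof -
  have "\<not> (\<exists>u'. min_mon E u' \<and> keys u' \<subset> keys u)" if "min_mon E u" for u
    using min_mon_keys_subset[OF E sharp _ that] by blast
  then show ?thesis unfolding T_min_def indispensable_iff_min_mon[OF E] mem_Collect_eq by blast
qed

definition fiber_supports :: "'v set set \<Rightarrow> ('v set \<Rightarrow>\<^sub>0 nat) \<Rightarrow> 'v set set set" where
  "fiber_supports E u = {keys b | b. min_mon E b \<and> Adeg b = Adeg u}"

lemma cancel_common:
  fixes m1 m2 :: "'a \<Rightarrow>\<^sub>0 nat"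
  obtains n1 n2 r where "m1 = n1 + r" "m2 = n2 + r" "keys n1 \<inter> keys n2 = {}"
proof
  \<comment> \<open>With truncated subtraction, \<open>m1 - (m1 - m2)\<close> is the gcd of the two
    monomials.\<close>
  show "m1 = (m1 - m2) + (m1 - (m1 - m2))"
    by (rule poly_mapping_eqI) (simp add: lookup_add lookup_minus)
  show "m2 = (m2 - m1) + (m1 - (m1 - m2))"
    by (rule poly_mapping_eqI) (simp add: lookup_add lookup_minus)
  show "keys (m1 - m2) \<inter> keys (m2 - m1) = {}"
    by (auto simp: in_keys_iff lookup_minus)
qed

text \<open>After cancelling their gcd, the two monomials witnessing the face still have nontrivial
  fibers. Each is divisible by a minimal monomial, which by incomparability is \<open>u\<close>,
  respectively \<open>b\<close>. So the supports survive the cancellation, are disjoint and cover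
  the same vertices, and \<open>min_mon_same_degree\<close> applies.\<close>

lemma Gamma_adj_imp:
  fixes K :: "'k::field itself"
  assumes E: "graph E" and sharp: "sharp_condition V E" and u: "min_mon E u" and adj: "Gamma_adj K E (keys u) T"
  shows "T \<in> fiber_supports E u"
proof -
  have "T \<in> T_min K E" using adj unfolding Gamma_adj_def Gamma_face_def by blast
  then obtain b where b: "min_mon E b" "keys b = T" using T_min_iff[OF E sharp] by blast
  have neq: "keys u \<noteq> T" using adj unfolding Gamma_adj_def by blast
  obtain d where "\<forall>T'\<in>{keys u, T}. \<exists>m. keys m = T' \<and> Adeg m = d"
    using adj unfolding Gamma_adj_def Gamma_face_def by blast
  then obtain m1 m2 where m: "keys m1 = keys u" "keys m2 = keys b" "Adeg m1 = Adeg m2" using b(2) by auto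
  obtain n1 n2 r where n: "m1 = n1 + r" "m2 = n2 + r" "keys n1 \<inter> keys n2 = {}" using cancel_common .
  have deg: "Adeg n1 = Adeg n2"
  proof
    fix x show "Adeg n1 x = Adeg n2 x" using fun_cong[OF m(3), of x] n by simp
  qed
  have ne: "n1 \<noteq> n2" using n m neq b by auto
  have sub: "keys n1 \<subseteq> keys u" "keys n2 \<subseteq> keys b" using m n by (auto simp: keys_plus_nat)
  have nE: "keys n1 \<subseteq> E" "keys n2 \<subseteq> E" using sub min_mon_keys[OF u] min_mon_keys[OF b(1)] by auto
  have "nontriv E n1" "nontriv E n2" using nE ne deg unfolding nontriv_def by metis+
  then obtain a1 r1 a2 r2 where a: "n1 = a1 + r1" "min_mon E a1" "n2 = a2 + r2" "min_mon E a2"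
    using min_mon_exists by metis
  have "keys a1 \<subseteq> keys u" "keys a2 \<subseteq> keys b" using a sub by (auto simp: keys_plus_nat)
  then have eq: "a1 = u" "a2 = b" using min_mon_keys_subset[OF E sharp] a u b by blast+
  have "keys u \<subseteq> keys n1" "keys b \<subseteq> keys n2" using a eq by (auto simp: keys_plus_nat)
  then have k: "keys n1 = keys u" "keys n2 = keys b" using sub by auto
  have "\<Union>(keys n1) = \<Union>(keys n2)"
  proof (rule set_eqI)
    fix x
    have "x \<in> \<Union>(keys n1) \<longleftrightarrow> Adeg n1 x \<noteq> 0" by (simp only: Adeg_eq_0_iff not_not)
    also have "\<dots> \<longleftrightarrow> x \<in> \<Union>(keys n2)" by (simp only: deg Adeg_eq_0_iff not_not)
    finally show "x \<in> \<Union>(keys n1) \<longleftrightarrow> x \<in> \<Union>(keys n2)" .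
  qed
  then have "Adeg u = Adeg b" using min_mon_same_degree[OF E sharp u b(1)] n(3) unfolding k by blast
  then show ?thesis unfolding fiber_supports_def using b by auto
qed

lemma fiber_supports_face:
  fixes K :: "'k::field itself"
  assumes E: "graph E" and sharp: "sharp_condition V E" and F: "F \<subseteq> fiber_supports E u" "finite F" "F \<noteq> {}"
  shows "Gamma_face K E F"
proof -
  have "T \<in> T_min K E \<and> (\<exists>b. keys b = T \<and> Adeg b = Adeg u)" if T: "T \<in> F" for T
  proof -
    obtain b where "min_mon E b" "Adeg b = Adeg u" "T = keys b"
      using T F(1) unfolding fiber_supports_def by blast
    then show ?thesis using T_min_iff[OF E sharp] by blast
  qed
  then show ?thesis unfolding Gamma_face_def using F by blast
qed

text \<open>Adjacency preserves the degree of the minimal monomial, and conversely all supports of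
  one degree are pairwise adjacent, so one step reaches the whole component.\<close>

lemma Gamma_component:
  fixes K :: "'k::field itself"
  assumes E: "graph E" and sharp: "sharp_condition V E" and u: "min_mon E u"
  shows "{T. (Gamma_adj K E)\<^sup>*\<^sup>* (keys u) T} = fiber_supports E u"
proof
  show "{T. (Gamma_adj K E)\<^sup>*\<^sup>* (keys u) T} \<subseteq> fiber_supports E u"
  proof
    fix T assume "T \<in> {T. (Gamma_adj K E)\<^sup>*\<^sup>* (keys u) T}"
    then have "(Gamma_adj K E)\<^sup>*\<^sup>* (keys u) T" by simp
    then show "T \<in> fiber_supports E u"
    proof (induction rule: rtranclp_induct)
      case base
      then show ?case using u unfolding fiber_supports_def by blast
    next
      case (step S T)
      then obtain b where b: "min_mon E b" "Adeg b = Adeg u" "S = keys b" unfolding fiber_supports_def by blast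
      then have "T \<in> fiber_supports E b" using Gamma_adj_imp[OF E sharp b(1)] step by blast
      then show ?case using b unfolding fiber_supports_def by simp
    qed
  qed
  show "fiber_supports E u \<subseteq> {T. (Gamma_adj K E)\<^sup>*\<^sup>* (keys u) T}"
  proof
    fix T assume T: "T \<in> fiber_supports E u"
    have uu: "keys u \<in> fiber_supports E u" using u unfolding fiber_supports_def by blast
    have "T = keys u \<or> Gamma_adj K E (keys u) T"
      unfolding Gamma_adj_def using fiber_supports_face[OF E sharp, of "{keys u, T}" u] T uu by auto
    then show "T \<in> {T. (Gamma_adj K E)\<^sup>*\<^sup>* (keys u) T}" by auto
  qed
qed

lemma Gamma_components_iff:
  fixes K :: "'k::field itself"
  assumes E: "graph E" and sharp: "sharp_condition V E"
  shows "C \<in> Gamma_components K E \<longleftrightarrow> (\<exists>u. min_mon E u \<and> C = fiber_supports E u)"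
proof -
  have "C \<in> Gamma_components K E \<longleftrightarrow> (\<exists>u. min_mon E u \<and> C = {T. (Gamma_adj K E)\<^sup>*\<^sup>* (keys u) T})"
    unfolding Gamma_components_def mem_Collect_eq Bex_def T_min_iff[OF E sharp] by auto
  then show ?thesis using Gamma_component[OF E sharp] by metis
qed

section \<open>Binomials of walks and the size of a component\<close>

lemma keys_walk_binomial:
  fixes K :: "'k::field itself"
  shows "u \<in> keys (walk_binomial K vs) \<longleftrightarrow>
    (let f = (\<lambda>c. \<Sum>i\<in>{i. i < length vs \<and> even (i + c)}. single (cyc_edge vs i) 1)
     in f 0 \<noteq> f 1 \<and> (u = f 0 \<or> u = f (1::nat)))"
  unfolding walk_binomial_def Let_def keys_binomial by simp

lemma walk_binomial_walk:
  fixes K :: "'k::field itself"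
  assumes E: "graph E" and u: "min_mon E u" and walk: "is_even_closed_walk E vs" and key: "u \<in> keys (walk_binomial K vs)"
  shows "\<exists>c v. alt_walk E vs c u v"
proof -
  define f where "f c = (\<Sum>i\<in>{i. i < length vs \<and> even (i + c)}. single (cyc_edge vs i) (1::nat))" for c :: nat
  have f: "f 0 \<noteq> f 1" "u = f 0 \<or> u = f 1" using key unfolding keys_walk_binomial Let_def f_def by auto
  have odd: "(\<Sum>i\<in>{i. i < length vs \<and> odd (i + c)}. single (cyc_edge vs i) (1::nat)) = f (Suc c)" for c
    unfolding f_def by simp
  have two: "f (Suc (Suc c)) = f c" for c unfolding f_def by simp
  have "alt_walk E vs c u (f (Suc c))" if "u = f c" "u \<noteq> f (Suc c)" for c
    unfolding alt_walk_def using E walk u that odd[of c] unfolding f_def[of c] by simp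
  then show ?thesis using f two[of 0] by (metis One_nat_def)
qed

lemma walk_in_binomial:
  fixes K :: "'k::field itself"
  assumes "alt_walk E vs 0 u v"
  shows "is_even_closed_walk E vs \<and> u \<in> keys (walk_binomial K vs)"
  using assms unfolding alt_walk_def keys_walk_binomial Let_def by auto

lemma quadratic_iff_tot: "quadratic_monomial u \<longleftrightarrow> tot u = 2"
  by (simp add: quadratic_monomial_def tot_def)

context sharp_walk
begin

lemma fiber_supports_pair:
  assumes "\<not> has_F4 E vs"
  shows "fiber_supports E u = {keys u, keys v}" "keys u \<noteq> keys v"
proof -
  have vm: "min_mon E v" by (rule v_minimal[OF assms])
  have "keys b \<in> {keys u, keys v}" if "min_mon E b" "Adeg b = Adeg u" for b
    using fiber_unique[OF min_mon_keys[OF that(1)] that(2) _ assms] by blast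
  moreover have "keys u \<in> fiber_supports E u" "keys v \<in> fiber_supports E u"
    unfolding fiber_supports_def using min vm Adeg_uv by blast+
  ultimately show "fiber_supports E u = {keys u, keys v}" unfolding fiber_supports_def by blast
  have "keys u \<noteq> {}" using tot_u L_pos by (auto simp: tot_def)
  then show "keys u \<noteq> keys v" using disjoint by auto
qed

text \<open>The walk runs around four distinct vertices, so the monomials in question are perfect
  matchings of these, each fixed by the partner of one vertex \<open>w\<close>.\<close>

lemma quadratic_fiber_supports:
  assumes "tot u = 2"
  shows "finite (fiber_supports E u) \<and> card (fiber_supports E u) \<le> 3"
proof -
  have L4: "L = 4" using tot_u assms by simp
  have no_rep: "\<not> (i < j \<and> j < L \<and> vs ! i = vs ! j)" for i j
  proof
    assume ij: "i < j \<and> j < L \<and> vs ! i = vs ! j"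
    then have "odd (i + j)" using repeat_odd by blast
    moreover have "j \<noteq> Suc i" using cyc_edge_ne[of i] ij by auto
    moreover have "i < j" "j < 4" using ij L4 by auto
    \<comment> \<open>Positions 0 and 3 are neighbours in the closed walk, so this repeat would be a
      loop.\<close>
    ultimately have "i = 0 \<and> j = 3" by presburger
    then show False using cyc_edge_ne[of 3] ij L4 by auto
  qed
  then have "flat u" using flat_or_repeat by blast
  then have one: "Adeg u = (\<lambda>z. if z \<in> set vs then 1 else 0)" unfolding flat_def vertices_u by blast
  have "distinct vs" using no_rep by (metis distinct_conv_nth linorder_neqE_nat)
  then have c4: "card (set vs) = 4" using L4 distinct_card by metis
  define w where "w = vs ! 0"
  have w: "w \<in> set vs" unfolding w_def using L_pos by simp
  let ?R = "(\<lambda>z. {{w, z}, set vs - {w, z}}) ` (set vs - {w})"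
  have sub: "fiber_supports E u \<subseteq> ?R"
  proof
    fix T assume "T \<in> fiber_supports E u"
    then obtain b where b: "min_mon E b" "Adeg b = Adeg u" "T = keys b" unfolding fiber_supports_def by blast
    note bE = min_mon_keys[OF b(1)]
    have subV: "e \<subseteq> set vs" if "e \<in> keys b" for e by (rule p_subset[OF bE b(2) that])
    have ex: "\<exists>e\<in>keys b. x \<in> e" if "x \<in> set vs" for x
      using that p_edge_ex[OF bE b(2)] by (auto simp: in_set_conv_nth)
    have uniq: "e = e'" if "e \<in> keys b" "e' \<in> keys b" "x \<in> e" "x \<in> e'" for e e' x
    proof (rule ccontr)
      assume "e \<noteq> e'"
      then have "Adeg u x \<ge> 2" using Adeg_ge_2[OF that] b(2) by simp
      then show False unfolding one by (simp split: if_splits)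
    qed
    obtain e where e: "e \<in> keys b" "w \<in> e" using ex w by blast
    obtain z where z: "e = {w, z}" using graph_edge_at[OF E] e bE by blast
    have wz: "w \<noteq> z" using graph_irrefl[OF E] e bE z by blast
    have zV: "z \<in> set vs - {w}" using subV[OF e(1)] z wz by auto
    have c2: "card (set vs - {w, z}) = 2" using c4 wz w zV by (subst card_Diff_subset) auto
    have other: "e' = set vs - {w, z}" if e': "e' \<in> keys b" "e' \<noteq> e" for e'
    proof -
      have "w \<notin> e'" "z \<notin> e'" using uniq[OF e'(1) e(1)] e' z by auto
      then have "e' \<subseteq> set vs - {w, z}" using subV[OF e'(1)] by blast
      moreover have "card e' = 2" using E e'(1) bE unfolding graph_def by blast
      ultimately show ?thesis using c2 by (intro card_subset_eq) auto
    qed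
    have "set vs - {w, z} \<noteq> {}" using c2 by (metis card.empty zero_neq_numeral)
    then obtain y where y: "y \<in> set vs" "y \<notin> e" using z by blast
    then obtain e' where "e' \<in> keys b" "y \<in> e'" using ex by blast
    then have "set vs - {w, z} \<in> keys b" using other[of e'] y by auto
    then have "keys b = {{w, z}, set vs - {w, z}}" using other e z by blast
    then show "T \<in> (\<lambda>z. {{w, z}, set vs - {w, z}}) ` (set vs - {w})" using b(3) zV by blast
  qed
  have "card (set vs - {w}) = 3" using c4 w by simp
  then have "card ?R \<le> 3" using card_image_le[of "set vs - {w}" "\<lambda>z. {{w, z}, set vs - {w, z}}"] by simp
  moreover have "card (fiber_supports E u) \<le> card ?R" by (rule card_mono[OF _ sub]) simp
  moreover have "finite (fiber_supports E u)" by (rule finite_subset[OF sub]) simp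
  ultimately show ?thesis by simp
qed

end

text \<open>An F4 of a walk with both monomials minimal would force length 4, that is degree 2;
  without an F4 the fiber contains no third monomial.\<close>

lemma nonquadratic_fiber_supports:
  assumes E: "graph E" and sharp: "sharp_condition V E" and u: "min_mon E u" and nq: "\<not> quadratic_monomial u"
    and b: "min_mon E b" "Adeg b = Adeg u" "b \<noteq> u"
  obtains vs where "alt_walk E vs 0 u b" "\<not> has_F4 E vs" "fiber_supports E u = {keys u, keys b}" "keys u \<noteq> keys b"
proof -
  obtain vs where vs: "alt_walk E vs 0 u b"
    using alt_walk_exists[OF E u min_mon_keys[OF b(1)] b(2,3)] by blast
  then interpret sharp_walk E vs 0 u b V by (rule sharp_walkI[OF _ sharp])
  have "\<not> has_F4 E vs" using F4_not_both_minimal[OF _ b(1)] tot_u nq unfolding quadratic_iff_tot by auto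
  then show ?thesis using that[OF vs] fiber_supports_pair by blast
qed

theorem theorem3p11:
  fixes V :: "'v set" and E :: "'v set set" and K :: "'k::field itself"
  assumes "simple_graph V E" and "sg_connected V E" and "sharp_condition V E"
  shows "(\<forall>u. indispensable_monomial K E u \<and> \<not> quadratic_monomial u \<longrightarrow>
            ({Poly_Mapping.keys u} \<in> Gamma_components K E \<longleftrightarrow>
             (\<forall>vs. is_even_closed_walk E vs \<and> u \<in> Poly_Mapping.keys (walk_binomial K vs) \<longrightarrow> has_F4 E vs)))
       \<and> (\<forall>C\<in>Gamma_components K E.
            card C = 1 \<or> (card C = 2 \<and> Gamma_face K E C) \<or> (card C = 3 \<and> Gamma_face K E C))"
proof (intro conjI allI impI ballI)
  have E: "graph E" using assms(1) unfolding simple_graph_def graph_def by fastforce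
  note sharp = assms(3)
  note comps = Gamma_components_iff[OF E sharp, of _ K]
  {
    fix u assume "indispensable_monomial K E u \<and> \<not> quadratic_monomial u"
    then have u: "min_mon E u" and nq: "\<not> quadratic_monomial u"
      using indispensable_iff_min_mon[OF E] by blast+
    have self: "keys u \<in> fiber_supports E u" using u unfolding fiber_supports_def by blast
    show "{keys u} \<in> Gamma_components K E \<longleftrightarrow>
      (\<forall>vs. is_even_closed_walk E vs \<and> u \<in> keys (walk_binomial K vs) \<longrightarrow> has_F4 E vs)"
    proof (intro iffI allI impI)
      fix vs assume comp: "{keys u} \<in> Gamma_components K E"
        and vs: "is_even_closed_walk E vs \<and> u \<in> keys (walk_binomial K vs)"
      obtain u' where u': "min_mon E u'" "{keys u} = fiber_supports E u'" using comp comps by blast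
      then have "keys u' \<in> {keys u}" unfolding fiber_supports_def by blast
      then have "u' = u" using min_mon_keys_subset[OF E sharp u'(1) u] by blast
      obtain c v where "alt_walk E vs c u v" using walk_binomial_walk[OF E u] vs by blast
      then interpret sharp_walk E vs c u v V by (rule sharp_walkI[OF _ sharp])
      \<comment> \<open>Without an F4 the component would also contain the support of
        \<open>v\<close>.\<close>
      show "has_F4 E vs" using fiber_supports_pair u'(2) \<open>u' = u\<close> by blast
    next
      assume F4: "\<forall>vs. is_even_closed_walk E vs \<and> u \<in> keys (walk_binomial K vs) \<longrightarrow> has_F4 E vs"
      have "b = u" if b: "min_mon E b" "Adeg b = Adeg u" for b
      proof (rule ccontr)
        assume "b \<noteq> u"
        then obtain vs where "alt_walk E vs 0 u b" "\<not> has_F4 E vs"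
          by (rule nonquadratic_fiber_supports[OF E sharp u nq b])
        then show False using F4 walk_in_binomial[of E vs u b K] by blast
      qed
      then have "fiber_supports E u = {keys u}" using self unfolding fiber_supports_def by blast
      then show "{keys u} \<in> Gamma_components K E" using comps u by metis
    qed
  }
  fix C assume "C \<in> Gamma_components K E"
  then obtain u where u: "min_mon E u" and C: "C = fiber_supports E u" using comps by blast
  have self: "keys u \<in> C" using u unfolding C fiber_supports_def by blast
  have "finite C \<and> card C \<le> 3"
  proof (cases "quadratic_monomial u")
    case True
    obtain vs v where "sharp_walk E vs 0 u v V" using min_mon_walk[OF E sharp u] .
    then interpret sharp_walk E vs 0 u v V .
    show ?thesis unfolding C using quadratic_fiber_supports True quadratic_iff_tot by blast
  next
    case nq: False
    show ?thesis
    proof (cases "\<exists>b. min_mon E b \<and> Adeg b = Adeg u \<and> b \<noteq> u")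
      case True
      then obtain b where b: "min_mon E b" "Adeg b = Adeg u" "b \<noteq> u" by blast
      obtain vs where "C = {keys u, keys b}" unfolding C
        by (rule nonquadratic_fiber_supports[OF E sharp u nq b])
      then show ?thesis by (simp add: card_insert_if)
    next
      case False
      then have "C = {keys u}" using self unfolding C fiber_supports_def by blast
      then show ?thesis by simp
    qed
  qed
  moreover from this have "Gamma_face K E C"
    using fiber_supports_face[OF E sharp, of C u] self unfolding C by blast
  moreover have "card C \<noteq> 0" using calculation(1) self by auto
  ultimately show "card C = 1 \<or> (card C = 2 \<and> Gamma_face K E C) \<or> (card C = 3 \<and> Gamma_face K E C)"
    by linarith
qed

end
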